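(* Let $\mathbb{F}$ be a field of positive characteristic $p$, let $\lambda=(\lambda_1,\ldots,\lambda_\ell)\vdash n$ and let $a\geq 0$ be an integer. Then $S^aM^\lambda$ is a projective $\mathbb{F}\mathfrak{S}_n$-module if and only if either $n<p$, or both $p\nmid a$ and $\lambda_i<p$ for all $1\le i\le\ell$.
   Context: $n$ is a positive integer. $M^\lambda$ is the Young permutation module: the permutation $\mathbb{F}\mathfrak{S}_n$-module on $\lambda$-tabloids, isomorphic to the trivial module of the Young subgroup $\mathfrak{S}_\lambda$ induced to $\mathfrak{S}_n$. $S^aM$ is the $a$-th symmetric power with diagonal action; $S^0M=\mathbb{F}$ (trivial module) and $S^1M=M$. *)

theory Defs
  imports "HOL-Algebra.Module" "HOL-Algebra.AbelCoset" "HOL-Algebra.Sym_Groups" "HOL-Library.Multiset"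
begin

section \<open>Modules over a not necessarily commutative ring\<close>

text \<open>
  The locale \<^locale>\<open>module\<close> of HOL-Algebra demands a commutative ring of scalars, so unital left
  modules over an arbitrary ring are introduced here, on the same record type. The fields \<open>mult\<close> and
  \<open>one\<close>, which that type inherits from \<open>ring\<close>, play no role in a module and are left undefined.
\<close>

locale left_module = R?: ring R + M?: abelian_group M
  for R :: "('r, 'a) ring_scheme" (structure) and M :: "('r, 'm, 'b) module_scheme" (structure) +
  assumes smult_closed: "\<lbrakk>a \<in> carrier R; x \<in> carrier M\<rbrakk> \<Longrightarrow> a \<odot>\<^bsub>M\<^esub> x \<in> carrier M"
    and smult_l_distr: "\<lbrakk>a \<in> carrier R; b \<in> carrier R; x \<in> carrier M\<rbrakk> \<Longrightarrow>
      (a \<oplus> b) \<odot>\<^bsub>M\<^esub> x = a \<odot>\<^bsub>M\<^esub> x \<oplus>\<^bsub>M\<^esub> b \<odot>\<^bsub>M\<^esub> x"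
    and smult_r_distr: "\<lbrakk>a \<in> carrier R; x \<in> carrier M; y \<in> carrier M\<rbrakk> \<Longrightarrow>
      a \<odot>\<^bsub>M\<^esub> (x \<oplus>\<^bsub>M\<^esub> y) = a \<odot>\<^bsub>M\<^esub> x \<oplus>\<^bsub>M\<^esub> a \<odot>\<^bsub>M\<^esub> y"
    and smult_assoc: "\<lbrakk>a \<in> carrier R; b \<in> carrier R; x \<in> carrier M\<rbrakk> \<Longrightarrow>
      (a \<otimes> b) \<odot>\<^bsub>M\<^esub> x = a \<odot>\<^bsub>M\<^esub> (b \<odot>\<^bsub>M\<^esub> x)"
    and smult_one: "x \<in> carrier M \<Longrightarrow> \<one> \<odot>\<^bsub>M\<^esub> x = x"

definition left_module_hom ::
    "('r, 'a) ring_scheme \<Rightarrow> ('r, 'm, 'b) module_scheme \<Rightarrow> ('r, 'n, 'c) module_scheme \<Rightarrow> ('m \<Rightarrow> 'n) set"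
  where "left_module_hom R M N = {h \<in> carrier M \<rightarrow> carrier N.
    (\<forall>x\<in>carrier M. \<forall>y\<in>carrier M. h (x \<oplus>\<^bsub>M\<^esub> y) = h x \<oplus>\<^bsub>N\<^esub> h y) \<and>
    (\<forall>r\<in>carrier R. \<forall>x\<in>carrier M. h (r \<odot>\<^bsub>M\<^esub> x) = r \<odot>\<^bsub>N\<^esub> h x)}"

definition free_module :: "('r, 'a) ring_scheme \<Rightarrow> 'x set \<Rightarrow> ('r, 'x \<Rightarrow> 'r) module"
  where "free_module R S = \<lparr>
    carrier = {v \<in> S \<rightarrow>\<^sub>E carrier R. finite {x \<in> S. v x \<noteq> \<zero>\<^bsub>R\<^esub>}},
    monoid.mult = undefined, one = undefined,
    zero = (\<lambda>x\<in>S. \<zero>\<^bsub>R\<^esub>),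
    add = (\<lambda>u v. \<lambda>x\<in>S. u x \<oplus>\<^bsub>R\<^esub> v x),
    smult = (\<lambda>r v. \<lambda>x\<in>S. r \<otimes>\<^bsub>R\<^esub> v x)\<rparr>"

definition basis_vector :: "('r, 'a) ring_scheme \<Rightarrow> 'x set \<Rightarrow> 'x \<Rightarrow> ('x \<Rightarrow> 'r)"
  where "basis_vector R S x = (\<lambda>y\<in>S. if y = x then \<one>\<^bsub>R\<^esub> else \<zero>\<^bsub>R\<^esub>)"

text \<open>
  A module is projective if it is isomorphic to a direct summand of a free module. Basis sets of the
  element type of \<open>P\<close> are enough for full generality: a projective module \<open>P\<close> is a direct
  summand of the free module on the set \<open>carrier P\<close>. The predicate \<^locale>\<open>submodule\<close> of HOL-Algebra
  does not need commutativity of the ring.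
\<close>

definition projective_module :: "('r, 'a) ring_scheme \<Rightarrow> ('r, 'm, 'b) module_scheme \<Rightarrow> bool"
  where "projective_module R P \<longleftrightarrow> left_module R P \<and>
    (\<exists>(S :: 'm set) N Q.
       submodule N R (free_module R S) \<and> submodule Q R (free_module R S) \<and>
       N \<inter> Q = {\<zero>\<^bsub>free_module R S\<^esub>} \<and> N <+>\<^bsub>free_module R S\<^esub> Q = carrier (free_module R S) \<and>
       (\<exists>f \<in> left_module_hom R P (free_module R S). bij_betw f (carrier P) N))"

definition generated_submodule ::
    "('r, 'a) ring_scheme \<Rightarrow> ('r, 'm, 'b) module_scheme \<Rightarrow> 'm set \<Rightarrow> 'm set"
  where "generated_submodule R M A = \<Inter> {N. submodule N R M \<and> A \<subseteq> N}"

definition quotient_module :: "('r, 'm, 'b) module_scheme \<Rightarrow> 'm set \<Rightarrow> ('r, 'm set) module"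
  where "quotient_module M N = \<lparr>
    carrier = a_rcosets\<^bsub>M\<^esub> N,
    monoid.mult = undefined, one = undefined,
    zero = N,
    add = set_add M,
    smult = (\<lambda>r C. \<Union>x\<in>C. N +>\<^bsub>M\<^esub> (r \<odot>\<^bsub>M\<^esub> x))\<rparr>"


section \<open>Group algebras and permutation modules\<close>

text \<open>The group \<open>G\<close> is meant to be finite throughout.\<close>

definition group_algebra :: "('a, 'b) ring_scheme \<Rightarrow> ('g, 'c) monoid_scheme \<Rightarrow> ('g \<Rightarrow> 'a) ring"
  where "group_algebra F G = \<lparr>
    carrier = carrier G \<rightarrow>\<^sub>E carrier F,
    monoid.mult = (\<lambda>\<alpha> \<beta>. \<lambda>g\<in>carrier G. \<Oplus>\<^bsub>F\<^esub>h\<in>carrier G. \<alpha> h \<otimes>\<^bsub>F\<^esub> \<beta> (inv\<^bsub>G\<^esub> h \<otimes>\<^bsub>G\<^esub> g)),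
    one = (\<lambda>g\<in>carrier G. if g = \<one>\<^bsub>G\<^esub> then \<one>\<^bsub>F\<^esub> else \<zero>\<^bsub>F\<^esub>),
    zero = (\<lambda>g\<in>carrier G. \<zero>\<^bsub>F\<^esub>),
    add = (\<lambda>\<alpha> \<beta>. \<lambda>g\<in>carrier G. \<alpha> g \<oplus>\<^bsub>F\<^esub> \<beta> g)\<rparr>"

text \<open>The element \<open>c g\<close> of the group algebra, for \<open>c\<close> in \<open>F\<close> and \<open>g\<close> in \<open>G\<close>.\<close>

definition monomial :: "('a, 'b) ring_scheme \<Rightarrow> ('g, 'c) monoid_scheme \<Rightarrow> 'a \<Rightarrow> 'g \<Rightarrow> ('g \<Rightarrow> 'a)"
  where "monomial F G c g = (\<lambda>h\<in>carrier G. if h = g then c else \<zero>\<^bsub>F\<^esub>)"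

text \<open>
  For a left action \<open>act\<close> of \<open>G\<close> on \<open>S\<close>, a group element \<open>g\<close> sends the basis vector at \<open>x\<close> to the
  one at \<open>act g x\<close>, so the coefficient of \<open>g v\<close> at \<open>x\<close> is that of \<open>v\<close> at \<open>act (inv g) x\<close>.
\<close>

definition permutation_module ::
    "('a, 'b) ring_scheme \<Rightarrow> ('g, 'c) monoid_scheme \<Rightarrow> 'x set \<Rightarrow> ('g \<Rightarrow> 'x \<Rightarrow> 'x) \<Rightarrow>
     ('g \<Rightarrow> 'a, 'x \<Rightarrow> 'a) module"
  where "permutation_module F G S act = \<lparr>
    carrier = carrier (free_module F S),
    monoid.mult = undefined, one = undefined,
    zero = zero (free_module F S),
    add = add (free_module F S),
    smult = (\<lambda>\<alpha> v. \<lambda>x\<in>S. \<Oplus>\<^bsub>F\<^esub>g\<in>carrier G. \<alpha> g \<otimes>\<^bsub>F\<^esub> v (act (inv\<^bsub>G\<^esub> g) x))\<rparr>"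


section \<open>Symmetric powers\<close>

text \<open>
  The symmetric power \<open>S\<^sup>a M\<close> of a module \<open>M\<close> over the group algebra \<open>F G\<close>, formed over \<open>F\<close> and
  with diagonal \<open>G\<close>-action, is the \<open>F\<close>-vector space with basis \<open>M\<^sup>a\<close> (lists of length \<open>a\<close>) modulo
  the relations that make the class of \<open>(m\<^sub>1, \<dots>, m\<^sub>a)\<close> multilinear over \<open>F\<close> and symmetric, that is,
  the quotient of the tensor power over \<open>F\<close> by the commutativity relations. \<open>F\<close> acts on \<open>M\<close> through
  its embedding into \<open>F G\<close>.
\<close>

definition tuples :: "('r, 'm, 'b) module_scheme \<Rightarrow> nat \<Rightarrow> 'm list set"
  where "tuples M a = {ms. length ms = a \<and> set ms \<subseteq> carrier M}"

definition tuple_module ::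
    "('a, 'b) ring_scheme \<Rightarrow> ('g, 'c) monoid_scheme \<Rightarrow> nat \<Rightarrow> ('g \<Rightarrow> 'a, 'm, 'd) module_scheme \<Rightarrow>
     ('g \<Rightarrow> 'a, 'm list \<Rightarrow> 'a) module"
  where "tuple_module F G a M =
    permutation_module F G (tuples M a) (\<lambda>g. map (\<lambda>m. monomial F G \<one>\<^bsub>F\<^esub> g \<odot>\<^bsub>M\<^esub> m))"

definition symmetric_power_relations ::
    "('a, 'b) ring_scheme \<Rightarrow> ('g, 'c) monoid_scheme \<Rightarrow> nat \<Rightarrow> ('g \<Rightarrow> 'a, 'm, 'd) module_scheme \<Rightarrow>
     ('m list \<Rightarrow> 'a) set"
  where "symmetric_power_relations F G a M =
    (let T = tuple_module F G a M;
         e = basis_vector F (tuples M a);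
         scalar = (\<lambda>c. monomial F G c \<one>\<^bsub>G\<^esub>)
     in {e (us @ (x \<oplus>\<^bsub>M\<^esub> y) # vs) \<ominus>\<^bsub>T\<^esub> (e (us @ x # vs) \<oplus>\<^bsub>T\<^esub> e (us @ y # vs)) | us x y vs.
            us @ x # vs \<in> tuples M a \<and> y \<in> carrier M}
      \<union> {e (us @ (scalar c \<odot>\<^bsub>M\<^esub> x) # vs) \<ominus>\<^bsub>T\<^esub> scalar c \<odot>\<^bsub>T\<^esub> e (us @ x # vs) | us c x vs.
            us @ x # vs \<in> tuples M a \<and> c \<in> carrier F}
      \<union> {e us \<ominus>\<^bsub>T\<^esub> e vs | us vs. us \<in> tuples M a \<and> vs \<in> tuples M a \<and> mset us = mset vs})"

text \<open>
  \<open>G\<close> permutes the relations, so the \<open>F G\<close>-submodule that they generate is just their \<open>F\<close>-span.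
\<close>

definition symmetric_power ::
    "('a, 'b) ring_scheme \<Rightarrow> ('g, 'c) monoid_scheme \<Rightarrow> nat \<Rightarrow> ('g \<Rightarrow> 'a, 'm, 'd) module_scheme \<Rightarrow>
     ('g \<Rightarrow> 'a, ('m list \<Rightarrow> 'a) set) module"
  where "symmetric_power F G a M =
    quotient_module (tuple_module F G a M)
      (generated_submodule (group_algebra F G) (tuple_module F G a M)
         (symmetric_power_relations F G a M))"


section \<open>Young permutation modules\<close>

definition partition_of :: "nat list \<Rightarrow> nat \<Rightarrow> bool"
  where "partition_of lam n \<longleftrightarrow> sorted_wrt (\<ge>) lam \<and> 0 \<notin> set lam \<and> sum_list lam = n"

text \<open>A tabloid is given by the list of its rows, each row being the set of its entries.\<close>

definition tabloids :: "nat \<Rightarrow> nat list \<Rightarrow> nat set list set"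
  where "tabloids n lam = {t. length t = length lam \<and>
    (\<forall>i<length lam. card (t ! i) = lam ! i) \<and>
    (\<forall>i<length lam. \<forall>j<length lam. i \<noteq> j \<longrightarrow> t ! i \<inter> t ! j = {}) \<and>
    \<Union> (set t) = {1..n}}"

definition young_module ::
    "('a, 'b) ring_scheme \<Rightarrow> nat \<Rightarrow> nat list \<Rightarrow> ((nat \<Rightarrow> nat) \<Rightarrow> 'a, nat set list \<Rightarrow> 'a) module"
  where "young_module F n lam =
    permutation_module F (sym_group n) (tabloids n lam) (\<lambda>\<sigma>. map (image \<sigma>))"


section \<open>Characteristic\<close>

definition has_positive_char :: "('a, 'b) ring_scheme \<Rightarrow> nat \<Rightarrow> bool"
  where "has_positive_char F p \<longleftrightarrow> p > 0 \<and> [p] \<cdot>\<^bsub>F\<^esub> \<one>\<^bsub>F\<^esub> = \<zero>\<^bsub>F\<^esub> \<and>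
    (\<forall>q. 0 < q \<and> q < p \<longrightarrow> [q] \<cdot>\<^bsub>F\<^esub> \<one>\<^bsub>F\<^esub> \<noteq> \<zero>\<^bsub>F\<^esub>)"

end

theory Submission
  imports Defs
begin

text \<open>
  The symmetric power of a permutation module on a basis \<open>\<Omega>\<close> is the permutation module on the set
  \<open>X\<close> of multisets of size \<open>a\<close> in \<open>\<Omega>\<close>. If it is projective, then no element of order \<open>p\<close> fixes a
  multiset: such a fixed basis vector would be a norm, whereas norms have coefficient \<open>0\<close> there. For
  \<open>n \<ge> p\<close> a \<open>p\<close>-cycle fixes the multiset consisting of \<open>a/p\<close> copies of one of its orbits if \<open>p\<close>
  divides \<open>a\<close>, and \<open>a\<close> copies of one tabloid if some row has at least \<open>p\<close> entries.

  Conversely, projectivity follows from a function \<open>m\<close> on \<open>X\<close> whose sum over the translates of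
  every point is the same constant \<open>K\<close>, not divisible by \<open>p\<close>. If \<open>n < p\<close>, take \<open>m = 1\<close> and
  \<open>K = n!\<close>. Otherwise let \<open>m\<close> be the multiplicity of a fixed tabloid: since the symmetric group acts
  transitively on tabloids, \<open>K = a \<lambda>\<^sub>1! \<dots> \<lambda>\<^sub>\<ell>!\<close>.
\<close>

section \<open>Finite sums\<close>

lemma (in abelian_monoid) finsum_swap:
  assumes "finite A" "finite B" "\<And>a b. a \<in> A \<Longrightarrow> b \<in> B \<Longrightarrow> f a b \<in> carrier G"
  shows "(\<Oplus>a\<in>A. \<Oplus>b\<in>B. f a b) = (\<Oplus>b\<in>B. \<Oplus>a\<in>A. f a b)"
  using assms(1,3)
proof (induction A rule: finite_induct)
  case empty
  then show ?case by (simp add: finsum_zero)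
next
  case (insert x A)
  have x: "f x \<in> B \<rightarrow> carrier G" and A: "(\<lambda>b. \<Oplus>a\<in>A. f a b) \<in> B \<rightarrow> carrier G"
    using insert by (auto intro!: finsum_closed)
  have "(\<Oplus>a\<in>insert x A. \<Oplus>b\<in>B. f a b) = (\<Oplus>b\<in>B. f x b) \<oplus> (\<Oplus>a\<in>A. \<Oplus>b\<in>B. f a b)"
    using insert by (intro finsum_insert) (auto intro!: finsum_closed)
  also have "\<dots> = (\<Oplus>b\<in>B. f x b) \<oplus> (\<Oplus>b\<in>B. \<Oplus>a\<in>A. f a b)"
    using insert by simp
  also have "\<dots> = (\<Oplus>b\<in>B. f x b \<oplus> (\<Oplus>a\<in>A. f a b))"
    using finsum_addf[OF x A] by simp
  also have "\<dots> = (\<Oplus>b\<in>B. \<Oplus>a\<in>insert x A. f a b)"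
    using insert by (intro finsum_cong') (auto intro!: finsum_closed finsum_insert[symmetric])
  finally show ?case .
qed

lemma (in abelian_monoid) finsum_bij:
  assumes "bij_betw f A B" "\<And>b. b \<in> B \<Longrightarrow> g b \<in> carrier G"
  shows "(\<Oplus>a\<in>A. g (f a)) = (\<Oplus>b\<in>B. g b)"
  using finsum_reindex[of g f A] assms by (auto simp: bij_betw_def)

lemma (in abelian_monoid) finsum_delta:
  assumes "finite A" "i \<in> A" "c \<in> carrier G"
  shows "(\<Oplus>j\<in>A. if j = i then c else \<zero>) = c"
proof -
  have "(\<Oplus>j\<in>A. if i = j then c else \<zero>) = c"
    using assms by (intro finsum_singleton[of i A "\<lambda>_. c"]) auto
  then show ?thesis by (simp add: eq_commute)
qed

lemma (in abelian_group) add_minus_cancel: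
  assumes "x \<in> carrier G" "y \<in> carrier G"
  shows "x \<oplus> (y \<ominus> x) = y"
proof -
  have "x \<oplus> (y \<ominus> x) = (x \<oplus> \<ominus> x) \<oplus> y"
    using assms a_comm[of y "\<ominus> x"] a_assoc[of x "\<ominus> x" y] by (simp add: a_minus_def)
  then show ?thesis using assms by (simp add: r_neg)
qed

section \<open>Left modules\<close>

context left_module
begin

lemma smult_zero: "a \<in> carrier R \<Longrightarrow> a \<odot>\<^bsub>M\<^esub> \<zero>\<^bsub>M\<^esub> = \<zero>\<^bsub>M\<^esub>"
  by (metis M.add.r_cancel_one' M.r_zero M.zero_closed smult_closed smult_r_distr)

lemma zero_smult: "x \<in> carrier M \<Longrightarrow> \<zero> \<odot>\<^bsub>M\<^esub> x = \<zero>\<^bsub>M\<^esub>"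
  by (metis M.add.r_cancel_one' R.r_zero R.zero_closed smult_closed smult_l_distr)

lemma minus_one_smult:
  assumes "x \<in> carrier M"
  shows "(\<ominus> \<one>) \<odot>\<^bsub>M\<^esub> x = \<ominus>\<^bsub>M\<^esub> x"
proof -
  have "(\<ominus> \<one>) \<odot>\<^bsub>M\<^esub> x \<oplus>\<^bsub>M\<^esub> x = (\<ominus> \<one> \<oplus> \<one>) \<odot>\<^bsub>M\<^esub> x"
    using assms by (subst smult_l_distr) (auto simp: smult_one)
  also have "\<dots> = \<zero>\<^bsub>M\<^esub>"
    using assms by (simp add: R.l_neg zero_smult)
  finally show ?thesis
    using assms by (intro M.minus_equality[symmetric]) (auto intro: smult_closed)
qed

lemma submodule_criterion:
  assumes "H \<subseteq> carrier M" "\<zero>\<^bsub>M\<^esub> \<in> H"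
    and "\<And>x y. x \<in> H \<Longrightarrow> y \<in> H \<Longrightarrow> x \<oplus>\<^bsub>M\<^esub> y \<in> H"
    and "\<And>a x. a \<in> carrier R \<Longrightarrow> x \<in> H \<Longrightarrow> a \<odot>\<^bsub>M\<^esub> x \<in> H"
  shows "submodule H R M"
proof (intro submodule.intro subgroup.intro submodule_axioms.intro)
  fix x assume "x \<in> H"
  moreover have "(\<ominus> \<one>) \<odot>\<^bsub>M\<^esub> x \<in> H"
    using assms(4) \<open>x \<in> H\<close> by simp
  ultimately show "inv\<^bsub>add_monoid M\<^esub> x \<in> H"
    using minus_one_smult[of x] assms(1) by (auto simp: a_inv_def)
qed (use assms in auto)

end

lemma submoduleD:
  assumes "submodule N R M"
  shows "N \<subseteq> carrier M" "\<zero>\<^bsub>M\<^esub> \<in> N"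
    and "\<And>x y. x \<in> N \<Longrightarrow> y \<in> N \<Longrightarrow> x \<oplus>\<^bsub>M\<^esub> y \<in> N"
    and "\<And>a x. a \<in> carrier R \<Longrightarrow> x \<in> N \<Longrightarrow> a \<odot>\<^bsub>M\<^esub> x \<in> N"
    and "\<And>x. x \<in> N \<Longrightarrow> \<ominus>\<^bsub>M\<^esub> x \<in> N"
proof -
  interpret submodule N R M by fact
  show "N \<subseteq> carrier M" "\<zero>\<^bsub>M\<^esub> \<in> N"
    and "\<And>x y. x \<in> N \<Longrightarrow> y \<in> N \<Longrightarrow> x \<oplus>\<^bsub>M\<^esub> y \<in> N"
    and "\<And>a x. a \<in> carrier R \<Longrightarrow> x \<in> N \<Longrightarrow> a \<odot>\<^bsub>M\<^esub> x \<in> N"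
    using subset one_closed m_closed smult_closed by auto
  show "\<And>x. x \<in> N \<Longrightarrow> \<ominus>\<^bsub>M\<^esub> x \<in> N"
    using m_inv_closed by (simp add: a_inv_def)
qed

lemma left_module_homD:
  assumes "h \<in> left_module_hom R M N"
  shows "\<And>x. x \<in> carrier M \<Longrightarrow> h x \<in> carrier N"
    and "\<And>x y. x \<in> carrier M \<Longrightarrow> y \<in> carrier M \<Longrightarrow> h (x \<oplus>\<^bsub>M\<^esub> y) = h x \<oplus>\<^bsub>N\<^esub> h y"
    and "\<And>r x. r \<in> carrier R \<Longrightarrow> x \<in> carrier M \<Longrightarrow> h (r \<odot>\<^bsub>M\<^esub> x) = r \<odot>\<^bsub>N\<^esub> h x"
  using assms by (auto simp: left_module_hom_def)

lemma left_module_homI: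
  assumes "\<And>x. x \<in> carrier M \<Longrightarrow> h x \<in> carrier N"
    and "\<And>x y. x \<in> carrier M \<Longrightarrow> y \<in> carrier M \<Longrightarrow> h (x \<oplus>\<^bsub>M\<^esub> y) = h x \<oplus>\<^bsub>N\<^esub> h y"
    and "\<And>r x. r \<in> carrier R \<Longrightarrow> x \<in> carrier M \<Longrightarrow> h (r \<odot>\<^bsub>M\<^esub> x) = r \<odot>\<^bsub>N\<^esub> h x"
  shows "h \<in> left_module_hom R M N"
  using assms by (auto simp: left_module_hom_def)

lemma left_module_hom_comp:
  assumes "f \<in> left_module_hom R M N" "g \<in> left_module_hom R N L"
  shows "g \<circ> f \<in> left_module_hom R M L"
  using assms by (auto simp: left_module_hom_def Pi_iff)

lemma left_module_hom_zero:
  assumes "left_module R M" "left_module R N" "h \<in> left_module_hom R M N"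
  shows "h \<zero>\<^bsub>M\<^esub> = \<zero>\<^bsub>N\<^esub>"
proof -
  interpret M: left_module R M by fact
  interpret N: left_module R N by fact
  note h = left_module_homD[OF assms(3)]
  have "h \<zero>\<^bsub>M\<^esub> \<oplus>\<^bsub>N\<^esub> h \<zero>\<^bsub>M\<^esub> = h \<zero>\<^bsub>M\<^esub>"
    using h(2)[of "\<zero>\<^bsub>M\<^esub>" "\<zero>\<^bsub>M\<^esub>"] by simp
  then show ?thesis
    by (metis M.M.zero_closed N.M.add.r_cancel_one h(1))
qed

lemma left_module_hom_minus:
  assumes "left_module R M" "left_module R N" "h \<in> left_module_hom R M N"
    and "x \<in> carrier M" "y \<in> carrier M"
  shows "h (x \<ominus>\<^bsub>M\<^esub> y) = h x \<ominus>\<^bsub>N\<^esub> h y"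
proof -
  interpret M: left_module R M by fact
  interpret N: left_module R N by fact
  note h = left_module_homD[OF assms(3)]
  have "h (\<ominus>\<^bsub>M\<^esub> y) = \<ominus>\<^bsub>N\<^esub> h y"
    using h(3)[of "\<ominus>\<^bsub>R\<^esub> \<one>\<^bsub>R\<^esub>" y] h(1)[of y] assms(5) M.minus_one_smult N.minus_one_smult by simp
  then show ?thesis
    using h(2) assms(4,5) by (simp add: a_minus_def)
qed

lemma left_module_hom_kernel:
  assumes "left_module R M" "left_module R N" "h \<in> left_module_hom R M N"
  shows "submodule {x \<in> carrier M. h x = \<zero>\<^bsub>N\<^esub>} R M"
proof -
  interpret M: left_module R M by fact
  interpret N: left_module R N by fact
  show ?thesis
    by (rule M.submodule_criterion)
      (auto simp: left_module_hom_zero[OF assms] left_module_homD[OF assms(3)] M.smult_closed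
        N.smult_zero)
qed

lemma left_module_hom_image:
  assumes "left_module R M" "left_module R N" "h \<in> left_module_hom R M N"
  shows "submodule (h ` carrier M) R N"
proof -
  interpret M: left_module R M by fact
  interpret N: left_module R N by fact
  note h = left_module_homD[OF assms(3)]
  show ?thesis
  proof (rule N.submodule_criterion)
    show "\<zero>\<^bsub>N\<^esub> \<in> h ` carrier M"
      using left_module_hom_zero[OF assms] by (intro image_eqI[of _ _ "\<zero>\<^bsub>M\<^esub>"]) simp_all
  next
    fix x y assume "x \<in> h ` carrier M" "y \<in> h ` carrier M"
    then obtain u v where "u \<in> carrier M" "x = h u" "v \<in> carrier M" "y = h v" by blast
    then show "x \<oplus>\<^bsub>N\<^esub> y \<in> h ` carrier M"
      by (intro image_eqI[of _ _ "u \<oplus>\<^bsub>M\<^esub> v"]) (simp_all add: h(2))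
  next
    fix r x assume "r \<in> carrier R" "x \<in> h ` carrier M"
    then obtain u where "u \<in> carrier M" "x = h u" by blast
    with \<open>r \<in> carrier R\<close> show "r \<odot>\<^bsub>N\<^esub> x \<in> h ` carrier M"
      by (intro image_eqI[of _ _ "r \<odot>\<^bsub>M\<^esub> u"]) (simp_all add: h(3) M.smult_closed)
  qed (use h(1) in auto)
qed

lemma left_module_transfer:
  assumes "left_module R U" "bij_betw k (carrier U) (carrier P)" "k \<zero>\<^bsub>U\<^esub> = \<zero>\<^bsub>P\<^esub>"
    and k: "k \<in> left_module_hom R U P"
  shows "left_module R P"
proof -
  interpret U: left_module R U by fact
  note k = left_module_homD[OF k]
  have surj: "\<exists>u\<in>carrier U. x = k u" if "x \<in> carrier P" for x
    using assms(2) that by (auto simp: bij_betw_def)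
  have "abelian_group P"
  proof (rule abelian_groupI)
    fix x assume "x \<in> carrier P"
    then obtain u where "u \<in> carrier U" "x = k u" using surj by blast
    then show "\<zero>\<^bsub>P\<^esub> \<oplus>\<^bsub>P\<^esub> x = x" "\<exists>y\<in>carrier P. y \<oplus>\<^bsub>P\<^esub> x = \<zero>\<^bsub>P\<^esub>"
      using k(2)[of "\<zero>\<^bsub>U\<^esub>" u] k(2)[of "\<ominus>\<^bsub>U\<^esub> u" u] k(1)[of "\<ominus>\<^bsub>U\<^esub> u"] assms(3)
      by (auto simp: U.M.l_neg)
  next
    fix x y z assume "x \<in> carrier P" "y \<in> carrier P" "z \<in> carrier P"
    then obtain u v w where "u \<in> carrier U" "x = k u" "v \<in> carrier U" "y = k v"
      "w \<in> carrier U" "z = k w"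
      using surj by meson
    then show "x \<oplus>\<^bsub>P\<^esub> y \<oplus>\<^bsub>P\<^esub> z = x \<oplus>\<^bsub>P\<^esub> (y \<oplus>\<^bsub>P\<^esub> z)"
      by (simp add: k(2)[symmetric] U.M.a_assoc)
  next
    fix x y assume "x \<in> carrier P" "y \<in> carrier P"
    then obtain u v where "u \<in> carrier U" "x = k u" "v \<in> carrier U" "y = k v"
      using surj by meson
    then show "x \<oplus>\<^bsub>P\<^esub> y = y \<oplus>\<^bsub>P\<^esub> x" "x \<oplus>\<^bsub>P\<^esub> y \<in> carrier P"
      using k(1)[of "u \<oplus>\<^bsub>U\<^esub> v"] by (auto simp: k(2)[symmetric] U.M.a_comm)
  next
    show "\<zero>\<^bsub>P\<^esub> \<in> carrier P"
      using k(1) assms(3) by force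
  qed
  then show ?thesis
  proof (intro left_module.intro left_module_axioms.intro)
    fix a b x assume ab: "a \<in> carrier R" "b \<in> carrier R" "x \<in> carrier P"
    then obtain u where "u \<in> carrier U" "x = k u" using surj by blast
    with ab show "(a \<oplus>\<^bsub>R\<^esub> b) \<odot>\<^bsub>P\<^esub> x = a \<odot>\<^bsub>P\<^esub> x \<oplus>\<^bsub>P\<^esub> b \<odot>\<^bsub>P\<^esub> x"
      "(a \<otimes>\<^bsub>R\<^esub> b) \<odot>\<^bsub>P\<^esub> x = a \<odot>\<^bsub>P\<^esub> (b \<odot>\<^bsub>P\<^esub> x)"
      by (simp_all add: k(2,3)[symmetric] U.smult_l_distr U.smult_assoc U.smult_closed)
  next
    fix a x y assume ab: "a \<in> carrier R" "x \<in> carrier P" "y \<in> carrier P"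
    then obtain u v where "u \<in> carrier U" "x = k u" "v \<in> carrier U" "y = k v"
      using surj by meson
    with ab show "a \<odot>\<^bsub>P\<^esub> (x \<oplus>\<^bsub>P\<^esub> y) = a \<odot>\<^bsub>P\<^esub> x \<oplus>\<^bsub>P\<^esub> a \<odot>\<^bsub>P\<^esub> y"
      by (simp add: k(2,3)[symmetric] U.smult_r_distr U.smult_closed)
  next
    fix a x assume ab: "a \<in> carrier R" "x \<in> carrier P"
    then obtain u where "u \<in> carrier U" "x = k u" using surj by blast
    with ab show "a \<odot>\<^bsub>P\<^esub> x \<in> carrier P"
      using k(1) by (simp add: k(3)[symmetric] U.smult_closed)
  next
    fix x assume "x \<in> carrier P"
    then obtain u where "u \<in> carrier U" "x = k u" using surj by blast
    then show "\<one>\<^bsub>R\<^esub> \<odot>\<^bsub>P\<^esub> x = x"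
      by (simp add: k(3)[symmetric] U.smult_one)
  qed (use U.R.ring_axioms in auto)
qed

lemma left_module_hom_inv_into:
  assumes "left_module R U" "bij_betw k (carrier U) (carrier P)" "k \<in> left_module_hom R U P"
  shows "inv_into (carrier U) k \<in> left_module_hom R P U"
proof -
  interpret U: left_module R U by fact
  note k = left_module_homD[OF assms(3)]
  have inv: "inv_into (carrier U) k x \<in> carrier U \<and> k (inv_into (carrier U) k x) = x"
    if "x \<in> carrier P" for x
    using assms(2) that by (metis bij_betw_def f_inv_into_f inv_into_into)
  have eq: "u = v" if "u \<in> carrier U" "v \<in> carrier U" "k u = k v" for u v
    using assms(2) that by (auto simp: bij_betw_def inj_on_def)
  have closed: "x \<oplus>\<^bsub>P\<^esub> y \<in> carrier P \<and> (r \<in> carrier R \<longrightarrow> r \<odot>\<^bsub>P\<^esub> x \<in> carrier P)"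
    if "x \<in> carrier P" "y \<in> carrier P" for x y r
    using inv[OF that(1)] inv[OF that(2)] k by (metis U.M.add.m_closed U.smult_closed)
  show ?thesis
  proof (rule left_module_homI)
    fix x y assume "x \<in> carrier P" "y \<in> carrier P"
    then show "inv_into (carrier U) k (x \<oplus>\<^bsub>P\<^esub> y) =
        inv_into (carrier U) k x \<oplus>\<^bsub>U\<^esub> inv_into (carrier U) k y"
      by (intro eq) (simp_all add: inv k(2) closed)
  next
    fix r x assume "r \<in> carrier R" "x \<in> carrier P"
    then show "inv_into (carrier U) k (r \<odot>\<^bsub>P\<^esub> x) = r \<odot>\<^bsub>U\<^esub> inv_into (carrier U) k x"
      by (intro eq) (simp_all add: inv k(3) closed U.smult_closed)
  qed (simp add: inv)
qed

text \<open>The quotient by the kernel of an epimorphism is described through the fibres of that map.\<close>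

lemma left_module_first_iso:
  assumes M: "left_module R M" and U: "left_module R U" and f: "f \<in> left_module_hom R M U"
    and surj: "f ` carrier M = carrier U" and N: "N = {x \<in> carrier M. f x = \<zero>\<^bsub>U\<^esub>}"
  defines "k \<equiv> \<lambda>u. {x \<in> carrier M. f x = u}"
  shows "bij_betw k (carrier U) (carrier (quotient_module M N))"
    and "k \<in> left_module_hom R U (quotient_module M N)"
    and "left_module R (quotient_module M N)"
proof -
  interpret M: left_module R M by fact
  interpret U: left_module R U by fact
  note h = left_module_homD[OF f]
  have minus: "f (x \<ominus>\<^bsub>M\<^esub> y) = f x \<ominus>\<^bsub>U\<^esub> f y" if "x \<in> carrier M" "y \<in> carrier M" for x y
    using left_module_hom_minus[OF M U f that] .
  have coset: "N +>\<^bsub>M\<^esub> x = k (f x)" if x: "x \<in> carrier M" for x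
  proof (intro equalityI subsetI)
    fix y assume "y \<in> N +>\<^bsub>M\<^esub> x"
    then show "y \<in> k (f x)"
      using x by (auto simp: a_r_coset_def' k_def N h)
  next
    fix y assume y: "y \<in> k (f x)"
    then have "y \<ominus>\<^bsub>M\<^esub> x \<in> N" "y = (y \<ominus>\<^bsub>M\<^esub> x) \<oplus>\<^bsub>M\<^esub> x"
      using x h(1)[OF x] minus[of y x]
      by (auto simp: k_def N a_minus_def M.M.a_assoc M.M.l_neg U.M.r_neg)
    then show "y \<in> N +>\<^bsub>M\<^esub> x"
      by (auto simp: a_r_coset_def')
  qed
  have carrier: "carrier (quotient_module M N) = k ` carrier U"
    by (auto simp: quotient_module_def A_RCOSETS_def' coset surj[symmetric])
  have inj: "inj_on k (carrier U)"
  proof (rule inj_onI)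
    fix u v assume u: "u \<in> carrier U" and "k u = k v"
    obtain x where "x \<in> carrier M" "f x = u" using surj u by (metis imageE)
    then have "x \<in> k v" using \<open>k u = k v\<close> by (auto simp: k_def)
    then show "u = v" using \<open>f x = u\<close> by (simp add: k_def)
  qed
  show bij: "bij_betw k (carrier U) (carrier (quotient_module M N))"
    using inj carrier by (simp add: bij_betw_def)
  show hom: "k \<in> left_module_hom R U (quotient_module M N)"
  proof (rule left_module_homI)
    fix u v assume u: "u \<in> carrier U" and v: "v \<in> carrier U"
    have "k (u \<oplus>\<^bsub>U\<^esub> v) \<subseteq> set_add M (k u) (k v)"
    proof
      fix z assume z: "z \<in> k (u \<oplus>\<^bsub>U\<^esub> v)"
      obtain x where x: "x \<in> carrier M" "f x = u" using surj u by (metis imageE)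
      have "z = x \<oplus>\<^bsub>M\<^esub> (z \<ominus>\<^bsub>M\<^esub> x)"
        using x z M.M.add_minus_cancel[of x z] by (simp add: k_def)
      moreover have "u \<oplus>\<^bsub>U\<^esub> f (z \<ominus>\<^bsub>M\<^esub> x) = u \<oplus>\<^bsub>U\<^esub> v"
        using x z minus[of z x] u v U.M.add_minus_cancel[of u "u \<oplus>\<^bsub>U\<^esub> v"] by (simp add: k_def)
      then have "x \<in> k u" "z \<ominus>\<^bsub>M\<^esub> x \<in> k v"
        using x z u v h(1) by (auto simp: k_def)
      ultimately show "z \<in> set_add M (k u) (k v)"
        by (auto simp: set_add_defs)
    qed
    moreover have "set_add M (k u) (k v) \<subseteq> k (u \<oplus>\<^bsub>U\<^esub> v)"
      using h by (auto simp: set_add_defs k_def)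
    ultimately show "k (u \<oplus>\<^bsub>U\<^esub> v) = k u \<oplus>\<^bsub>quotient_module M N\<^esub> k v"
      by (simp add: quotient_module_def)
  next
    fix r u assume r: "r \<in> carrier R" and u: "u \<in> carrier U"
    obtain x where x: "x \<in> carrier M" "f x = u" using surj u by (metis imageE)
    have "(\<Union>x\<in>k u. N +>\<^bsub>M\<^esub> (r \<odot>\<^bsub>M\<^esub> x)) = (\<Union>x\<in>k u. k (r \<odot>\<^bsub>U\<^esub> u))"
      using r h(3) by (intro SUP_cong refl) (auto simp: k_def coset M.smult_closed)
    also have "\<dots> = k (r \<odot>\<^bsub>U\<^esub> u)"
      using x by (auto simp: k_def)
    finally show "k (r \<odot>\<^bsub>U\<^esub> u) = r \<odot>\<^bsub>quotient_module M N\<^esub> k u"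
      by (simp add: quotient_module_def)
  qed (simp add: carrier)
  show "left_module R (quotient_module M N)"
    by (rule left_module_transfer[OF U bij _ hom]) (simp add: k_def quotient_module_def N)
qed

section \<open>Free modules\<close>

lemma free_module_simps:
  "zero (free_module R S) = (\<lambda>x\<in>S. \<zero>\<^bsub>R\<^esub>)"
  "add (free_module R S) u v = (\<lambda>x\<in>S. u x \<oplus>\<^bsub>R\<^esub> v x)"
  "smult (free_module R S) r v = (\<lambda>x\<in>S. r \<otimes>\<^bsub>R\<^esub> v x)"
  by (simp_all add: free_module_def)

lemma mem_free_module:
  "v \<in> carrier (free_module R S) \<longleftrightarrow>
    v \<in> extensional S \<and> (\<forall>x\<in>S. v x \<in> carrier R) \<and> finite {x \<in> S. v x \<noteq> \<zero>\<^bsub>R\<^esub>}"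
  by (auto simp: free_module_def PiE_def)

lemma free_moduleD: "v \<in> carrier (free_module R S) \<Longrightarrow> x \<in> S \<Longrightarrow> v x \<in> carrier R"
  by (simp add: mem_free_module)

context ring
begin

lemma left_module_free_module: "left_module R (free_module R S)"
proof -
  let ?F = "free_module R S"
  have add: "u \<oplus>\<^bsub>?F\<^esub> v \<in> carrier ?F" if "u \<in> carrier ?F" "v \<in> carrier ?F" for u v
  proof -
    have "{x \<in> S. (u \<oplus>\<^bsub>?F\<^esub> v) x \<noteq> \<zero>} \<subseteq> {x \<in> S. u x \<noteq> \<zero>} \<union> {x \<in> S. v x \<noteq> \<zero>}"
      by (auto simp: free_module_simps)
    then have "finite {x \<in> S. (u \<oplus>\<^bsub>?F\<^esub> v) x \<noteq> \<zero>}"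
      using that by (rule_tac finite_subset) (auto simp: mem_free_module)
    then show ?thesis
      using that unfolding mem_free_module by (auto simp: free_module_simps)
  qed
  have smult: "r \<odot>\<^bsub>?F\<^esub> v \<in> carrier ?F" if "r \<in> carrier R" "v \<in> carrier ?F" for r v
  proof -
    have "{x \<in> S. (r \<odot>\<^bsub>?F\<^esub> v) x \<noteq> \<zero>} \<subseteq> {x \<in> S. v x \<noteq> \<zero>}"
      using that by (auto simp: free_module_simps)
    then have "finite {x \<in> S. (r \<odot>\<^bsub>?F\<^esub> v) x \<noteq> \<zero>}"
      using that by (rule_tac finite_subset) (auto simp: mem_free_module)
    then show ?thesis
      using that unfolding mem_free_module by (auto simp: free_module_simps)
  qed
  have "abelian_group ?F"
  proof (rule abelian_groupI)
    fix v assume v: "v \<in> carrier ?F"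
    have "(\<ominus> \<one>) \<odot>\<^bsub>?F\<^esub> v \<oplus>\<^bsub>?F\<^esub> v = \<zero>\<^bsub>?F\<^esub>"
      using v by (auto simp: free_module_simps l_minus l_neg free_moduleD intro!: restrict_ext)
    then show "\<exists>u\<in>carrier ?F. u \<oplus>\<^bsub>?F\<^esub> v = \<zero>\<^bsub>?F\<^esub>"
      using smult[OF _ v, of "\<ominus> \<one>"] by auto
    show "\<zero>\<^bsub>?F\<^esub> \<oplus>\<^bsub>?F\<^esub> v = v"
      using v by (intro extensionalityI[of _ S]) (auto simp: free_module_simps mem_free_module)
  next
    fix u v w assume "u \<in> carrier ?F" "v \<in> carrier ?F" "w \<in> carrier ?F"
    then show "u \<oplus>\<^bsub>?F\<^esub> v \<oplus>\<^bsub>?F\<^esub> w = u \<oplus>\<^bsub>?F\<^esub> (v \<oplus>\<^bsub>?F\<^esub> w)"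
      by (auto simp: free_module_simps free_moduleD a_assoc intro!: restrict_ext)
  next
    fix u v assume "u \<in> carrier ?F" "v \<in> carrier ?F"
    then show "u \<oplus>\<^bsub>?F\<^esub> v = v \<oplus>\<^bsub>?F\<^esub> u"
      by (auto simp: free_module_simps free_moduleD a_comm intro!: restrict_ext)
  qed (use add in \<open>auto simp: mem_free_module free_module_simps\<close>)
  then show ?thesis
  proof (intro left_module.intro left_module_axioms.intro)
    fix v assume v: "v \<in> carrier ?F"
    show "\<one> \<odot>\<^bsub>?F\<^esub> v = v"
      using v by (intro extensionalityI[of _ S]) (auto simp: free_module_simps mem_free_module)
  next
    fix r v assume "r \<in> carrier R" "v \<in> carrier ?F"
    then show "r \<odot>\<^bsub>?F\<^esub> v \<in> carrier ?F" by (rule smult)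
  next
    fix a b x assume "a \<in> carrier R" "b \<in> carrier R" "x \<in> carrier ?F"
    then show "(a \<oplus> b) \<odot>\<^bsub>?F\<^esub> x = a \<odot>\<^bsub>?F\<^esub> x \<oplus>\<^bsub>?F\<^esub> b \<odot>\<^bsub>?F\<^esub> x"
      "(a \<otimes> b) \<odot>\<^bsub>?F\<^esub> x = a \<odot>\<^bsub>?F\<^esub> (b \<odot>\<^bsub>?F\<^esub> x)"
      by (auto simp: free_module_simps free_moduleD l_distr m_assoc intro!: restrict_ext)
  next
    fix a x y assume "a \<in> carrier R" "x \<in> carrier ?F" "y \<in> carrier ?F"
    then show "a \<odot>\<^bsub>?F\<^esub> (x \<oplus>\<^bsub>?F\<^esub> y) = a \<odot>\<^bsub>?F\<^esub> x \<oplus>\<^bsub>?F\<^esub> a \<odot>\<^bsub>?F\<^esub> y"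
      by (auto simp: free_module_simps free_moduleD r_distr intro!: restrict_ext)
  qed (use ring_axioms in auto)
qed

lemma basis_vector_closed: "basis_vector R S x \<in> carrier (free_module R S)"
proof -
  have "{y \<in> S. basis_vector R S x y \<noteq> \<zero>} \<subseteq> {x}"
    by (auto simp: basis_vector_def)
  then have "finite {y \<in> S. basis_vector R S x y \<noteq> \<zero>}"
    by (rule finite_subset) simp
  then show ?thesis
    unfolding mem_free_module by (auto simp: basis_vector_def)
qed

lemma free_module_induct [consumes 1, case_names zero basis add smult]:
  assumes v: "v \<in> carrier (free_module R S)"
    and zero: "P (\<lambda>x\<in>S. \<zero>)"
    and basis: "\<And>x. x \<in> S \<Longrightarrow> P (basis_vector R S x)"
    and add: "\<And>u v. u \<in> carrier (free_module R S) \<Longrightarrow> v \<in> carrier (free_module R S) \<Longrightarrow>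
      P u \<Longrightarrow> P v \<Longrightarrow> P (u \<oplus>\<^bsub>free_module R S\<^esub> v)"
    and smult: "\<And>r v. r \<in> carrier R \<Longrightarrow> v \<in> carrier (free_module R S) \<Longrightarrow> P v \<Longrightarrow>
      P (r \<odot>\<^bsub>free_module R S\<^esub> v)"
  shows "P v"
proof -
  interpret L: left_module R "free_module R S" by (rule left_module_free_module)
  have "\<forall>v. v \<in> carrier (free_module R S) \<and> {x \<in> S. v x \<noteq> \<zero>} = A \<longrightarrow> P v" if "finite A" for A
    using that
  proof (induction A rule: finite_induct)
    case empty
    have "v = (\<lambda>x\<in>S. \<zero>)" if "v \<in> carrier (free_module R S)" "{x \<in> S. v x \<noteq> \<zero>} = {}" for v
      using that by (intro extensionalityI[of _ S]) (auto simp: mem_free_module)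
    then show ?case using zero by auto
  next
    case (insert y A)
    show ?case
    proof (intro allI impI)
      fix v assume "v \<in> carrier (free_module R S) \<and> {x \<in> S. v x \<noteq> \<zero>} = insert y A"
      then have v: "v \<in> carrier (free_module R S)" and A: "{x \<in> S. v x \<noteq> \<zero>} = insert y A"
        by auto
      then have y: "y \<in> S" "v y \<in> carrier R" by (auto simp: mem_free_module)
      define w where "w = (\<lambda>x\<in>S. if x = y then \<zero> else v x)"
      have wA: "{x \<in> S. w x \<noteq> \<zero>} = A"
        using A insert(2) by (auto simp: w_def)
      have w: "w \<in> carrier (free_module R S)"
        using v insert(1) unfolding mem_free_module wA by (auto simp: w_def)
      have eq: "v = w \<oplus>\<^bsub>free_module R S\<^esub> (v y \<odot>\<^bsub>free_module R S\<^esub> basis_vector R S y)"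
        using v y by (intro extensionalityI[of _ S])
          (auto simp: mem_free_module free_module_simps w_def basis_vector_def)
      have "P w" using insert(3) w wA by blast
      moreover have "P (v y \<odot>\<^bsub>free_module R S\<^esub> basis_vector R S y)"
        by (intro smult basis y basis_vector_closed)
      ultimately show "P v"
        by (subst eq) (intro add w L.smult_closed y basis_vector_closed)
    qed
  qed
  then show ?thesis
    using v by (auto simp: mem_free_module)
qed

end

section \<open>Projective modules\<close>

lemma projective_moduleI:
  fixes P :: "('r, 'm, 'b) module_scheme" and S :: "'m set"
  assumes R: "ring R" and P: "left_module R P" and U: "left_module R U"
    and h: "h \<in> left_module_hom R P U" "bij_betw h (carrier P) (carrier U)"
    and s: "s \<in> left_module_hom R U (free_module R S)"
    and t: "t \<in> left_module_hom R (free_module R S) U"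
    and ts: "\<And>u. u \<in> carrier U \<Longrightarrow> t (s u) = u"
  shows "projective_module R P"
proof -
  let ?L = "free_module R S"
  have L: "left_module R ?L" using ring.left_module_free_module[OF R] .
  interpret U: left_module R U by fact
  interpret L: left_module R ?L by fact
  note sD = left_module_homD[OF s] and tD = left_module_homD[OF t]
  define N where "N = s ` carrier U"
  define Q where "Q = {x \<in> carrier ?L. t x = \<zero>\<^bsub>U\<^esub>}"
  have "submodule N R ?L"
    unfolding N_def using left_module_hom_image[OF U L s] .
  moreover have "submodule Q R ?L"
    unfolding Q_def using left_module_hom_kernel[OF L U t] .
  moreover have "N \<inter> Q = {\<zero>\<^bsub>?L\<^esub>}"
  proof -
    have "x = \<zero>\<^bsub>?L\<^esub>" if "x \<in> N" "x \<in> Q" for x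
      using that ts left_module_hom_zero[OF U L s] by (auto simp: N_def Q_def)
    moreover have "\<zero>\<^bsub>?L\<^esub> \<in> N" "\<zero>\<^bsub>?L\<^esub> \<in> Q"
      using submoduleD(2) \<open>submodule N R ?L\<close> \<open>submodule Q R ?L\<close> by metis+
    ultimately show ?thesis by blast
  qed
  moreover have "N <+>\<^bsub>?L\<^esub> Q = carrier ?L"
  proof
    have "N \<subseteq> carrier ?L" "Q \<subseteq> carrier ?L"
      using submoduleD(1) \<open>submodule N R ?L\<close> \<open>submodule Q R ?L\<close> by metis+
    then show "N <+>\<^bsub>?L\<^esub> Q \<subseteq> carrier ?L"
      unfolding set_add_defs by (auto simp: subset_iff)
    show "carrier ?L \<subseteq> N <+>\<^bsub>?L\<^esub> Q"
    proof
      fix x assume x: "x \<in> carrier ?L"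
      have tx: "t x \<in> carrier U" "s (t x) \<in> carrier ?L" using x sD(1) tD(1) by auto
      then have "t (x \<ominus>\<^bsub>?L\<^esub> s (t x)) = t x \<ominus>\<^bsub>U\<^esub> t x"
        using left_module_hom_minus[OF L U t x] ts by simp
      then have "x \<ominus>\<^bsub>?L\<^esub> s (t x) \<in> Q"
        using x tx by (auto simp: Q_def a_minus_def U.M.r_neg)
      moreover have "x = s (t x) \<oplus>\<^bsub>?L\<^esub> (x \<ominus>\<^bsub>?L\<^esub> s (t x))"
        using x tx L.M.add_minus_cancel by simp
      moreover have "s (t x) \<in> N" using tx by (simp add: N_def)
      ultimately show "x \<in> N <+>\<^bsub>?L\<^esub> Q"
        by (auto simp: set_add_defs)
    qed
  qed
  moreover have "s \<circ> h \<in> left_module_hom R P ?L"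
    using left_module_hom_comp[OF h(1) s] .
  moreover have "bij_betw (s \<circ> h) (carrier P) N"
  proof (rule bij_betw_trans[OF h(2)])
    show "bij_betw s (carrier U) N"
      unfolding N_def using ts by (intro inj_on_imp_bij_betw inj_on_inverseI[of _ t])
  qed
  ultimately show ?thesis
    using P unfolding projective_module_def by blast
qed

section \<open>Group algebras and permutation modules\<close>

definition left_action :: "('g, 'c) monoid_scheme \<Rightarrow> 'x set \<Rightarrow> ('g \<Rightarrow> 'x \<Rightarrow> 'x) \<Rightarrow> bool"
  where "left_action G S act \<longleftrightarrow>
    (\<forall>g\<in>carrier G. \<forall>x\<in>S. act g x \<in> S) \<and> (\<forall>x\<in>S. act \<one>\<^bsub>G\<^esub> x = x) \<and>
    (\<forall>g\<in>carrier G. \<forall>h\<in>carrier G. \<forall>x\<in>S. act (g \<otimes>\<^bsub>G\<^esub> h) x = act g (act h x))"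

lemma left_actionD:
  assumes "left_action G S act"
  shows "\<And>g x. g \<in> carrier G \<Longrightarrow> x \<in> S \<Longrightarrow> act g x \<in> S"
    and "\<And>x. x \<in> S \<Longrightarrow> act \<one>\<^bsub>G\<^esub> x = x"
    and "\<And>g h x. g \<in> carrier G \<Longrightarrow> h \<in> carrier G \<Longrightarrow> x \<in> S \<Longrightarrow>
      act (g \<otimes>\<^bsub>G\<^esub> h) x = act g (act h x)"
  using assms by (auto simp: left_action_def)

lemma (in group) left_action_inv:
  assumes "left_action G S act" "g \<in> carrier G" "x \<in> S"
  shows "act (inv g) (act g x) = x" "act g (act (inv g) x) = x"
  using assms left_actionD(3)[OF assms(1), of "inv g" g x] left_actionD(3)[OF assms(1), of g "inv g" x]
    left_actionD(2)[OF assms(1,3)] by auto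

lemma (in group) left_action_eq_iff:
  assumes "left_action G S act" "g \<in> carrier G" "x \<in> S" "y \<in> S"
  shows "act (inv g) x = y \<longleftrightarrow> x = act g y"
  using assms left_action_inv by metis

lemma abelian_group_cong:
  assumes "abelian_group N"
    and "carrier M = carrier N" "zero M = zero N" "add M = add N"
  shows "abelian_group M"
proof -
  interpret N: abelian_group N by fact
  show ?thesis
    by (rule abelian_groupI) (auto simp: assms(2-) N.a_ac intro: N.l_neg)
qed

lemma permutation_module_simps:
  "carrier (permutation_module F G S act) = carrier (free_module F S)"
  "zero (permutation_module F G S act) = zero (free_module F S)"
  "add (permutation_module F G S act) = add (free_module F S)"
  "smult (permutation_module F G S act) \<alpha> v =
    (\<lambda>x\<in>S. \<Oplus>\<^bsub>F\<^esub>g\<in>carrier G. \<alpha> g \<otimes>\<^bsub>F\<^esub> v (act (inv\<^bsub>G\<^esub> g) x))"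
  by (simp_all add: permutation_module_def)

locale finite_group_algebra = F?: cring F + G: group G for F (structure) and G (structure) +
  assumes finite_group: "finite (carrier G)"
begin

abbreviation "FG \<equiv> group_algebra F G"

lemma FG_simps:
  "carrier FG = carrier (free_module F (carrier G))"
  "zero FG = zero (free_module F (carrier G))"
  "add FG = add (free_module F (carrier G))"
  "monoid.mult FG = smult (permutation_module F G (carrier G) (monoid.mult G))"
  using finite_group
  by (auto simp: group_algebra_def free_module_def permutation_module_def fun_eq_iff
      intro!: restrict_ext finsum_cong')

lemma FG_closed: "\<alpha> \<in> carrier FG \<Longrightarrow> g \<in> carrier G \<Longrightarrow> \<alpha> g \<in> carrier F"
  by (simp add: FG_simps free_moduleD)

lemma left_action_mult: "left_action G (carrier G) (monoid.mult G)"
  by (simp add: left_action_def G.m_assoc)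

lemma monomial_closed: "c \<in> carrier F \<Longrightarrow> monomial F G c g \<in> carrier FG"
  using finite_group by (simp add: FG_simps mem_free_module monomial_def)

lemma FG_one: "one FG = monomial F G \<one> \<one>\<^bsub>G\<^esub>"
  by (simp add: group_algebra_def monomial_def)

lemma permutation_smult_closed:
  assumes act: "left_action G S act" and "\<alpha> \<in> carrier FG" "v \<in> carrier (free_module F S)"
  shows "\<alpha> \<odot>\<^bsub>permutation_module F G S act\<^esub> v \<in> carrier (free_module F S)"
proof -
  let ?w = "\<alpha> \<odot>\<^bsub>permutation_module F G S act\<^esub> v"
  have "{x \<in> S. ?w x \<noteq> \<zero>} \<subseteq> (\<Union>g\<in>carrier G. act g ` {x \<in> S. v x \<noteq> \<zero>})"
  proof
    fix x assume x: "x \<in> {x \<in> S. ?w x \<noteq> \<zero>}"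
    have "\<exists>g\<in>carrier G. v (act (inv\<^bsub>G\<^esub> g) x) \<noteq> \<zero>"
    proof (rule ccontr)
      assume "\<not> ?thesis"
      then have "(\<Oplus>g\<in>carrier G. \<alpha> g \<otimes> v (act (inv\<^bsub>G\<^esub> g) x)) = (\<Oplus>g\<in>carrier G. \<zero>)"
        using assms(2) by (intro finsum_cong') (auto simp: FG_closed)
      then show False using x by (auto simp: permutation_module_simps finsum_zero)
    qed
    then obtain g where g: "g \<in> carrier G" "v (act (inv\<^bsub>G\<^esub> g) x) \<noteq> \<zero>" by blast
    have "x = act g (act (inv\<^bsub>G\<^esub> g) x)" using G.left_action_inv[OF act g(1)] x by simp
    moreover have "act (inv\<^bsub>G\<^esub> g) x \<in> {x \<in> S. v x \<noteq> \<zero>}"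
      using g x left_actionD(1)[OF act] by simp
    ultimately show "x \<in> (\<Union>g\<in>carrier G. act g ` {x \<in> S. v x \<noteq> \<zero>})"
      using g(1) by blast
  qed
  then have "finite {x \<in> S. ?w x \<noteq> \<zero>}"
    using finite_group assms(3) by (rule_tac finite_subset) (auto simp: mem_free_module)
  then show ?thesis
    using assms(2,3) left_actionD(1)[OF act] unfolding mem_free_module
    by (auto simp: permutation_module_simps FG_closed intro!: finsum_closed)
qed

lemma permutation_smult_l_distr:
  assumes act: "left_action G S act" and "\<alpha> \<in> carrier FG" "\<beta> \<in> carrier FG"
    and v: "v \<in> carrier (free_module F S)"
  defines "U \<equiv> permutation_module F G S act"
  shows "(\<alpha> \<oplus>\<^bsub>FG\<^esub> \<beta>) \<odot>\<^bsub>U\<^esub> v = \<alpha> \<odot>\<^bsub>U\<^esub> v \<oplus>\<^bsub>U\<^esub> \<beta> \<odot>\<^bsub>U\<^esub> v"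
proof -
  have "(\<Oplus>g\<in>carrier G. (\<alpha> \<oplus>\<^bsub>FG\<^esub> \<beta>) g \<otimes> v (act (inv\<^bsub>G\<^esub> g) x)) =
      (\<Oplus>g\<in>carrier G. \<alpha> g \<otimes> v (act (inv\<^bsub>G\<^esub> g) x)) \<oplus>
      (\<Oplus>g\<in>carrier G. \<beta> g \<otimes> v (act (inv\<^bsub>G\<^esub> g) x))" if x: "x \<in> S" for x
  proof -
    note [simp] = FG_closed[OF assms(2)] FG_closed[OF assms(3)] free_moduleD[OF v]
      left_actionD(1)[OF act _ x]
    have "(\<Oplus>g\<in>carrier G. (\<alpha> \<oplus>\<^bsub>FG\<^esub> \<beta>) g \<otimes> v (act (inv\<^bsub>G\<^esub> g) x)) =
        (\<Oplus>g\<in>carrier G. \<alpha> g \<otimes> v (act (inv\<^bsub>G\<^esub> g) x) \<oplus> \<beta> g \<otimes> v (act (inv\<^bsub>G\<^esub> g) x))"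
      by (intro finsum_cong') (auto simp: FG_simps free_module_simps l_distr)
    then show ?thesis
      by (subst (asm) finsum_addf) auto
  qed
  then show ?thesis
    by (auto simp: U_def permutation_module_simps free_module_simps intro!: restrict_ext)
qed

lemma permutation_smult_r_distr:
  assumes act: "left_action G S act" and "\<alpha> \<in> carrier FG"
    and u: "u \<in> carrier (free_module F S)" and v: "v \<in> carrier (free_module F S)"
  defines "U \<equiv> permutation_module F G S act"
  shows "\<alpha> \<odot>\<^bsub>U\<^esub> (u \<oplus>\<^bsub>U\<^esub> v) = \<alpha> \<odot>\<^bsub>U\<^esub> u \<oplus>\<^bsub>U\<^esub> \<alpha> \<odot>\<^bsub>U\<^esub> v"
proof -
  have "(\<Oplus>g\<in>carrier G. \<alpha> g \<otimes> (u \<oplus>\<^bsub>U\<^esub> v) (act (inv\<^bsub>G\<^esub> g) x)) =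
      (\<Oplus>g\<in>carrier G. \<alpha> g \<otimes> u (act (inv\<^bsub>G\<^esub> g) x)) \<oplus>
      (\<Oplus>g\<in>carrier G. \<alpha> g \<otimes> v (act (inv\<^bsub>G\<^esub> g) x))" if x: "x \<in> S" for x
  proof -
    note [simp] = FG_closed[OF assms(2)] free_moduleD[OF u] free_moduleD[OF v]
      left_actionD(1)[OF act _ x]
    have "(\<Oplus>g\<in>carrier G. \<alpha> g \<otimes> (u \<oplus>\<^bsub>U\<^esub> v) (act (inv\<^bsub>G\<^esub> g) x)) =
        (\<Oplus>g\<in>carrier G. \<alpha> g \<otimes> u (act (inv\<^bsub>G\<^esub> g) x) \<oplus> \<alpha> g \<otimes> v (act (inv\<^bsub>G\<^esub> g) x))"
      by (intro finsum_cong') (auto simp: U_def permutation_module_simps free_module_simps r_distr)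
    then show ?thesis
      by (subst (asm) finsum_addf) auto
  qed
  then show ?thesis
    by (auto simp: U_def permutation_module_simps free_module_simps intro!: restrict_ext)
qed

lemma permutation_smult_assoc:
  assumes act: "left_action G S act" and a: "\<alpha> \<in> carrier FG" "\<beta> \<in> carrier FG"
    and v: "v \<in> carrier (free_module F S)"
  defines "U \<equiv> permutation_module F G S act"
  shows "(\<alpha> \<otimes>\<^bsub>FG\<^esub> \<beta>) \<odot>\<^bsub>U\<^esub> v = \<alpha> \<odot>\<^bsub>U\<^esub> (\<beta> \<odot>\<^bsub>U\<^esub> v)"
proof -
  have "(\<Oplus>g\<in>carrier G. (\<alpha> \<otimes>\<^bsub>FG\<^esub> \<beta>) g \<otimes> v (act (inv\<^bsub>G\<^esub> g) x)) =
      (\<Oplus>h\<in>carrier G. \<alpha> h \<otimes> (\<beta> \<odot>\<^bsub>U\<^esub> v) (act (inv\<^bsub>G\<^esub> h) x))" if x: "x \<in> S" for x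
  proof -
    note [simp] = FG_closed[OF a(1)] FG_closed[OF a(2)] free_moduleD[OF v]
      left_actionD(1)[OF act] x finite_group
    have bij: "bij_betw (\<lambda>k. h \<otimes>\<^bsub>G\<^esub> k) (carrier G) (carrier G)" if "h \<in> carrier G" for h
      using that by (simp add: bij_betw_def G.inj_on_cmult G.surj_const_mult)
    have "(\<Oplus>g\<in>carrier G. (\<alpha> \<otimes>\<^bsub>FG\<^esub> \<beta>) g \<otimes> v (act (inv\<^bsub>G\<^esub> g) x)) =
        (\<Oplus>g\<in>carrier G. \<Oplus>h\<in>carrier G. \<alpha> h \<otimes> \<beta> (inv\<^bsub>G\<^esub> h \<otimes>\<^bsub>G\<^esub> g) \<otimes> v (act (inv\<^bsub>G\<^esub> g) x))"
      by (intro finsum_cong')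
        (auto simp: FG_simps permutation_module_simps intro!: finsum_ldistr finsum_closed)
    also have "\<dots> = (\<Oplus>h\<in>carrier G. \<Oplus>g\<in>carrier G.
        \<alpha> h \<otimes> \<beta> (inv\<^bsub>G\<^esub> h \<otimes>\<^bsub>G\<^esub> g) \<otimes> v (act (inv\<^bsub>G\<^esub> g) x))"
      by (rule finsum_swap) simp_all
    also have "\<dots> = (\<Oplus>h\<in>carrier G. \<alpha> h \<otimes> (\<beta> \<odot>\<^bsub>U\<^esub> v) (act (inv\<^bsub>G\<^esub> h) x))"
    proof (intro finsum_cong' refl)
      fix h assume h: "h \<in> carrier G"
      have "(\<Oplus>g\<in>carrier G. \<alpha> h \<otimes> \<beta> (inv\<^bsub>G\<^esub> h \<otimes>\<^bsub>G\<^esub> g) \<otimes> v (act (inv\<^bsub>G\<^esub> g) x)) =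
          (\<Oplus>k\<in>carrier G. \<alpha> h \<otimes> \<beta> (inv\<^bsub>G\<^esub> h \<otimes>\<^bsub>G\<^esub> (h \<otimes>\<^bsub>G\<^esub> k)) \<otimes> v (act (inv\<^bsub>G\<^esub> (h \<otimes>\<^bsub>G\<^esub> k)) x))"
        using h by (intro finsum_bij[OF bij, symmetric]) simp_all
      also have "\<dots> = (\<Oplus>k\<in>carrier G. \<alpha> h \<otimes> (\<beta> k \<otimes> v (act (inv\<^bsub>G\<^esub> k) (act (inv\<^bsub>G\<^esub> h) x))))"
        using h
        by (intro finsum_cong')
          (auto simp: m_assoc G.m_assoc[symmetric] G.inv_mult_group left_actionD(3)[OF act])
      also have "\<dots> = \<alpha> h \<otimes> (\<Oplus>k\<in>carrier G. \<beta> k \<otimes> v (act (inv\<^bsub>G\<^esub> k) (act (inv\<^bsub>G\<^esub> h) x)))"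
        using h by (intro finsum_rdistr[symmetric]) auto
      finally show "(\<Oplus>g\<in>carrier G. \<alpha> h \<otimes> \<beta> (inv\<^bsub>G\<^esub> h \<otimes>\<^bsub>G\<^esub> g) \<otimes> v (act (inv\<^bsub>G\<^esub> g) x)) =
          \<alpha> h \<otimes> (\<beta> \<odot>\<^bsub>U\<^esub> v) (act (inv\<^bsub>G\<^esub> h) x)"
        using h by (simp add: U_def permutation_module_simps)
    qed (auto simp: U_def permutation_module_simps intro!: finsum_closed)
    finally show ?thesis .
  qed
  then show ?thesis
    by (auto simp: U_def permutation_module_simps intro!: restrict_ext)
qed

lemma monomial_smult:
  assumes act: "left_action G S act" and "c \<in> carrier F" "g \<in> carrier G"
    and v: "v \<in> carrier (free_module F S)"
  shows "monomial F G c g \<odot>\<^bsub>permutation_module F G S act\<^esub> v = (\<lambda>x\<in>S. c \<otimes> v (act (inv\<^bsub>G\<^esub> g) x))"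
proof -
  have "(\<Oplus>h\<in>carrier G. monomial F G c g h \<otimes> v (act (inv\<^bsub>G\<^esub> h) x)) = c \<otimes> v (act (inv\<^bsub>G\<^esub> g) x)"
    if x: "x \<in> S" for x
  proof -
    note [simp] = free_moduleD[OF v] left_actionD(1)[OF act] x finite_group assms
    have "(\<Oplus>h\<in>carrier G. monomial F G c g h \<otimes> v (act (inv\<^bsub>G\<^esub> h) x)) =
        (\<Oplus>h\<in>carrier G. if h = g then c \<otimes> v (act (inv\<^bsub>G\<^esub> g) x) else \<zero>)"
      by (intro finsum_cong') (auto simp: monomial_def)
    then show ?thesis by (simp add: finsum_delta)
  qed
  then show ?thesis
    by (auto simp: permutation_module_simps intro!: restrict_ext)
qed

lemma scalar_smult:
  assumes act: "left_action G S act" and "c \<in> carrier F" "v \<in> carrier (free_module F S)"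
  shows "monomial F G c \<one>\<^bsub>G\<^esub> \<odot>\<^bsub>permutation_module F G S act\<^esub> v = c \<odot>\<^bsub>free_module F S\<^esub> v"
  using assms by (subst monomial_smult)
    (auto simp: free_module_simps left_actionD(2)[OF act] intro!: restrict_ext)

lemma monomial_smult_basis_vector:
  assumes act: "left_action G S act" and "c \<in> carrier F" "g \<in> carrier G" "x \<in> S"
  shows "monomial F G c g \<odot>\<^bsub>permutation_module F G S act\<^esub> basis_vector F S x =
    c \<odot>\<^bsub>free_module F S\<^esub> basis_vector F S (act g x)"
  using assms
  by (subst monomial_smult[OF act _ _ basis_vector_closed])
    (auto simp: free_module_simps basis_vector_def G.left_action_eq_iff[OF act]
      left_actionD(1)[OF act] G.left_action_inv[OF act] intro!: restrict_ext)

lemma abelian_group_permutation_module: "abelian_group (permutation_module F G S act)"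
proof -
  interpret L: left_module F "free_module F S" by (rule left_module_free_module)
  have "abelian_group (free_module F S)" by unfold_locales
  then show ?thesis
    by (rule abelian_group_cong) (simp_all add: permutation_module_simps)
qed

lemma ring_FG: "ring FG"
proof (rule ringI)
  interpret L: left_module F "free_module F (carrier G)" by (rule left_module_free_module)
  have "abelian_group (free_module F (carrier G))" by unfold_locales
  then show "abelian_group FG"
    by (rule abelian_group_cong) (simp_all add: FG_simps)
  note act = left_action_mult
  show "Group.monoid FG"
  proof (rule monoidI)
    fix \<alpha> \<beta> assume "\<alpha> \<in> carrier FG" "\<beta> \<in> carrier FG"
    then show "\<alpha> \<otimes>\<^bsub>FG\<^esub> \<beta> \<in> carrier FG"
      using permutation_smult_closed[OF act] by (simp add: FG_simps)
  next
    fix \<alpha> \<beta> \<gamma> assume "\<alpha> \<in> carrier FG" "\<beta> \<in> carrier FG" "\<gamma> \<in> carrier FG"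
    then show "\<alpha> \<otimes>\<^bsub>FG\<^esub> \<beta> \<otimes>\<^bsub>FG\<^esub> \<gamma> = \<alpha> \<otimes>\<^bsub>FG\<^esub> (\<beta> \<otimes>\<^bsub>FG\<^esub> \<gamma>)"
      using permutation_smult_assoc[OF act, of \<alpha> \<beta> \<gamma>] by (simp add: FG_simps)
  next
    fix \<alpha> assume a: "\<alpha> \<in> carrier FG"
    show "\<one>\<^bsub>FG\<^esub> \<otimes>\<^bsub>FG\<^esub> \<alpha> = \<alpha>"
      using scalar_smult[OF act, of \<one> \<alpha>] L.smult_one[of \<alpha>] a by (simp add: FG_simps FG_one)
    have "(\<alpha> \<otimes>\<^bsub>FG\<^esub> \<one>\<^bsub>FG\<^esub>) g = \<alpha> g" if g: "g \<in> carrier G" for g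
    proof -
      have "(\<Oplus>h\<in>carrier G. \<alpha> h \<otimes> \<one>\<^bsub>FG\<^esub> (inv\<^bsub>G\<^esub> h \<otimes>\<^bsub>G\<^esub> g)) =
          (\<Oplus>h\<in>carrier G. if h = g then \<alpha> g else \<zero>)"
        using g a G.left_action_eq_iff[OF act _ g G.one_closed]
        by (intro finsum_cong') (auto simp: FG_one monomial_def FG_closed)
      then show ?thesis
        using g a finite_group by (simp add: FG_simps(4) permutation_module_simps finsum_delta FG_closed)
    qed
    moreover have "\<alpha> \<otimes>\<^bsub>FG\<^esub> \<one>\<^bsub>FG\<^esub> \<in> extensional (carrier G)" "\<alpha> \<in> extensional (carrier G)"
      using a by (auto simp: FG_simps(1,4) permutation_module_simps mem_free_module)
    ultimately show "\<alpha> \<otimes>\<^bsub>FG\<^esub> \<one>\<^bsub>FG\<^esub> = \<alpha>"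
      by (intro extensionalityI[of _ "carrier G"])
  qed (simp add: FG_one monomial_closed)
  fix \<alpha> \<beta> \<gamma> assume "\<alpha> \<in> carrier FG" "\<beta> \<in> carrier FG" "\<gamma> \<in> carrier FG"
  then show "(\<alpha> \<oplus>\<^bsub>FG\<^esub> \<beta>) \<otimes>\<^bsub>FG\<^esub> \<gamma> = \<alpha> \<otimes>\<^bsub>FG\<^esub> \<gamma> \<oplus>\<^bsub>FG\<^esub> \<beta> \<otimes>\<^bsub>FG\<^esub> \<gamma>"
    "\<gamma> \<otimes>\<^bsub>FG\<^esub> (\<alpha> \<oplus>\<^bsub>FG\<^esub> \<beta>) = \<gamma> \<otimes>\<^bsub>FG\<^esub> \<alpha> \<oplus>\<^bsub>FG\<^esub> \<gamma> \<otimes>\<^bsub>FG\<^esub> \<beta>"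
    using permutation_smult_l_distr[OF act, of \<alpha> \<beta> \<gamma>] permutation_smult_r_distr[OF act, of \<gamma> \<alpha> \<beta>]
    by (simp_all add: FG_simps permutation_module_simps(1-3))
qed

lemma left_module_permutation_module:
  assumes act: "left_action G S act"
  shows "left_module FG (permutation_module F G S act)"
proof (intro left_module.intro left_module_axioms.intro ring_FG abelian_group_permutation_module)
  interpret L: left_module F "free_module F S" by (rule left_module_free_module)
  fix v assume "v \<in> carrier (permutation_module F G S act)"
  then show "\<one>\<^bsub>FG\<^esub> \<odot>\<^bsub>permutation_module F G S act\<^esub> v = v"
    using scalar_smult[OF act, of \<one> v] L.smult_one by (simp add: FG_one permutation_module_simps(1))
qed (use permutation_smult_closed[OF act] permutation_smult_l_distr[OF act]
      permutation_smult_r_distr[OF act] permutation_smult_assoc[OF act]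
    in \<open>simp_all add: permutation_module_simps(1)\<close>)

lemma left_module_hom_monomialI:
  assumes M: "left_module FG M" and N: "left_module FG N"
    and closed: "\<And>x. x \<in> carrier M \<Longrightarrow> h x \<in> carrier N"
    and add: "\<And>x y. x \<in> carrier M \<Longrightarrow> y \<in> carrier M \<Longrightarrow> h (x \<oplus>\<^bsub>M\<^esub> y) = h x \<oplus>\<^bsub>N\<^esub> h y"
    and mono: "\<And>c g x. c \<in> carrier F \<Longrightarrow> g \<in> carrier G \<Longrightarrow> x \<in> carrier M \<Longrightarrow>
      h (monomial F G c g \<odot>\<^bsub>M\<^esub> x) = monomial F G c g \<odot>\<^bsub>N\<^esub> h x"
  shows "h \<in> left_module_hom FG M N"
proof (rule left_module_homI[OF closed add])
  interpret M: left_module FG M by fact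
  interpret N: left_module FG N by fact
  fix \<alpha> x assume "\<alpha> \<in> carrier FG" and x: "x \<in> carrier M"
  then have "\<alpha> \<in> carrier (free_module F (carrier G))" by (simp add: FG_simps)
  then have "\<forall>x\<in>carrier M. h (\<alpha> \<odot>\<^bsub>M\<^esub> x) = \<alpha> \<odot>\<^bsub>N\<^esub> h x"
  proof (induction \<alpha> rule: free_module_induct)
    case zero
    have "(\<lambda>x\<in>carrier G. \<zero>) = monomial F G \<zero> \<one>\<^bsub>G\<^esub>"
      by (auto simp: monomial_def)
    then show ?case using mono by simp
  next
    case (basis g)
    then have "basis_vector F (carrier G) g = monomial F G \<one> g"
      by (auto simp: basis_vector_def monomial_def)
    then show ?case using mono basis by simp
  next
    case (add \<alpha> \<beta>)
    then show ?case
      using assms(4) closed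
      by (simp add: FG_simps[symmetric] M.smult_l_distr N.smult_l_distr M.smult_closed)
  next
    case (smult c \<alpha>)
    have "c \<odot>\<^bsub>free_module F (carrier G)\<^esub> \<alpha> = monomial F G c \<one>\<^bsub>G\<^esub> \<otimes>\<^bsub>FG\<^esub> \<alpha>"
      using scalar_smult[OF left_action_mult, of c \<alpha>] smult by (simp add: FG_simps)
    then show ?case
      using smult mono closed monomial_closed[of c "\<one>\<^bsub>G\<^esub>"]
      by (simp add: FG_simps[symmetric] M.smult_assoc N.smult_assoc M.smult_closed)
  qed
  with x show "h (\<alpha> \<odot>\<^bsub>M\<^esub> x) = \<alpha> \<odot>\<^bsub>N\<^esub> h x" by blast
qed

end

section \<open>Projective permutation modules\<close>

context finite_group_algebra
begin

lemma mem_free_module_finite: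
  "finite S \<Longrightarrow> v \<in> carrier (free_module F S) \<longleftrightarrow> v \<in> S \<rightarrow>\<^sub>E carrier F"
  by (auto simp: mem_free_module PiE_def)

lemma monomial_mult:
  "c \<in> carrier F \<Longrightarrow> k \<in> carrier G \<Longrightarrow> \<beta> \<in> carrier FG \<Longrightarrow>
    monomial F G c k \<otimes>\<^bsub>FG\<^esub> \<beta> = (\<lambda>g\<in>carrier G. c \<otimes> \<beta> (inv\<^bsub>G\<^esub> k \<otimes>\<^bsub>G\<^esub> g))"
  using monomial_smult[OF left_action_mult, of c k \<beta>] by (simp add: FG_simps)

text \<open>
  The averaging function \<open>c\<close> is what Higman's criterion asks for: the endomorphism that scales the
  basis vector at \<open>x\<close> by \<open>c x\<close> has trace the identity, so averaging with it turns a linear section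
  of an epimorphism from a free module into an equivariant one.
\<close>

lemma projective_permutation_moduleI:
  fixes P :: "('c \<Rightarrow> 'a, 'm, 'e) module_scheme" and b :: "'x \<Rightarrow> 'm"
  assumes act: "left_action G X act" and X: "finite X"
    and P: "left_module FG P"
    and h: "h \<in> left_module_hom FG P (permutation_module F G X act)"
      "bij_betw h (carrier P) (carrier (permutation_module F G X act))"
    and b: "inj_on b X"
    and c: "\<And>x. x \<in> X \<Longrightarrow> c x \<in> carrier F"
      "\<And>x. x \<in> X \<Longrightarrow> (\<Oplus>g\<in>carrier G. c (act (inv\<^bsub>G\<^esub> g) x)) = \<one>"
  shows "projective_module FG P"
proof -
  let ?U = "permutation_module F G X act"
  let ?L = "free_module FG (b ` X)"
  define r where "r = inv_into X b"
  have rb [simp]: "r (b x) = x" if "x \<in> X" for x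
    using b that by (simp add: r_def)
  have U: "left_module FG ?U" using left_module_permutation_module[OF act] .
  have L: "left_module FG ?L" using ring.left_module_free_module[OF ring_FG] .
  note actD [simp] = left_actionD(1)[OF act]
  have carU: "carrier ?U = X \<rightarrow>\<^sub>E carrier F"
    using mem_free_module_finite[OF X] by (auto simp: permutation_module_simps)
  have carFG: "carrier FG = carrier G \<rightarrow>\<^sub>E carrier F"
    by (simp add: group_algebra_def)
  have carL: "carrier ?L = b ` X \<rightarrow>\<^sub>E carrier FG"
    using X by (auto simp: mem_free_module PiE_def Pi_def)
  define s where "s = (\<lambda>u. \<lambda>y\<in>b ` X. \<lambda>g\<in>carrier G. c (r y) \<otimes> u (act g (r y)))"
  define t where "t = (\<lambda>v. \<lambda>x\<in>X. \<Oplus>g\<in>carrier G. v (b (act (inv\<^bsub>G\<^esub> g) x)) g)"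
  have FGval [simp]: "v (b x) g \<in> carrier F" if "v \<in> carrier ?L" "x \<in> X" "g \<in> carrier G" for v x g
    using that by (auto simp: carL carFG)
  have Uval [simp]: "u x \<in> carrier F" if "u \<in> carrier ?U" "x \<in> X" for u x
    using that by (auto simp: carU)
  have s: "s \<in> left_module_hom FG ?U ?L"
  proof (rule left_module_hom_monomialI[OF U L])
    show "s u \<in> carrier ?L" if "u \<in> carrier ?U" for u
      using that by (auto simp: s_def carL carFG c)
    show "s (u \<oplus>\<^bsub>?U\<^esub> v) = s u \<oplus>\<^bsub>?L\<^esub> s v" if "u \<in> carrier ?U" "v \<in> carrier ?U" for u v
      using that by (auto simp: s_def free_module_simps permutation_module_simps(3) FG_simps(3) c
          r_distr fun_eq_iff)
    show "s (monomial F G a k \<odot>\<^bsub>?U\<^esub> u) = monomial F G a k \<odot>\<^bsub>?L\<^esub> s u"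
      if a: "a \<in> carrier F" and k: "k \<in> carrier G" and u: "u \<in> carrier ?U" for a k u
    proof -
      have su: "s u \<in> carrier ?L" using u by (auto simp: s_def carL carFG c)
      have u': "u \<in> carrier (free_module F X)" using u by (simp add: permutation_module_simps)
      have "c x \<otimes> (a \<otimes> u (act (inv\<^bsub>G\<^esub> k) (act g x))) = a \<otimes> (c x \<otimes> u (act (inv\<^bsub>G\<^esub> k \<otimes>\<^bsub>G\<^esub> g) x))"
        if "x \<in> X" "g \<in> carrier G" for x g
        using that a k u c(1)[of x] by (simp add: left_actionD(3)[OF act] m_lcomm)
      moreover have "monomial F G a k \<otimes>\<^bsub>FG\<^esub> s u (b x) =
          (\<lambda>g\<in>carrier G. a \<otimes> s u (b x) (inv\<^bsub>G\<^esub> k \<otimes>\<^bsub>G\<^esub> g))" if "x \<in> X" for x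
        using that su by (intro monomial_mult[OF a k]) (auto simp: carL)
      ultimately show ?thesis
        using a k u monomial_smult[OF act a k u']
        by (auto simp: free_module_simps s_def intro!: restrict_ext)
    qed
  qed
  have t: "t \<in> left_module_hom FG ?L ?U"
  proof (rule left_module_hom_monomialI[OF L U])
    show tcl: "t v \<in> carrier ?U" if "v \<in> carrier ?L" for v
      using that by (auto simp: t_def carU intro!: finsum_closed)
    show "t (u \<oplus>\<^bsub>?L\<^esub> v) = t u \<oplus>\<^bsub>?U\<^esub> t v" if uv: "u \<in> carrier ?L" "v \<in> carrier ?L" for u v
    proof -
      have "(\<Oplus>g\<in>carrier G. (u \<oplus>\<^bsub>?L\<^esub> v) (b (act (inv\<^bsub>G\<^esub> g) x)) g) =
        (\<Oplus>g\<in>carrier G. u (b (act (inv\<^bsub>G\<^esub> g) x)) g) \<oplus> (\<Oplus>g\<in>carrier G. v (b (act (inv\<^bsub>G\<^esub> g) x)) g)"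
        if "x \<in> X" for x
      proof -
        have "(\<Oplus>g\<in>carrier G. (u \<oplus>\<^bsub>?L\<^esub> v) (b (act (inv\<^bsub>G\<^esub> g) x)) g) =
          (\<Oplus>g\<in>carrier G. u (b (act (inv\<^bsub>G\<^esub> g) x)) g \<oplus> v (b (act (inv\<^bsub>G\<^esub> g) x)) g)"
          using that uv by (intro finsum_cong') (auto simp: free_module_simps FG_simps(3))
        then show ?thesis
          using that uv by (subst (asm) finsum_addf) auto
      qed
      then show ?thesis
        by (auto simp: t_def permutation_module_simps free_module_simps(2)[of F] intro!: restrict_ext)
    qed
    show "t (monomial F G a k \<odot>\<^bsub>?L\<^esub> v) = monomial F G a k \<odot>\<^bsub>?U\<^esub> t v"
      if a: "a \<in> carrier F" and k: "k \<in> carrier G" and v: "v \<in> carrier ?L" for a k v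
    proof -
      have tv: "t v \<in> carrier (free_module F X)"
        using tcl[OF v] by (simp add: permutation_module_simps)
      have mono: "monomial F G a k \<otimes>\<^bsub>FG\<^esub> v (b x) =
          (\<lambda>g\<in>carrier G. a \<otimes> v (b x) (inv\<^bsub>G\<^esub> k \<otimes>\<^bsub>G\<^esub> g))" if "x \<in> X" for x
        using that v by (intro monomial_mult[OF a k]) (auto simp: carL)
      have bij: "bij_betw (\<lambda>g. k \<otimes>\<^bsub>G\<^esub> g) (carrier G) (carrier G)"
        using k by (simp add: bij_betw_def G.inj_on_cmult G.surj_const_mult)
      have "(\<Oplus>g\<in>carrier G. (monomial F G a k \<odot>\<^bsub>?L\<^esub> v) (b (act (inv\<^bsub>G\<^esub> g) x)) g) =
          a \<otimes> t v (act (inv\<^bsub>G\<^esub> k) x)" if x: "x \<in> X" for x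
      proof -
        have "(\<Oplus>g\<in>carrier G. (monomial F G a k \<odot>\<^bsub>?L\<^esub> v) (b (act (inv\<^bsub>G\<^esub> g) x)) g) =
            (\<Oplus>g\<in>carrier G. a \<otimes> v (b (act (inv\<^bsub>G\<^esub> g) x)) (inv\<^bsub>G\<^esub> k \<otimes>\<^bsub>G\<^esub> g))"
          using x a k v by (intro finsum_cong') (auto simp: free_module_simps mono)
        also have "\<dots> = (\<Oplus>g\<in>carrier G.
            a \<otimes> v (b (act (inv\<^bsub>G\<^esub> (k \<otimes>\<^bsub>G\<^esub> g)) x)) (inv\<^bsub>G\<^esub> k \<otimes>\<^bsub>G\<^esub> (k \<otimes>\<^bsub>G\<^esub> g)))"
          using x a k v by (intro finsum_bij[OF bij, symmetric]) auto
        also have "\<dots> = (\<Oplus>g\<in>carrier G. a \<otimes> v (b (act (inv\<^bsub>G\<^esub> g) (act (inv\<^bsub>G\<^esub> k) x))) g)"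
          using x a k v
          by (intro finsum_cong')
            (auto simp: G.m_assoc[symmetric] G.inv_mult_group left_actionD(3)[OF act])
        also have "\<dots> = a \<otimes> (\<Oplus>g\<in>carrier G. v (b (act (inv\<^bsub>G\<^esub> g) (act (inv\<^bsub>G\<^esub> k) x))) g)"
          using x a k v finite_group by (intro finsum_rdistr[symmetric]) auto
        finally show ?thesis using x k by (simp add: t_def)
      qed
      then show ?thesis
        unfolding monomial_smult[OF act a k tv] by (auto simp: t_def intro!: restrict_ext)
    qed
  qed
  have "t (s u) = u" if u: "u \<in> carrier ?U" for u
  proof (rule extensionalityI[of _ X])
    fix x assume x: "x \<in> X"
    have "t (s u) x = (\<Oplus>g\<in>carrier G. c (act (inv\<^bsub>G\<^esub> g) x) \<otimes> u x)"
      using x u unfolding t_def s_def restrict_apply'[OF x]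
      by (intro finsum_cong') (auto simp: c G.left_action_inv[OF act])
    also have "\<dots> = (\<Oplus>g\<in>carrier G. c (act (inv\<^bsub>G\<^esub> g) x)) \<otimes> u x"
      using x u finite_group by (intro finsum_ldistr[symmetric]) (auto simp: c)
    finally show "t (s u) x = u x"
      using x u by (simp add: c)
  qed (use u in \<open>auto simp: t_def carU PiE_def\<close>)
  then show ?thesis
    using projective_moduleI[OF ring_FG P U h s t] by blast
qed

end

lemma (in group) inj_on_powers:
  assumes "g \<in> carrier G" "\<And>i. 0 < i \<Longrightarrow> i < p \<Longrightarrow> g [^] (i::nat) \<noteq> \<one>"
  shows "inj_on (\<lambda>i. g [^] i) {..<p}"
proof -
  have False if "i < j" "j < p" "g [^] i = g [^] j" for i j :: nat
  proof -
    have "g [^] i \<otimes> g [^] (j - i) = g [^] j"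
      using nat_pow_mult[OF assms(1), of i "j - i"] that(1) by simp
    then have "g [^] (j - i) = \<one>"
      using that(3) l_cancel_one[of "g [^] i" "g [^] (j - i)"] assms(1) by simp
    then show False using assms(2)[of "j - i"] that by simp
  qed
  then show ?thesis
    by (intro linorder_inj_onI) auto
qed

lemma (in group) cyclic_transversal:
  fixes p :: nat
  assumes g: "g \<in> carrier G" and p: "p > 0" "g [^] p = \<one>"
    and ord: "\<And>i. 0 < i \<Longrightarrow> i < p \<Longrightarrow> g [^] (i::nat) \<noteq> \<one>"
  obtains D where "\<And>k. k \<in> carrier G \<Longrightarrow> \<exists>!i. i < p \<and> g [^] i \<otimes> k \<in> D"
proof -
  define Orb where "Orb k = range (\<lambda>i::nat. g [^] i \<otimes> k)" for k
  define rep where "rep k = (SOME k'. k' \<in> Orb k)" for k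
  have rep: "rep k \<in> Orb k" for k
    unfolding rep_def by (rule someI[of _ "g [^] (0::nat) \<otimes> k"]) (unfold Orb_def, rule rangeI)
  have Orb: "Orb (g [^] i \<otimes> k) = Orb k" if k: "k \<in> carrier G" for i :: nat and k
  proof
    show "Orb (g [^] i \<otimes> k) \<subseteq> Orb k"
      using k g by (auto simp: Orb_def m_assoc[symmetric] nat_pow_mult)
    show "Orb k \<subseteq> Orb (g [^] i \<otimes> k)"
    proof
      fix y assume "y \<in> Orb k"
      then obtain j :: nat where y: "y = g [^] j \<otimes> k" by (auto simp: Orb_def)
      have "g [^] (j + i * (p - 1) + i) = g [^] j \<otimes> (g [^] p) [^] i"
      proof -
        have "j + i * (p - 1) + i = j + p * i" using p(1) by (cases p) simp_all
        then show ?thesis using g by (simp only: nat_pow_mult nat_pow_pow nat_pow_closed)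
      qed
      then have "y = g [^] (j + i * (p - 1)) \<otimes> (g [^] i \<otimes> k)"
        using g k p(2) y by (simp add: m_assoc[symmetric] nat_pow_mult)
      then show "y \<in> Orb (g [^] i \<otimes> k)" by (auto simp: Orb_def)
    qed
  qed
  show thesis
  proof (rule that[of "{k. rep k = k}"])
    fix k assume k: "k \<in> carrier G"
    have rep_eq: "rep (g [^] i \<otimes> k) = rep k" for i :: nat
      using Orb[OF k] by (simp add: rep_def)
    obtain j :: nat where "rep k = g [^] j \<otimes> k"
      using rep[of k] by (auto simp: Orb_def)
    moreover have "g [^] j = g [^] (j mod p)"
    proof -
      have "g [^] (p * (j div p) + j mod p) = (g [^] p) [^] (j div p) \<otimes> g [^] (j mod p)"
        using g by (simp only: nat_pow_mult nat_pow_pow nat_pow_closed)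
      then show ?thesis using g p(2) by simp
    qed
    ultimately have j: "rep k = g [^] (j mod p) \<otimes> k" by simp
    show "\<exists>!i. i < p \<and> g [^] i \<otimes> k \<in> {k. rep k = k}"
    proof (rule ex1I[of _ "j mod p"])
      show "j mod p < p \<and> g [^] (j mod p) \<otimes> k \<in> {k. rep k = k}"
        using p(1) j rep_eq by simp
    next
      fix i assume i: "i < p \<and> g [^] i \<otimes> k \<in> {k. rep k = k}"
      then have "g [^] i \<otimes> k = g [^] (j mod p) \<otimes> k" using rep_eq j by simp
      then have "g [^] i = g [^] (j mod p)" using g k by simp
      then show "i = j mod p"
        using inj_onD[OF inj_on_powers[OF g ord]] i p(1) by simp
    qed
  qed
qed

context finite_group_algebra
begin

text \<open>
  On a projective module every vector fixed by the cyclic group generated by \<open>g\<close> is a norm,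
  as this holds on free modules. But the coefficient of a norm at a fixed point \<open>x\<close> of \<open>g\<close> is a
  multiple of \<open>p\<close>, so the basis vector at \<open>x\<close> is not a norm.
\<close>

lemma projective_permutation_moduleD:
  fixes P :: "('c \<Rightarrow> 'a, 'm, 'e) module_scheme" and p :: nat
  assumes act: "left_action G X act"
    and proj: "projective_module FG P"
    and h: "h \<in> left_module_hom FG P (permutation_module F G X act)"
      "bij_betw h (carrier P) (carrier (permutation_module F G X act))"
    and nontriv: "\<one> \<noteq> \<zero>" and char: "[p] \<cdot> \<one> = \<zero>"
    and g: "g \<in> carrier G" and p: "p > 0" "g [^]\<^bsub>G\<^esub> p = \<one>\<^bsub>G\<^esub>"
    and ord: "\<And>i. 0 < i \<Longrightarrow> i < p \<Longrightarrow> g [^]\<^bsub>G\<^esub> (i::nat) \<noteq> \<one>\<^bsub>G\<^esub>"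
    and x: "x \<in> X"
  shows "act g x \<noteq> x"
proof
  assume gx: "act g x = x"
  let ?U = "permutation_module F G X act"
  note [simp] = finite_group g
  have powx: "act (g [^]\<^bsub>G\<^esub> i) x = x" for i :: nat
    by (induction i) (simp_all add: x gx left_actionD(2,3)[OF act])
  have inj: "inj_on (\<lambda>i. g [^]\<^bsub>G\<^esub> i) {..<p}"
    using G.inj_on_powers[OF g ord] .
  define \<nu> where "\<nu> = (\<lambda>k\<in>carrier G. if inv\<^bsub>G\<^esub> k \<in> (\<lambda>i. g [^]\<^bsub>G\<^esub> i) ` {..<p} then \<one> else \<zero>)"
  have \<nu>: "\<nu> \<in> carrier FG"
    by (auto simp: \<nu>_def group_algebra_def)
  have norm: "\<nu> \<odot>\<^bsub>permutation_module F G S a\<^esub> v = (\<lambda>y\<in>S. \<Oplus>i\<in>{..<p}. v (a (g [^]\<^bsub>G\<^esub> i) y))"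
    if a: "left_action G S a" and v: "v \<in> carrier (free_module F S)" for S a v
  proof -
    have "(\<Oplus>k\<in>carrier G. \<nu> k \<otimes> v (a (inv\<^bsub>G\<^esub> k) y)) = (\<Oplus>i\<in>{..<p}. v (a (g [^]\<^bsub>G\<^esub> i) y))"
      if y: "y \<in> S" for y
    proof -
      note [simp] = free_moduleD[OF v] left_actionD(1)[OF a] y
      let ?C = "(\<lambda>i. g [^]\<^bsub>G\<^esub> i) ` {..<p}"
      have "bij_betw (\<lambda>k. inv\<^bsub>G\<^esub> k) (carrier G) (carrier G)"
        by (rule bij_betw_byWitness[where f' = "\<lambda>k. inv\<^bsub>G\<^esub> k"]) auto
      then have "(\<Oplus>k\<in>carrier G. \<nu> k \<otimes> v (a (inv\<^bsub>G\<^esub> k) y)) =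
          (\<Oplus>k\<in>carrier G. \<nu> (inv\<^bsub>G\<^esub> k) \<otimes> v (a (inv\<^bsub>G\<^esub> (inv\<^bsub>G\<^esub> k)) y))"
        using FG_closed[OF \<nu>] by (intro finsum_bij[symmetric]) auto
      also have "\<dots> = (\<Oplus>k\<in>?C. v (a k y))"
        by (intro add.finprod_mono_neutral_cong_right) (auto simp: \<nu>_def)
      also have "\<dots> = (\<Oplus>i\<in>{..<p}. v (a (g [^]\<^bsub>G\<^esub> i) y))"
        using inj by (intro finsum_bij[symmetric]) (auto simp: bij_betw_def)
      finally show ?thesis .
    qed
    then show ?thesis by (auto simp: permutation_module_simps intro!: restrict_ext)
  qed
  obtain S :: "'m set" and N Q f where N: "submodule N FG (free_module FG S)" and Q: "submodule Q FG (free_module FG S)"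
    and NQ: "N \<inter> Q = {\<zero>\<^bsub>free_module FG S\<^esub>}"
      "N <+>\<^bsub>free_module FG S\<^esub> Q = carrier (free_module FG S)"
    and f: "f \<in> left_module_hom FG P (free_module FG S)" "bij_betw f (carrier P) N"
    and P: "left_module FG P"
    using proj unfolding projective_module_def by blast
  let ?L = "free_module FG S"
  interpret R: ring FG by (rule ring_FG)
  interpret P: left_module FG P by fact
  interpret L: left_module FG ?L by (rule R.left_module_free_module)
  have ex: "basis_vector F X x \<in> carrier ?U"
    using basis_vector_closed by (simp add: permutation_module_simps)
  then obtain y where y: "y \<in> carrier P" "h y = basis_vector F X x"
    using h(2) by (metis bij_betw_def imageE)
  define v where "v = f y"
  have v: "v \<in> carrier ?L" "v \<in> N"
    using left_module_homD(1)[OF f(1) y(1)] f(2) y(1) by (auto simp: v_def bij_betw_def)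
  have "act (inv\<^bsub>G\<^esub> g) x = x"
    using G.left_action_inv(1)[OF act g x] gx by simp
  then have "monomial F G \<one> (inv\<^bsub>G\<^esub> g) \<odot>\<^bsub>?U\<^esub> h y = h y"
    using monomial_smult_basis_vector[OF act one_closed _ x, of "inv\<^bsub>G\<^esub> g"] y(2) ex
      left_module.smult_one[OF left_module_free_module, of _ X]
    by (simp add: permutation_module_simps)
  then have "h (monomial F G \<one> (inv\<^bsub>G\<^esub> g) \<odot>\<^bsub>P\<^esub> y) = h y"
    using left_module_homD(3)[OF h(1) _ y(1)] by (simp add: monomial_closed)
  then have "monomial F G \<one> (inv\<^bsub>G\<^esub> g) \<odot>\<^bsub>P\<^esub> y = y"
    by (rule inj_onD[OF bij_betw_imp_inj_on[OF h(2)]])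
      (simp_all add: y monomial_closed P.smult_closed)
  then have gv: "monomial F G \<one> (inv\<^bsub>G\<^esub> g) \<odot>\<^bsub>?L\<^esub> v = v"
    using left_module_homD(3)[OF f(1) _ y(1), of "monomial F G \<one> (inv\<^bsub>G\<^esub> g)"]
    by (simp add: monomial_closed v_def)
  have vs: "v s \<in> carrier FG" if "s \<in> S" for s
    using v(1) that by (rule free_moduleD)
  have vsk: "v s k \<in> carrier F" if "s \<in> S" "k \<in> carrier G" for s k
    using vs that by (simp add: FG_closed)
  have fixed1: "v s (g \<otimes>\<^bsub>G\<^esub> k) = v s k" if s: "s \<in> S" and k: "k \<in> carrier G" for s k
  proof -
    have "v s = monomial F G \<one> (inv\<^bsub>G\<^esub> g) \<otimes>\<^bsub>FG\<^esub> v s"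
      using fun_cong[OF gv, of s] s by (simp add: free_module_simps)
    then have "v s k = (monomial F G \<one> (inv\<^bsub>G\<^esub> g) \<otimes>\<^bsub>FG\<^esub> v s) k" by simp
    then show ?thesis
      using s k vs vsk by (simp add: monomial_mult)
  qed
  have fixed: "v s (g [^]\<^bsub>G\<^esub> i \<otimes>\<^bsub>G\<^esub> k) = v s k" if "s \<in> S" "k \<in> carrier G" for s k and i :: nat
    using that by (induction i arbitrary: k) (simp_all add: fixed1 G.m_assoc)
  obtain D where D: "\<And>k. k \<in> carrier G \<Longrightarrow> \<exists>!i. i < p \<and> g [^]\<^bsub>G\<^esub> i \<otimes>\<^bsub>G\<^esub> k \<in> D"
    using G.cyclic_transversal[OF g p ord] by blast
  define w where "w = (\<lambda>s\<in>S. \<lambda>k\<in>carrier G. if k \<in> D then v s k else \<zero>)"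
  have w: "w \<in> carrier ?L"
  proof -
    have "w s \<in> carrier FG" if "s \<in> S" for s
      using that vsk by (auto simp: w_def group_algebra_def)
    moreover have "{s \<in> S. w s \<noteq> \<zero>\<^bsub>FG\<^esub>} \<subseteq> {s \<in> S. v s \<noteq> \<zero>\<^bsub>FG\<^esub>}"
      by (auto simp: w_def FG_simps free_module_simps)
    then have "finite {s \<in> S. w s \<noteq> \<zero>\<^bsub>FG\<^esub>}"
      using v(1) by (rule_tac finite_subset) (auto simp: mem_free_module)
    ultimately show ?thesis
      by (auto simp: mem_free_module w_def)
  qed
  have "\<nu> \<odot>\<^bsub>?L\<^esub> w = v"
  proof (rule extensionalityI[of _ S])
    fix s assume s: "s \<in> S"
    have ws: "w s \<in> carrier (free_module F (carrier G))"
      using free_moduleD[OF w s] by (simp add: FG_simps)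
    have "\<nu> \<otimes>\<^bsub>FG\<^esub> w s = v s"
    proof (rule extensionalityI[of _ "carrier G"])
      fix k assume k: "k \<in> carrier G"
      obtain j where j: "j < p" "g [^]\<^bsub>G\<^esub> j \<otimes>\<^bsub>G\<^esub> k \<in> D"
        "\<And>i. i < p \<Longrightarrow> g [^]\<^bsub>G\<^esub> i \<otimes>\<^bsub>G\<^esub> k \<in> D \<Longrightarrow> i = j"
        using D[OF k] by blast
      have "(\<nu> \<otimes>\<^bsub>FG\<^esub> w s) k = (\<Oplus>i\<in>{..<p}. w s (g [^]\<^bsub>G\<^esub> i \<otimes>\<^bsub>G\<^esub> k))"
        using norm[OF left_action_mult ws] k by (simp add: FG_simps)
      also have "\<dots> = (\<Oplus>i\<in>{..<p}. if i = j then v s k else \<zero>)"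
        using s k j(1,2) vsk by (intro finsum_cong') (auto simp: w_def fixed dest: j(3))
      also have "\<dots> = v s k"
        using j(1) s k vsk by (intro finsum_delta) auto
      finally show "(\<nu> \<otimes>\<^bsub>FG\<^esub> w s) k = v s k" .
    next
      show "v s \<in> extensional (carrier G)"
        using vs[OF s] by (simp add: FG_simps mem_free_module)
    qed (simp add: FG_simps permutation_module_simps)
    then show "(\<nu> \<odot>\<^bsub>?L\<^esub> w) s = v s"
      using s by (simp add: free_module_simps)
  qed (use v(1) in \<open>simp_all add: free_module_simps mem_free_module\<close>)
  moreover have "w \<in> N <+>\<^bsub>?L\<^esub> Q" using w NQ(2) by simp
  then obtain n q where nq: "n \<in> N" "q \<in> Q" "w = n \<oplus>\<^bsub>?L\<^esub> q"
    unfolding set_add_defs by auto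
  ultimately have eq: "v = \<nu> \<odot>\<^bsub>?L\<^esub> n \<oplus>\<^bsub>?L\<^esub> \<nu> \<odot>\<^bsub>?L\<^esub> q"
    using L.smult_r_distr[OF \<nu>, of n q] submoduleD(1)[OF N] submoduleD(1)[OF Q]
    by (simp add: subset_iff)
  have nuN: "\<nu> \<odot>\<^bsub>?L\<^esub> n \<in> N" and nuQ: "\<nu> \<odot>\<^bsub>?L\<^esub> q \<in> Q"
    using submoduleD(4)[OF N \<nu> nq(1)] submoduleD(4)[OF Q \<nu> nq(2)] .
  then have cl: "\<nu> \<odot>\<^bsub>?L\<^esub> n \<in> carrier ?L" "\<nu> \<odot>\<^bsub>?L\<^esub> q \<in> carrier ?L"
    using submoduleD(1)[OF N] submoduleD(1)[OF Q] by (simp_all add: subset_iff)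
  have "\<nu> \<odot>\<^bsub>?L\<^esub> q = \<ominus>\<^bsub>?L\<^esub> (\<nu> \<odot>\<^bsub>?L\<^esub> n) \<oplus>\<^bsub>?L\<^esub> v"
    unfolding eq using cl by (simp add: L.M.r_neg1)
  then have "\<nu> \<odot>\<^bsub>?L\<^esub> q \<in> N"
    using submoduleD(3)[OF N submoduleD(5)[OF N nuN] v(2)] by simp
  then have "\<nu> \<odot>\<^bsub>?L\<^esub> q = \<zero>\<^bsub>?L\<^esub>" using nuQ NQ(1) by blast
  then have vn: "v = \<nu> \<odot>\<^bsub>?L\<^esub> n" using eq cl by simp
  obtain z where z: "z \<in> carrier P" "n = f z"
    using nq(1) f(2) by (metis bij_betw_def imageE)
  have "f (\<nu> \<odot>\<^bsub>P\<^esub> z) = f y"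
    using vn left_module_homD(3)[OF f(1) \<nu> z(1)] z(2) by (simp add: v_def)
  then have "\<nu> \<odot>\<^bsub>P\<^esub> z = y"
    by (rule inj_onD[OF bij_betw_imp_inj_on[OF f(2)]]) (simp_all add: y P.smult_closed \<nu> z)
  then have "basis_vector F X x = \<nu> \<odot>\<^bsub>?U\<^esub> h z"
    using y(2) left_module_homD(3)[OF h(1) \<nu> z(1)] by simp
  moreover have hz: "h z \<in> carrier (free_module F X)"
    using left_module_homD(1)[OF h(1) z(1)] by (simp add: permutation_module_simps)
  ultimately have "basis_vector F X x x = (\<Oplus>i\<in>{..<p}. h z x)"
    using norm[OF act hz] x by (simp add: powx)
  also have "\<dots> = [p] \<cdot> h z x"
    using free_moduleD[OF hz x] by (simp add: add.finprod_const)
  also have "\<dots> = [p] \<cdot> \<one> \<otimes> h z x"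
    using free_moduleD[OF hz x] by (simp add: add_pow_ldistr)
  also have "\<dots> = \<zero>"
    using free_moduleD[OF hz x] by (simp add: char)
  finally show False
    using x nontriv by (simp add: basis_vector_def)
qed

end

section \<open>Symmetric powers of permutation modules\<close>

definition multisets_of_size :: "'x set \<Rightarrow> nat \<Rightarrow> 'x multiset set"
  where "multisets_of_size \<Omega> a = {x. set_mset x \<subseteq> \<Omega> \<and> size x = a}"

lemma finite_multisets_of_size:
  assumes "finite \<Omega>"
  shows "finite (multisets_of_size \<Omega> a)"
proof -
  have "multisets_of_size \<Omega> a \<subseteq> mset ` {ts. set ts \<subseteq> \<Omega> \<and> length ts = a}"
  proof
    fix x assume x: "x \<in> multisets_of_size \<Omega> a"
    obtain ts where "mset ts = x" using ex_mset by blast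
    with x show "x \<in> mset ` {ts. set ts \<subseteq> \<Omega> \<and> length ts = a}"
      by (auto simp: multisets_of_size_def)
  qed
  then show ?thesis
    by (rule finite_subset) (intro finite_imageI finite_lists_length_eq assms)
qed

lemma left_action_multisets:
  assumes "left_action G \<Omega> act"
  shows "left_action G (multisets_of_size \<Omega> a) (\<lambda>g. image_mset (act g))"
  unfolding left_action_def
proof (intro conjI ballI)
  note act = left_actionD[OF assms]
  fix x assume x: "x \<in> multisets_of_size \<Omega> a"
  have "image_mset (act \<one>\<^bsub>G\<^esub>) x = image_mset (\<lambda>t. t) x"
    using x act(2) by (intro image_mset_cong) (auto simp: multisets_of_size_def)
  then show "image_mset (act \<one>\<^bsub>G\<^esub>) x = x" by simp
  fix g assume g: "g \<in> carrier G"
  with x show "image_mset (act g) x \<in> multisets_of_size \<Omega> a"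
    using act(1) by (auto simp: multisets_of_size_def)
  fix h assume h: "h \<in> carrier G"
  have "image_mset (act (g \<otimes>\<^bsub>G\<^esub> h)) x = image_mset (\<lambda>t. act g (act h t)) x"
    using x g h act(3) by (intro image_mset_cong) (auto simp: multisets_of_size_def)
  then show "image_mset (act (g \<otimes>\<^bsub>G\<^esub> h)) x = image_mset (act g) (image_mset (act h) x)"
    by (simp add: multiset.map_comp comp_def)
qed

lemma left_action_lists:
  assumes "left_action G \<Omega> act"
  shows "left_action G {ts. length ts = a \<and> set ts \<subseteq> \<Omega>} (\<lambda>g. map (act g))"
  unfolding left_action_def
proof (intro conjI ballI)
  note act = left_actionD[OF assms]
  fix ts assume ts: "ts \<in> {ts. length ts = a \<and> set ts \<subseteq> \<Omega>}"
  show "map (act \<one>\<^bsub>G\<^esub>) ts = ts"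
    using ts act(2) by (intro map_idI) auto
  fix g assume g: "g \<in> carrier G"
  with ts show "map (act g) ts \<in> {ts. length ts = a \<and> set ts \<subseteq> \<Omega>}"
    using act(1) by auto
  fix h assume h: "h \<in> carrier G"
  show "map (act (g \<otimes>\<^bsub>G\<^esub> h)) ts = map (act g) (map (act h) ts)"
    using ts g h act(3) by (auto simp: subset_iff)
qed

text \<open>
  The coefficient of the monomial \<open>x\<close> in the product of linear forms \<open>ms\<close> in the symmetric
  algebra on the basis \<open>\<Omega>\<close>.
\<close>

primrec (in cring) product_coeff :: "'x set \<Rightarrow> ('x \<Rightarrow> 'a) list \<Rightarrow> 'x multiset \<Rightarrow> 'a"
  where
    "product_coeff \<Omega> [] x = (if x = {#} then \<one> else \<zero>)"
  | "product_coeff \<Omega> (m # ms) x =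
      (\<Oplus>t\<in>\<Omega>. if t \<in># x then m t \<otimes> product_coeff \<Omega> ms (x - {#t#}) else \<zero>)"

context cring
begin

lemma product_coeff_closed:
  "set ms \<subseteq> carrier (free_module R \<Omega>) \<Longrightarrow> product_coeff \<Omega> ms x \<in> carrier R"
  by (induction ms arbitrary: x) (auto intro!: finsum_closed simp: free_moduleD)

lemma product_coeff_add:
  assumes "set us \<subseteq> carrier (free_module R \<Omega>)" "set vs \<subseteq> carrier (free_module R \<Omega>)"
    and m: "m \<in> carrier (free_module R \<Omega>)" "m' \<in> carrier (free_module R \<Omega>)"
  shows "product_coeff \<Omega> (us @ (m \<oplus>\<^bsub>free_module R \<Omega>\<^esub> m') # vs) x =
    product_coeff \<Omega> (us @ m # vs) x \<oplus> product_coeff \<Omega> (us @ m' # vs) x"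
  using assms(1)
proof (induction us arbitrary: x)
  case Nil
  note [simp] = free_moduleD[OF m(1)] free_moduleD[OF m(2)] product_coeff_closed[OF assms(2)]
  have "(\<Oplus>t\<in>\<Omega>. if t \<in># x then (m \<oplus>\<^bsub>free_module R \<Omega>\<^esub> m') t \<otimes> product_coeff \<Omega> vs (x - {#t#}) else \<zero>) =
      (\<Oplus>t\<in>\<Omega>. (if t \<in># x then m t \<otimes> product_coeff \<Omega> vs (x - {#t#}) else \<zero>) \<oplus>
        (if t \<in># x then m' t \<otimes> product_coeff \<Omega> vs (x - {#t#}) else \<zero>))"
    by (intro finsum_cong') (auto simp: free_module_simps l_distr)
  then show ?case
    by (simp add: finsum_addf Pi_def)
next
  case (Cons u us)
  have [simp]: "u t \<in> carrier R" if "t \<in> \<Omega>" for t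
    using Cons that by (auto intro: free_moduleD)
  have [simp]: "product_coeff \<Omega> (us @ m # vs) x \<in> carrier R"
    "product_coeff \<Omega> (us @ m' # vs) x \<in> carrier R" for x
    using Cons assms by (auto intro!: product_coeff_closed)
  have "(\<Oplus>t\<in>\<Omega>. if t \<in># x then u t \<otimes>
        product_coeff \<Omega> (us @ (m \<oplus>\<^bsub>free_module R \<Omega>\<^esub> m') # vs) (x - {#t#}) else \<zero>) =
      (\<Oplus>t\<in>\<Omega>. (if t \<in># x then u t \<otimes> product_coeff \<Omega> (us @ m # vs) (x - {#t#}) else \<zero>) \<oplus>
        (if t \<in># x then u t \<otimes> product_coeff \<Omega> (us @ m' # vs) (x - {#t#}) else \<zero>))"
    using Cons by (intro finsum_cong') (auto simp: r_distr)
  then show ?case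
    by (simp add: finsum_addf Pi_def)
qed

lemma product_coeff_smult:
  assumes "set us \<subseteq> carrier (free_module R \<Omega>)" "set vs \<subseteq> carrier (free_module R \<Omega>)"
    and m: "m \<in> carrier (free_module R \<Omega>)" and c: "c \<in> carrier R" and fin: "finite \<Omega>"
  shows "product_coeff \<Omega> (us @ (c \<odot>\<^bsub>free_module R \<Omega>\<^esub> m) # vs) x =
    c \<otimes> product_coeff \<Omega> (us @ m # vs) x"
  using assms(1)
proof (induction us arbitrary: x)
  case Nil
  note [simp] = free_moduleD[OF m] product_coeff_closed[OF assms(2)] c
  have "(\<Oplus>t\<in>\<Omega>. if t \<in># x then (c \<odot>\<^bsub>free_module R \<Omega>\<^esub> m) t \<otimes> product_coeff \<Omega> vs (x - {#t#}) else \<zero>) =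
      (\<Oplus>t\<in>\<Omega>. c \<otimes> (if t \<in># x then m t \<otimes> product_coeff \<Omega> vs (x - {#t#}) else \<zero>))"
    by (intro finsum_cong') (auto simp: free_module_simps m_assoc)
  then show ?case
    using fin by (simp add: finsum_rdistr Pi_def)
next
  case (Cons u us)
  have [simp]: "u t \<in> carrier R" if "t \<in> \<Omega>" for t
    using Cons that by (auto intro: free_moduleD)
  have [simp]: "product_coeff \<Omega> (us @ m # vs) x \<in> carrier R" for x
    using Cons assms by (auto intro!: product_coeff_closed)
  have "(\<Oplus>t\<in>\<Omega>. if t \<in># x then u t \<otimes>
        product_coeff \<Omega> (us @ (c \<odot>\<^bsub>free_module R \<Omega>\<^esub> m) # vs) (x - {#t#}) else \<zero>) =
      (\<Oplus>t\<in>\<Omega>. c \<otimes> (if t \<in># x then u t \<otimes> product_coeff \<Omega> (us @ m # vs) (x - {#t#}) else \<zero>))"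
    using Cons c by (intro finsum_cong') (auto simp: m_lcomm)
  then show ?case
    using fin c by (simp add: finsum_rdistr Pi_def)
qed

lemma product_coeff_swap:
  assumes "set ms \<subseteq> carrier (free_module R \<Omega>)" and fin: "finite \<Omega>"
    and m: "m \<in> carrier (free_module R \<Omega>)" "m' \<in> carrier (free_module R \<Omega>)"
  shows "product_coeff \<Omega> (m # m' # ms) x = product_coeff \<Omega> (m' # m # ms) x"
proof -
  have expand: "product_coeff \<Omega> (m # m' # ms) x =
      (\<Oplus>t\<in>\<Omega>. \<Oplus>t'\<in>\<Omega>. if {#t, t'#} \<subseteq># x
        then m t \<otimes> (m' t' \<otimes> product_coeff \<Omega> ms (x - {#t, t'#})) else \<zero>)"
    if m: "m \<in> carrier (free_module R \<Omega>)" "m' \<in> carrier (free_module R \<Omega>)" for m m'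
  proof -
    note [simp] = free_moduleD[OF m(1)] free_moduleD[OF m(2)] product_coeff_closed[OF assms(1)]
    have "(if t \<in># x then m t \<otimes> product_coeff \<Omega> (m' # ms) (x - {#t#}) else \<zero>) =
        (\<Oplus>t'\<in>\<Omega>. if {#t, t'#} \<subseteq># x
          then m t \<otimes> (m' t' \<otimes> product_coeff \<Omega> ms (x - {#t, t'#})) else \<zero>)" if t: "t \<in> \<Omega>" for t
    proof (cases "t \<in># x")
      case True
      then have sub: "{#t, t'#} \<subseteq># x \<longleftrightarrow> t' \<in># x - {#t#}" for t'
        by (simp add: insert_subset_eq_iff)
      have "m t \<otimes> product_coeff \<Omega> (m' # ms) (x - {#t#}) = (\<Oplus>t'\<in>\<Omega>. m t \<otimes>
          (if t' \<in># x - {#t#} then m' t' \<otimes> product_coeff \<Omega> ms (x - {#t#} - {#t'#}) else \<zero>))"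
        using fin t by (simp add: finsum_rdistr Pi_def)
      also have "\<dots> = (\<Oplus>t'\<in>\<Omega>. if {#t, t'#} \<subseteq># x
          then m t \<otimes> (m' t' \<otimes> product_coeff \<Omega> ms (x - {#t, t'#})) else \<zero>)"
        unfolding sub using t by (intro finsum_cong') (auto simp: add_mset_commute)
      finally show ?thesis using True by simp
    next
      case False
      then have "\<not> {#t, t'#} \<subseteq># x" for t'
        by (meson mset_subset_eq_insertD mset_subset_eqD union_single_eq_member)
      then show ?thesis using False by (simp add: finsum_zero)
    qed
    then show ?thesis
      by (simp only: product_coeff.simps(2)[of \<Omega> m]) (intro finsum_cong', auto intro!: finsum_closed)
  qed
  note [simp] = free_moduleD[OF m(1)] free_moduleD[OF m(2)] product_coeff_closed[OF assms(1)]
  have "product_coeff \<Omega> (m # m' # ms) x =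
      (\<Oplus>t'\<in>\<Omega>. \<Oplus>t\<in>\<Omega>. if {#t, t'#} \<subseteq># x
        then m t \<otimes> (m' t' \<otimes> product_coeff \<Omega> ms (x - {#t, t'#})) else \<zero>)"
    unfolding expand[OF m] using fin by (intro finsum_swap) auto
  also have "\<dots> = product_coeff \<Omega> (m' # m # ms) x"
    unfolding expand[OF m(2,1)]
    by (intro finsum_cong') (auto simp: m_lcomm add_mset_commute intro!: finsum_closed)
  finally show ?thesis .
qed

lemma product_coeff_move:
  assumes "set us \<subseteq> carrier (free_module R \<Omega>)" "set vs \<subseteq> carrier (free_module R \<Omega>)"
    and m: "m \<in> carrier (free_module R \<Omega>)" and fin: "finite \<Omega>"
  shows "product_coeff \<Omega> (us @ m # vs) x = product_coeff \<Omega> (m # us @ vs) x"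
  using assms(1)
proof (induction us arbitrary: x)
  case (Cons u us)
  then have "product_coeff \<Omega> (us @ m # vs) = product_coeff \<Omega> (m # us @ vs)"
    by (intro ext) simp
  then have "product_coeff \<Omega> ((u # us) @ m # vs) x = product_coeff \<Omega> (u # m # us @ vs) x"
    unfolding append_Cons product_coeff.simps(2)[of \<Omega> u] by (rule arg_cong)
  also have "\<dots> = product_coeff \<Omega> (m # u # us @ vs) x"
    using Cons assms by (intro product_coeff_swap) auto
  finally show ?case by simp
qed simp

lemma product_coeff_perm:
  assumes "mset us = mset vs" "set us \<subseteq> carrier (free_module R \<Omega>)" and fin: "finite \<Omega>"
  shows "product_coeff \<Omega> us x = product_coeff \<Omega> vs x"
  using assms(1,2)
proof (induction us arbitrary: vs x)
  case (Cons u us)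
  then have "u \<in> set vs" by (metis list.set_intros(1) mset_eq_setD)
  then obtain v1 v2 where vs: "vs = v1 @ u # v2" by (meson split_list)
  have set: "set vs \<subseteq> carrier (free_module R \<Omega>)" using Cons by (metis mset_eq_setD)
  have "mset us = mset (v1 @ v2)" using Cons vs by simp
  then have "product_coeff \<Omega> us = product_coeff \<Omega> (v1 @ v2)"
    using Cons by auto
  then have "product_coeff \<Omega> (u # us) x = product_coeff \<Omega> (u # v1 @ v2) x"
    unfolding product_coeff.simps(2) by (rule arg_cong)
  also have "\<dots> = product_coeff \<Omega> vs x"
    unfolding vs using set vs fin by (intro product_coeff_move[symmetric]) auto
  finally show ?case .
qed simp

lemma product_coeff_basis:
  assumes "set ts \<subseteq> \<Omega>" "finite \<Omega>"
  shows "product_coeff \<Omega> (map (basis_vector R \<Omega>) ts) x = (if x = mset ts then \<one> else \<zero>)"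
  using assms(1)
proof (induction ts arbitrary: x)
  case (Cons t ts)
  have eq: "x = add_mset t (mset ts) \<longleftrightarrow> t \<in># x \<and> x - {#t#} = mset ts"
    by (auto dest: insert_DiffM)
  have bv: "basis_vector R \<Omega> t s = (if s = t then \<one> else \<zero>)" if "s \<in> \<Omega>" for s
    using that by (simp add: basis_vector_def)
  have "product_coeff \<Omega> (map (basis_vector R \<Omega>) (t # ts)) x =
      (\<Oplus>s\<in>\<Omega>. if s = t then if x = mset (t # ts) then \<one> else \<zero> else \<zero>)"
    unfolding list.map product_coeff.simps
    using Cons by (intro finsum_cong') (auto simp: bv eq)
  also have "\<dots> = (if x = mset (t # ts) then \<one> else \<zero>)"
    using Cons assms(2) by (intro finsum_delta) auto
  finally show ?case .
qed simp

end

context finite_group_algebra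
begin

lemma linear_extension_hom:
  assumes act: "left_action G S act" and act': "left_action G X act'" and X: "finite X"
    and f: "\<And>s. s \<in> S \<Longrightarrow> f s \<in> carrier (free_module F X)"
    and equi: "\<And>g s x. g \<in> carrier G \<Longrightarrow> s \<in> S \<Longrightarrow> x \<in> X \<Longrightarrow> f (act g s) x = f s (act' (inv\<^bsub>G\<^esub> g) x)"
  defines "H \<equiv> \<lambda>v. \<lambda>x\<in>X. \<Oplus>s\<in>{s \<in> S. v s \<noteq> \<zero>}. v s \<otimes> f s x"
  shows "H \<in> left_module_hom FG (permutation_module F G S act) (permutation_module F G X act')"
    and "\<And>s. s \<in> S \<Longrightarrow> H (basis_vector F S s) = f s"
proof -
  let ?T = "permutation_module F G S act" and ?U = "permutation_module F G X act'"
  note actD [simp] = left_actionD(1)[OF act] left_actionD(1)[OF act']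
  have fcl [simp]: "f s x \<in> carrier F" if "s \<in> S" "x \<in> X" for s x
    using free_moduleD[OF f] that by blast
  have vcl: "v s \<in> carrier F" if "v \<in> carrier ?T" "s \<in> S" for v s
    using that by (simp add: permutation_module_simps free_moduleD)
  have H: "H v x = (\<Oplus>s\<in>A. v s \<otimes> f s x)"
    if "x \<in> X" "finite A" "A \<subseteq> S" "{s \<in> S. v s \<noteq> \<zero>} \<subseteq> A" "v \<in> carrier ?T" for v A x
    unfolding H_def restrict_apply'[OF that(1)]
    using that(1-4) vcl[OF that(5)] by (intro add.finprod_mono_neutral_cong_left) auto
  have fin: "finite {s \<in> S. v s \<noteq> \<zero>}" if "v \<in> carrier ?T" for v
    using that by (simp add: permutation_module_simps mem_free_module)
  interpret T: left_module FG ?T by (rule left_module_permutation_module[OF act])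
  interpret U: left_module FG ?U by (rule left_module_permutation_module[OF act'])
  show "H \<in> left_module_hom FG ?T ?U"
  proof (rule left_module_hom_monomialI[OF T.left_module_axioms U.left_module_axioms])
    show Hcl: "H v \<in> carrier ?U" if "v \<in> carrier ?T" for v
      using vcl[OF that]
      by (auto simp: H_def permutation_module_simps mem_free_module_finite[OF X] intro!: finsum_closed)
    show "H (u \<oplus>\<^bsub>?T\<^esub> v) = H u \<oplus>\<^bsub>?U\<^esub> H v" if u: "u \<in> carrier ?T" and v: "v \<in> carrier ?T" for u v
    proof (rule extensionalityI[of _ X])
      fix x assume x: "x \<in> X"
      let ?A = "{s \<in> S. u s \<noteq> \<zero>} \<union> {s \<in> S. v s \<noteq> \<zero>}"
      note [simp] = vcl[OF u] vcl[OF v] x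
      have A: "finite ?A" "?A \<subseteq> S" using fin u v by auto
      have "H (u \<oplus>\<^bsub>?T\<^esub> v) x = (\<Oplus>s\<in>?A. (u \<oplus>\<^bsub>?T\<^esub> v) s \<otimes> f s x)"
        by (intro H x A T.M.add.m_closed u v) (auto simp: permutation_module_simps(3) free_module_simps)
      also have "\<dots> = (\<Oplus>s\<in>?A. u s \<otimes> f s x \<oplus> v s \<otimes> f s x)"
        by (intro finsum_cong') (auto simp: permutation_module_simps(3) free_module_simps l_distr)
      also have "\<dots> = H u x \<oplus> H v x"
        unfolding H[OF x A _ u, OF Un_upper1] H[OF x A _ v, OF Un_upper2] by (rule finsum_addf) auto
      finally show "H (u \<oplus>\<^bsub>?T\<^esub> v) x = (H u \<oplus>\<^bsub>?U\<^esub> H v) x"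
        by (simp add: permutation_module_simps(3) free_module_simps)
    qed (auto simp: H_def permutation_module_simps(3) free_module_simps)
    show "H (monomial F G c g \<odot>\<^bsub>?T\<^esub> v) = monomial F G c g \<odot>\<^bsub>?U\<^esub> H v"
      if c: "c \<in> carrier F" and g: "g \<in> carrier G" and v: "v \<in> carrier ?T" for c g v
    proof (rule extensionalityI[of _ X])
      fix x assume x: "x \<in> X"
      let ?B = "{s \<in> S. v s \<noteq> \<zero>}"
      let ?A = "act g ` ?B"
      have v': "v \<in> carrier (free_module F S)" using v by (simp add: permutation_module_simps)
      have Hv: "H v \<in> carrier (free_module F X)" using Hcl[OF v] by (simp add: permutation_module_simps)
      note [simp] = vcl[OF v] x c g
      have A: "finite ?A" "?A \<subseteq> S" using fin v by auto
      have gv: "monomial F G c g \<odot>\<^bsub>?T\<^esub> v = (\<lambda>s\<in>S. c \<otimes> v (act (inv\<^bsub>G\<^esub> g) s))"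
        using monomial_smult[OF act c g v'] .
      have "{s \<in> S. (monomial F G c g \<odot>\<^bsub>?T\<^esub> v) s \<noteq> \<zero>} \<subseteq> ?A"
      proof
        fix s assume "s \<in> {s \<in> S. (monomial F G c g \<odot>\<^bsub>?T\<^esub> v) s \<noteq> \<zero>}"
        then have "s \<in> S" "act (inv\<^bsub>G\<^esub> g) s \<in> ?B" by (auto simp: gv)
        then show "s \<in> ?A"
          using G.left_action_inv(2)[OF act g, of s] by (metis (no_types, lifting) image_eqI)
      qed
      then have "H (monomial F G c g \<odot>\<^bsub>?T\<^esub> v) x =
          (\<Oplus>s\<in>?A. (monomial F G c g \<odot>\<^bsub>?T\<^esub> v) s \<otimes> f s x)"
        using v by (intro H x A T.smult_closed monomial_closed c)
      also have "\<dots> = (\<Oplus>s\<in>?B. (monomial F G c g \<odot>\<^bsub>?T\<^esub> v) (act g s) \<otimes> f (act g s) x)"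
      proof (rule finsum_bij[symmetric])
        show "bij_betw (act g) ?B ?A"
          by (intro inj_on_imp_bij_betw inj_on_inverseI[of _ "act (inv\<^bsub>G\<^esub> g)"])
            (simp add: G.left_action_inv[OF act])
      qed (auto simp: gv)
      also have "\<dots> = (\<Oplus>s\<in>?B. c \<otimes> (v s \<otimes> f s (act' (inv\<^bsub>G\<^esub> g) x)))"
        by (intro finsum_cong') (auto simp: gv G.left_action_inv[OF act] equi m_assoc)
      also have "\<dots> = c \<otimes> (\<Oplus>s\<in>?B. v s \<otimes> f s (act' (inv\<^bsub>G\<^esub> g) x))"
        using fin[OF v] by (intro finsum_rdistr[symmetric]) auto
      also have "\<dots> = (monomial F G c g \<odot>\<^bsub>?U\<^esub> H v) x"
        unfolding monomial_smult[OF act' c g Hv] by (simp add: H_def)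
      finally show "H (monomial F G c g \<odot>\<^bsub>?T\<^esub> v) x = (monomial F G c g \<odot>\<^bsub>?U\<^esub> H v) x" .
    qed (auto simp: H_def permutation_module_simps(4))
  qed
  fix s assume s: "s \<in> S"
  show "H (basis_vector F S s) = f s"
  proof (rule extensionalityI[of _ X])
    fix x assume x: "x \<in> X"
    have "H (basis_vector F S s) x = (\<Oplus>s'\<in>{s}. basis_vector F S s s' \<otimes> f s' x)"
      using s x by (intro H)
        (auto simp: permutation_module_simps basis_vector_closed, auto simp: basis_vector_def split: if_splits)
    then show "H (basis_vector F S s) x = f s x"
      using s x by (simp add: basis_vector_def)
  qed (use f[OF s] in \<open>auto simp: H_def mem_free_module\<close>)
qed

lemma left_action_permutation_module:
  assumes act: "left_action G \<Omega> act"
  shows "left_action G (carrier (permutation_module F G \<Omega> act))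
    (\<lambda>g m. monomial F G \<one> g \<odot>\<^bsub>permutation_module F G \<Omega> act\<^esub> m)"
proof -
  let ?M = "permutation_module F G \<Omega> act"
  interpret M: left_module FG ?M by (rule left_module_permutation_module[OF act])
  have mult: "monomial F G \<one> (g \<otimes>\<^bsub>G\<^esub> h) = monomial F G \<one> g \<otimes>\<^bsub>FG\<^esub> monomial F G \<one> h"
    if g: "g \<in> carrier G" and h: "h \<in> carrier G" for g h
  proof -
    have "inv\<^bsub>G\<^esub> g \<otimes>\<^bsub>G\<^esub> k = h \<longleftrightarrow> k = g \<otimes>\<^bsub>G\<^esub> h" if "k \<in> carrier G" for k
      using G.left_action_eq_iff[OF left_action_mult g that h] .
    then show ?thesis
      using g h monomial_mult[OF one_closed g monomial_closed[OF one_closed]]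
      by (auto simp: monomial_def intro!: restrict_ext)
  qed
  show ?thesis
    unfolding left_action_def
    by (auto simp: mult M.smult_assoc monomial_closed FG_one[symmetric] M.smult_one
        intro!: M.smult_closed)
qed

lemma product_coeff_equivariant:
  assumes act: "left_action G \<Omega> act" and fin: "finite \<Omega>" and g: "g \<in> carrier G"
    and "set ms \<subseteq> carrier (free_module F \<Omega>)" "set_mset x \<subseteq> \<Omega>"
  shows "product_coeff \<Omega> (map (\<lambda>m. monomial F G \<one> g \<odot>\<^bsub>permutation_module F G \<Omega> act\<^esub> m) ms) x =
    product_coeff \<Omega> ms (image_mset (act (inv\<^bsub>G\<^esub> g)) x)"
  using assms(4,5)
proof (induction ms arbitrary: x)
  case (Cons m ms)
  let ?g = "\<lambda>m. monomial F G \<one> g \<odot>\<^bsub>permutation_module F G \<Omega> act\<^esub> m" and ?h = "act (inv\<^bsub>G\<^esub> g)"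
  let ?y = "image_mset ?h x"
  have m: "m \<in> carrier (free_module F \<Omega>)" using Cons by simp
  note [simp] = left_actionD(1)[OF act] g free_moduleD[OF m]
  have [simp]: "product_coeff \<Omega> ms x \<in> carrier F" for x
    using Cons by (intro product_coeff_closed) simp
  have bij: "bij_betw ?h \<Omega> \<Omega>"
    by (rule bij_betw_byWitness[where f' = "act g"]) (auto simp: G.left_action_inv[OF act])
  have mem: "?h t \<in># ?y \<longleftrightarrow> t \<in># x" if "t \<in> \<Omega>" for t
    using Cons.prems(2) that bij by (auto simp: bij_betw_def dest: inj_onD)
  have "product_coeff \<Omega> (map ?g (m # ms)) x =
      (\<Oplus>t\<in>\<Omega>. if ?h t \<in># ?y then m (?h t) \<otimes> product_coeff \<Omega> ms (?y - {#?h t#}) else \<zero>)"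
    unfolding list.map product_coeff.simps
  proof (intro finsum_cong' refl)
    fix t assume t: "t \<in> \<Omega>"
    show "(if t \<in># x then ?g m t \<otimes> product_coeff \<Omega> (map ?g ms) (x - {#t#}) else \<zero>) =
        (if ?h t \<in># ?y then m (?h t) \<otimes> product_coeff \<Omega> ms (?y - {#?h t#}) else \<zero>)"
    proof (cases "t \<in># x")
      case True
      then have "image_mset ?h (x - {#t#}) = ?y - {#?h t#}"
        by (simp add: image_mset_Diff)
      moreover have "set_mset (x - {#t#}) \<subseteq> \<Omega>"
        using Cons.prems(2) by (meson in_diffD subset_iff)
      moreover have "?g m t = m (?h t)"
        using monomial_smult[OF act one_closed g m] t by simp
      ultimately show ?thesis
        using Cons True by simp
    qed (unfold mem[OF t], simp)
  qed auto
  also have "\<dots> = (\<Oplus>t\<in>\<Omega>. if t \<in># ?y then m t \<otimes> product_coeff \<Omega> ms (?y - {#t#}) else \<zero>)"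
    by (rule finsum_bij[OF bij]) simp
  finally show ?case by simp
qed simp

end

lemma generated_submodule:
  assumes M: "left_module R M" and A: "A \<subseteq> carrier M"
  shows "submodule (generated_submodule R M A) R M" "A \<subseteq> generated_submodule R M A"
    "\<And>N. submodule N R M \<Longrightarrow> A \<subseteq> N \<Longrightarrow> generated_submodule R M A \<subseteq> N"
proof -
  interpret left_module R M by fact
  have car: "submodule (carrier M) R M"
    by (rule submodule_criterion) (auto intro: smult_closed)
  have "generated_submodule R M A \<subseteq> carrier M"
    unfolding generated_submodule_def by (rule Inter_lower) (use car A in simp)
  then show "submodule (generated_submodule R M A) R M"
  proof (rule submodule_criterion)
    show "\<zero>\<^bsub>M\<^esub> \<in> generated_submodule R M A"
      unfolding generated_submodule_def using submoduleD(2) by blast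
  next
    fix x y assume "x \<in> generated_submodule R M A" "y \<in> generated_submodule R M A"
    then show "x \<oplus>\<^bsub>M\<^esub> y \<in> generated_submodule R M A"
      unfolding generated_submodule_def using submoduleD(3)[of _ R M x y] by blast
  next
    fix r x assume "r \<in> carrier R" "x \<in> generated_submodule R M A"
    then show "r \<odot>\<^bsub>M\<^esub> x \<in> generated_submodule R M A"
      unfolding generated_submodule_def using submoduleD(4)[of _ R M r x] by blast
  qed
qed (auto simp: generated_submodule_def)

context finite_group_algebra
begin

text \<open>
  The coefficients of products give an epimorphism from the tuples onto \<open>F[X]\<close>, where \<open>X\<close> is the
  set of multisets. Its kernel is spanned by the relations: modulo them, every vector is congruent
  to one supported on the tuples of basis vectors chosen to represent the multisets, and on such
  vectors the epimorphism is injective.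
\<close>

lemma symmetric_power_permutation_module:
  fixes a :: nat
  assumes act: "left_action G \<Omega> act" and \<Omega>: "finite \<Omega>"
  defines "M \<equiv> permutation_module F G \<Omega> act"
    and "U \<equiv> permutation_module F G (multisets_of_size \<Omega> a) (\<lambda>g. image_mset (act g))"
  shows "left_module FG (symmetric_power F G a M)"
    and "\<exists>h\<in>left_module_hom FG (symmetric_power F G a M) U.
      bij_betw h (carrier (symmetric_power F G a M)) (carrier U)"
proof -
  let ?X = "multisets_of_size \<Omega> a" and ?L = "free_module F \<Omega>"
  define S where "S = tuples M a"
  define T where "T = tuple_module F G a M"
  define actT where "actT = (\<lambda>g. map (\<lambda>m. monomial F G \<one> g \<odot>\<^bsub>M\<^esub> m))"
  define Rel where "Rel = symmetric_power_relations F G a M"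
  define N where "N = generated_submodule FG T Rel"
  define e where "e = basis_vector F S"
  define b where "b = basis_vector F \<Omega>"
  define sc where "sc = (\<lambda>c. monomial F G c \<one>\<^bsub>G\<^esub>)"
  have T: "T = permutation_module F G S actT"
    by (simp add: T_def tuple_module_def S_def actT_def)
  have S: "S = {ms. length ms = a \<and> set ms \<subseteq> carrier ?L}"
    by (simp add: S_def tuples_def M_def permutation_module_simps)
  have X: "finite ?X" using finite_multisets_of_size[OF \<Omega>] .
  have actX: "left_action G ?X (\<lambda>g. image_mset (act g))"
    using left_action_multisets[OF act] .
  have actS: "left_action G S actT"
    using left_action_lists[OF left_action_permutation_module[OF act], of a]
    by (simp add: S actT_def M_def permutation_module_simps(1))
  have bcl: "b t \<in> carrier ?L" for t
    using basis_vector_closed by (simp add: b_def)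
  interpret T: left_module FG T
    unfolding T by (rule left_module_permutation_module[OF actS])
  interpret U: left_module FG U
    unfolding U_def by (rule left_module_permutation_module[OF actX])
  have carT: "carrier T = carrier (free_module F S)"
    by (simp add: T permutation_module_simps)
  have ecl [simp]: "e ms \<in> carrier T" for ms
    using basis_vector_closed by (simp add: carT e_def)
  have sccl [simp]: "sc c \<in> carrier FG" if "c \<in> carrier F" for c
    using that by (simp add: sc_def monomial_closed)
  have scT: "sc c \<odot>\<^bsub>T\<^esub> v = c \<odot>\<^bsub>free_module F S\<^esub> v" if "c \<in> carrier F" "v \<in> carrier T" for c v
    using scalar_smult[OF actS that(1)] that(2) by (simp add: T sc_def permutation_module_simps)
  have scM: "sc c \<odot>\<^bsub>M\<^esub> m = c \<odot>\<^bsub>?L\<^esub> m" if "c \<in> carrier F" "m \<in> carrier ?L" for c m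
    using scalar_smult[OF act that] by (simp add: M_def sc_def)
  have addM: "m \<oplus>\<^bsub>M\<^esub> m' = m \<oplus>\<^bsub>?L\<^esub> m'" for m m'
    by (simp add: M_def permutation_module_simps)
  have carM: "carrier M = carrier ?L"
    by (simp add: M_def permutation_module_simps)
  interpret L: left_module F ?L by (rule left_module_free_module)

  define f where "f = (\<lambda>ms. \<lambda>x\<in>?X. product_coeff \<Omega> ms x)"
  define H where "H = (\<lambda>v. \<lambda>x\<in>?X. \<Oplus>ms\<in>{ms \<in> S. v ms \<noteq> \<zero>}. v ms \<otimes> f ms x)"
  have fcl: "f ms \<in> carrier (free_module F ?X)" if "ms \<in> S" for ms
    using that by (auto simp: f_def mem_free_module_finite[OF X] S intro: product_coeff_closed)
  have fequi: "f (actT g ms) x = f ms (image_mset (act (inv\<^bsub>G\<^esub> g)) x)"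
    if "g \<in> carrier G" "ms \<in> S" "x \<in> ?X" for g ms x
    using product_coeff_equivariant[OF act \<Omega> that(1), of ms x] that
      left_actionD(1)[OF actX, of "inv\<^bsub>G\<^esub> g" x]
    by (simp add: f_def actT_def M_def S multisets_of_size_def)
  have H: "H \<in> left_module_hom FG T U" and He: "\<And>ms. ms \<in> S \<Longrightarrow> H (e ms) = f ms"
    unfolding H_def T U_def e_def
    by (rule linear_extension_hom[where f = f, OF actS actX X fcl fequi], assumption+)+
  note HD = left_module_homD[OF H]

  have Rel: "Rel =
      {e (us @ (m \<oplus>\<^bsub>?L\<^esub> m') # vs) \<ominus>\<^bsub>T\<^esub> (e (us @ m # vs) \<oplus>\<^bsub>T\<^esub> e (us @ m' # vs)) | us m m' vs.
        us @ m # vs \<in> S \<and> m' \<in> carrier ?L}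
      \<union> {e (us @ (sc c \<odot>\<^bsub>M\<^esub> m) # vs) \<ominus>\<^bsub>T\<^esub> sc c \<odot>\<^bsub>T\<^esub> e (us @ m # vs) | us c m vs.
        us @ m # vs \<in> S \<and> c \<in> carrier F}
      \<union> {e us \<ominus>\<^bsub>T\<^esub> e vs | us vs. us \<in> S \<and> vs \<in> S \<and> mset us = mset vs}"
    unfolding Rel_def symmetric_power_relations_def Let_def T_def[symmetric] S_def[symmetric]
      e_def sc_def addM carM by (rule refl)
  have RelT: "Rel \<subseteq> carrier T"
    unfolding Rel by (auto intro!: T.smult_closed)
  note gen = generated_submodule[OF T.left_module_axioms RelT, folded N_def]
  note ND = submoduleD[OF gen(1)]
  let ?K = "{v \<in> carrier T. H v = \<zero>\<^bsub>U\<^esub>}"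
  have K: "submodule ?K FG T"
    using left_module_hom_kernel[OF T.left_module_axioms U.left_module_axioms H] .
  have Hminus: "H (v \<ominus>\<^bsub>T\<^esub> w) = \<zero>\<^bsub>U\<^esub>" if "v \<in> carrier T" "w \<in> carrier T" "H v = H w" for v w
    using left_module_hom_minus[OF T.left_module_axioms U.left_module_axioms H that(1,2)] that HD(1)
    by (simp add: a_minus_def U.M.r_neg)
  have "Rel \<subseteq> ?K"
  proof
    fix r assume "r \<in> Rel"
    then consider
        (add) us m m' vs where "us @ m # vs \<in> S" "m' \<in> carrier ?L"
          "r = e (us @ (m \<oplus>\<^bsub>?L\<^esub> m') # vs) \<ominus>\<^bsub>T\<^esub> (e (us @ m # vs) \<oplus>\<^bsub>T\<^esub> e (us @ m' # vs))"
      | (smult) us c m vs where "us @ m # vs \<in> S" "c \<in> carrier F"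
          "r = e (us @ (sc c \<odot>\<^bsub>M\<^esub> m) # vs) \<ominus>\<^bsub>T\<^esub> sc c \<odot>\<^bsub>T\<^esub> e (us @ m # vs)"
      | (perm) us vs where "us \<in> S" "vs \<in> S" "mset us = mset vs" "r = e us \<ominus>\<^bsub>T\<^esub> e vs"
      unfolding Rel by blast
    then show "r \<in> ?K"
    proof cases
      case add
      have "us @ (m \<oplus>\<^bsub>?L\<^esub> m') # vs \<in> S" "us @ m' # vs \<in> S"
        using add by (auto simp: S)
      moreover have "f (us @ (m \<oplus>\<^bsub>?L\<^esub> m') # vs) = f (us @ m # vs) \<oplus>\<^bsub>U\<^esub> f (us @ m' # vs)"
        using add by (auto simp: f_def U_def permutation_module_simps free_module_simps(2)[of F ?X] S
            product_coeff_add intro!: restrict_ext)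
      ultimately show ?thesis
        using add by (auto simp: HD He intro!: Hminus)
    next
      case smult
      have m: "m \<in> carrier ?L" using smult by (simp add: S)
      then have "us @ (c \<odot>\<^bsub>?L\<^esub> m) # vs \<in> S"
        using smult L.smult_closed by (auto simp: S)
      moreover have "f (us @ (c \<odot>\<^bsub>?L\<^esub> m) # vs) = sc c \<odot>\<^bsub>U\<^esub> f (us @ m # vs)"
        using smult product_coeff_smult[OF _ _ m smult(2) \<Omega>] scalar_smult[OF actX smult(2) fcl[OF smult(1)]]
        by (auto simp: f_def U_def sc_def free_module_simps(3)[of F ?X] S intro!: restrict_ext)
      ultimately show ?thesis
        using smult m by (auto simp: HD He scM intro!: Hminus T.smult_closed)
    next
      case perm
      then have "f us = f vs"
        using product_coeff_perm[OF perm(3) _ \<Omega>] by (auto simp: f_def S intro!: restrict_ext)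
      then show ?thesis
        using perm by (auto simp: He intro!: Hminus)
    qed
  qed
  then have NK: "N \<subseteq> ?K" using gen(3)[OF K] by blast

  define rep where "rep x = map b (SOME ts. mset ts = x)" for x
  have rep: "\<exists>ts. rep x = map b ts \<and> mset ts = x \<and> set ts \<subseteq> \<Omega> \<and> length ts = a" if "x \<in> ?X" for x
  proof -
    have "mset (SOME ts. mset ts = x) = x" using ex_mset by (metis (mono_tags) someI_ex)
    then show ?thesis
      using that unfolding rep_def multisets_of_size_def by (metis (mono_tags, lifting) mem_Collect_eq set_mset_mset size_mset)
  qed
  have repS: "rep x \<in> S" if "x \<in> ?X" for x
    using rep[OF that] bcl by (auto simp: S)
  have frep: "f (rep x) y = (if y = x then \<one> else \<zero>)" if "x \<in> ?X" "y \<in> ?X" for x y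
    using rep[OF that(1)] product_coeff_basis[OF _ \<Omega>] that by (auto simp: f_def b_def)

  define E where "E = {u \<in> carrier T. \<forall>ms\<in>S. ms \<notin> rep ` ?X \<longrightarrow> u ms = \<zero>}"
  define W where "W = {v. \<exists>u\<in>E. \<exists>n\<in>N. v = u \<oplus>\<^bsub>T\<^esub> n}"
  have ET: "E \<subseteq> carrier T" by (auto simp: E_def)
  have Ezero: "\<zero>\<^bsub>T\<^esub> \<in> E"
    using T.M.zero_closed by (auto simp: E_def T permutation_module_simps free_module_simps)
  have Eadd: "u \<oplus>\<^bsub>T\<^esub> v \<in> E" if "u \<in> E" "v \<in> E" for u v
    using that T.M.add.m_closed[of u v] by (auto simp: E_def T permutation_module_simps(3) free_module_simps)
  have Esmult: "sc c \<odot>\<^bsub>T\<^esub> u \<in> E" if c: "c \<in> carrier F" and u: "u \<in> E" for c u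
  proof -
    have "u \<in> carrier T" using u by (simp add: E_def)
    then show ?thesis
      using u c T.smult_closed[OF sccl[OF c], of u] scT[OF c, of u]
      by (auto simp: E_def free_module_simps)
  qed
  have WI: "u \<oplus>\<^bsub>T\<^esub> n \<in> W" if "u \<in> E" "n \<in> N" for u n
    using that by (auto simp: W_def)
  have NW: "n \<in> W" if "n \<in> N" for n
    using WI[OF Ezero that] ND(1) that by auto
  have Wadd: "v \<oplus>\<^bsub>T\<^esub> w \<in> W" if "v \<in> W" "w \<in> W" for v w
  proof -
    obtain u n u' n' where *: "u \<in> E" "n \<in> N" "v = u \<oplus>\<^bsub>T\<^esub> n" "u' \<in> E" "n' \<in> N" "w = u' \<oplus>\<^bsub>T\<^esub> n'"
      using \<open>v \<in> W\<close> \<open>w \<in> W\<close> by (auto simp: W_def)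
    then have "u \<in> carrier T" "u' \<in> carrier T" "n \<in> carrier T" "n' \<in> carrier T"
      using ET ND(1) by auto
    then have "v \<oplus>\<^bsub>T\<^esub> w = (u \<oplus>\<^bsub>T\<^esub> u') \<oplus>\<^bsub>T\<^esub> (n \<oplus>\<^bsub>T\<^esub> n')"
      using * by (simp add: T.M.a_ac)
    then show ?thesis
      unfolding W_def using Eadd[OF *(1,4)] ND(3)[OF *(2,5)] by blast
  qed
  have Wsmult: "sc c \<odot>\<^bsub>T\<^esub> v \<in> W" if c: "c \<in> carrier F" and v: "v \<in> W" for c v
  proof -
    obtain u n where *: "u \<in> E" "n \<in> N" "v = u \<oplus>\<^bsub>T\<^esub> n"
      using v by (auto simp: W_def)
    then have "sc c \<odot>\<^bsub>T\<^esub> v = sc c \<odot>\<^bsub>T\<^esub> u \<oplus>\<^bsub>T\<^esub> sc c \<odot>\<^bsub>T\<^esub> n"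
      using ET ND(1) T.smult_r_distr[OF sccl[OF c], of u n] by auto
    then show ?thesis
      unfolding W_def using Esmult[OF c *(1)] ND(4)[OF sccl[OF c] *(2)] by blast
  qed
  have Wcong: "v \<in> W" if "v \<ominus>\<^bsub>T\<^esub> w \<in> Rel" "w \<in> W" "v \<in> carrier T" "w \<in> carrier T" for v w
    using Wadd[OF that(2) NW[of "v \<ominus>\<^bsub>T\<^esub> w"]] gen(2) that T.M.add_minus_cancel[of w v] by auto

  have We_basis: "e (map b ts) \<in> W" if ts: "set ts \<subseteq> \<Omega>" "length ts = a" for ts
  proof -
    have x: "mset ts \<in> ?X" using ts by (auto simp: multisets_of_size_def)
    have S1: "map b ts \<in> S" using ts bcl by (auto simp: S)
    obtain ts' where ts': "rep (mset ts) = map b ts'" "mset ts' = mset ts" using rep[OF x] by blast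
    have "mset (map b ts) = mset (rep (mset ts))" using ts' by simp
    then have "e (map b ts) \<ominus>\<^bsub>T\<^esub> e (rep (mset ts)) \<in> Rel"
      unfolding Rel using S1 repS[OF x] by blast
    moreover have "e (rep (mset ts)) \<in> E"
      using x ecl[of "rep (mset ts)"] by (auto simp: E_def e_def basis_vector_def)
    then have "e (rep (mset ts)) \<in> W"
      using WI[OF _ ND(2)] ecl[of "rep (mset ts)"] by fastforce
    ultimately show ?thesis by (rule Wcong) simp_all
  qed
  have We: "e (map b ts @ ms) \<in> W" if "set ts \<subseteq> \<Omega>" "map b ts @ ms \<in> S" for ts ms
    using that
  proof (induction ms arbitrary: ts)
    case Nil
    then show ?case using We_basis by (simp add: S)
  next
    case (Cons m ms)
    have inS: "map b ts @ m' # ms \<in> S" if "m' \<in> carrier ?L" for m'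
      using Cons.prems that by (auto simp: S)
    have sm: "e (map b ts @ (c \<odot>\<^bsub>?L\<^esub> m') # ms) \<in> W"
      if c: "c \<in> carrier F" and m': "m' \<in> carrier ?L" and w: "sc c \<odot>\<^bsub>T\<^esub> e (map b ts @ m' # ms) \<in> W" for c m'
    proof (rule Wcong[OF _ w])
      show "e (map b ts @ (c \<odot>\<^bsub>?L\<^esub> m') # ms) \<ominus>\<^bsub>T\<^esub> sc c \<odot>\<^bsub>T\<^esub> e (map b ts @ m' # ms) \<in> Rel"
        unfolding scM[OF c m', symmetric] Rel using c inS[OF m'] by blast
    qed (simp_all add: T.smult_closed c)
    have "m \<in> carrier ?L" using Cons.prems by (simp add: S)
    then show ?case
    proof (induction m rule: free_module_induct)
      case zero
      have "(\<lambda>x\<in>\<Omega>. \<zero>) = \<zero> \<odot>\<^bsub>?L\<^esub> \<zero>\<^bsub>?L\<^esub>" by (auto simp: free_module_simps)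
      moreover have "sc \<zero> \<odot>\<^bsub>T\<^esub> e (map b ts @ \<zero>\<^bsub>?L\<^esub> # ms) = \<zero>\<^bsub>T\<^esub>"
        using scT[OF zero_closed ecl[of "map b ts @ \<zero>\<^bsub>?L\<^esub> # ms"]] ecl[of "map b ts @ \<zero>\<^bsub>?L\<^esub> # ms"]
        by (auto simp: T permutation_module_simps free_module_simps free_moduleD)
      ultimately show ?case
        using sm[OF zero_closed L.M.zero_closed] NW[OF ND(2)] by simp
    next
      case (basis t)
      have "e (map b (ts @ [t]) @ ms) \<in> W"
        using basis Cons.prems inS[OF bcl[of t]] by (intro Cons.IH) auto
      then show ?case by (simp add: b_def)
    next
      case (add m m')
      have "e (map b ts @ (m \<oplus>\<^bsub>?L\<^esub> m') # ms) \<ominus>\<^bsub>T\<^esub>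
          (e (map b ts @ m # ms) \<oplus>\<^bsub>T\<^esub> e (map b ts @ m' # ms)) \<in> Rel"
        unfolding Rel using inS[OF add(1)] add(2) by blast
      then show ?case
        using Wadd[OF add(3,4)] by (rule Wcong) simp_all
    next
      case (smult c m)
      then show ?case by (intro sm Wsmult)
    qed
  qed
  have TW: "v \<in> W" if "v \<in> carrier T" for v
  proof -
    have "v \<in> carrier (free_module F S)" using that by (simp add: carT)
    then show ?thesis
    proof (induction v rule: free_module_induct)
      case zero
      then show ?case
        using NW[OF ND(2)] unfolding T permutation_module_simps free_module_simps .
    next
      case (basis ms)
      then show ?case using We[of "[]" ms] by (simp add: e_def)
    next
      case (add u v)
      then show ?case using Wadd by (simp add: T permutation_module_simps)
    next
      case (smult c v)
      then show ?case using Wsmult[of c v] scT[of c v] by (simp add: carT)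
    qed
  qed
  have "v \<in> N" if v: "v \<in> carrier T" and Hv: "H v = \<zero>\<^bsub>U\<^esub>" for v
  proof -
    obtain u n where u: "u \<in> E" and n: "n \<in> N" and vun: "v = u \<oplus>\<^bsub>T\<^esub> n"
      using TW[OF v] by (auto simp: W_def)
    have uT: "u \<in> carrier T" and nT: "n \<in> carrier T" "H n = \<zero>\<^bsub>U\<^esub>" using u n ET NK by auto
    have Hu: "H u = \<zero>\<^bsub>U\<^esub>"
      using HD(2)[OF uT nT(1)] HD(1)[OF uT] Hv nT vun by simp
    have ucl: "u ms \<in> carrier F" if "ms \<in> S" for ms
      using uT that by (simp add: carT free_moduleD)
    have "u (rep x) = \<zero>" if x: "x \<in> ?X" for x
    proof (rule ccontr)
      assume nz: "u (rep x) \<noteq> \<zero>"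
      have "H u x = (\<Oplus>ms\<in>{ms \<in> S. u ms \<noteq> \<zero>}. if ms = rep x then u (rep x) else \<zero>)"
        unfolding H_def restrict_apply'[OF x]
      proof (intro finsum_cong' refl)
        fix ms assume ms: "ms \<in> {ms \<in> S. u ms \<noteq> \<zero>}"
        then obtain y where y: "y \<in> ?X" "ms = rep y" using u by (auto simp: E_def)
        have "rep y = rep x \<longleftrightarrow> y = x"
        proof (intro iffI; rule ccontr)
          assume "rep y = rep x" "y \<noteq> x"
          then have "\<one> = \<zero>" using frep[OF y(1) x] frep[OF x x] by simp
          then show False
            using nz r_one[OF ucl[OF repS[OF x]]] r_null[OF ucl[OF repS[OF x]]] by simp
        qed simp
        then show "u ms \<otimes> f ms x = (if ms = rep x then u (rep x) else \<zero>)"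
          using y ms x ucl[of ms] by (auto simp: frep)
      qed (use ucl repS[OF x] in auto)
      also have "\<dots> = u (rep x)"
        using uT x nz repS[OF x] ucl
        by (intro finsum_delta) (auto simp: carT mem_free_module)
      finally show False
        using nz Hu x by (simp add: U_def permutation_module_simps free_module_simps)
    qed
    then have "u ms = \<zero>" if "ms \<in> S" for ms
      using u that by (auto simp: E_def)
    then have "u = \<zero>\<^bsub>T\<^esub>"
      using uT by (intro extensionalityI[of _ S])
        (auto simp: carT T permutation_module_simps free_module_simps mem_free_module)
    then show "v \<in> N" using vun nT n by simp
  qed
  then have ker: "N = ?K" using NK by blast

  have "w \<in> H ` carrier T" if "w \<in> carrier U" for w
  proof -
    note I = submoduleD[OF left_module_hom_image[OF T.left_module_axioms U.left_module_axioms H]]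
    have "w \<in> carrier (free_module F ?X)" using that by (simp add: U_def permutation_module_simps)
    then show ?thesis
    proof (induction w rule: free_module_induct)
      case zero
      then show ?case
        using I(2) unfolding U_def permutation_module_simps free_module_simps .
    next
      case (basis x)
      have "f (rep x) = basis_vector F ?X x"
        using frep[OF basis] by (intro extensionalityI[of _ ?X]) (auto simp: f_def basis_vector_def)
      then show ?case using He[OF repS[OF basis]] by (metis ecl image_eqI)
    next
      case (add u v)
      then show ?case using I(3) by (simp add: U_def permutation_module_simps)
    next
      case (smult c v)
      then show ?case
        using I(4)[OF sccl[OF smult(1)] smult(3)] scalar_smult[OF actX smult(1,2)]
        by (simp add: U_def sc_def)
    qed
  qed
  then have surj: "H ` carrier T = carrier U" using HD(1) by blast

  have P: "symmetric_power F G a M = quotient_module T N"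
    by (simp add: symmetric_power_def T_def N_def Rel_def)
  note iso = left_module_first_iso[OF T.left_module_axioms U.left_module_axioms H surj ker, folded P]
  show "left_module FG (symmetric_power F G a M)" by (rule iso(3))
  show "\<exists>h\<in>left_module_hom FG (symmetric_power F G a M) U.
      bij_betw h (carrier (symmetric_power F G a M)) (carrier U)"
    using left_module_hom_inv_into[OF U.left_module_axioms iso(1,2)] bij_betw_inv_into[OF iso(1)]
    by blast
qed

end

section \<open>Natural multiples in positive characteristic\<close>

context domain
begin

lemma add_pow_mult_one: "[j] \<cdot> \<one> \<otimes> [k] \<cdot> \<one> = [(j * k :: nat)] \<cdot> \<one>"
  by (simp add: add_pow_ldistr add.nat_pow_pow mult.commute)

lemma add_pow_eq_zero_iff:
  assumes "has_positive_char R p"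
  shows "[(k::nat)] \<cdot> \<one> = \<zero> \<longleftrightarrow> p dvd k"
proof -
  have p: "p > 0" "[p] \<cdot> \<one> = \<zero>" "\<And>q. 0 < q \<Longrightarrow> q < p \<Longrightarrow> [q] \<cdot> \<one> \<noteq> \<zero>"
    using assms by (auto simp: has_positive_char_def)
  have mult: "[(p * j :: nat)] \<cdot> \<one> = \<zero>" for j
    using add_pow_mult_one[of p j] p(2) by simp
  have "[k] \<cdot> \<one> = [(p * (k div p))] \<cdot> \<one> \<oplus> [(k mod p)] \<cdot> \<one>"
    using add.nat_pow_mult[of \<one> "p * (k div p)" "k mod p"] by simp
  then have eq: "[k] \<cdot> \<one> = [(k mod p)] \<cdot> \<one>" by (simp add: mult)
  show ?thesis
    unfolding eq dvd_eq_mod_eq_0 using p(1) p(3)[of "k mod p"] by (cases "k mod p = 0") auto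
qed

lemma add_pow_fact_nonzero:
  assumes "has_positive_char R p" "k < p"
  shows "[(fact k :: nat)] \<cdot> \<one> \<noteq> \<zero>"
  using assms(2)
proof (induction k)
  case (Suc k)
  have "[(Suc k)] \<cdot> \<one> \<noteq> \<zero>"
    using Suc.prems add_pow_eq_zero_iff[OF assms(1), of "Suc k"] by (auto dest: dvd_imp_le simp del: add.nat_pow_Suc)
  then have "[(Suc k)] \<cdot> \<one> \<otimes> [(fact k :: nat)] \<cdot> \<one> \<noteq> \<zero>"
    using Suc by (simp add: integral_iff del: add.nat_pow_Suc)
  then show ?case unfolding add_pow_mult_one fact_Suc of_nat_id .
qed simp

lemma add_pow_prod_fact_nonzero:
  assumes "has_positive_char R p" "\<forall>k\<in>set ks. k < p"
  shows "[prod_list (map fact ks :: nat list)] \<cdot> \<one> \<noteq> \<zero>"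
  using assms(2)
proof (induction ks)
  case (Cons k ks)
  then have "[(fact k :: nat)] \<cdot> \<one> \<otimes> [prod_list (map fact ks :: nat list)] \<cdot> \<one> \<noteq> \<zero>"
    using add_pow_fact_nonzero[OF assms(1), of k] by (simp add: integral_iff)
  then show ?case unfolding add_pow_mult_one list.map prod_list.Cons .
qed simp

end

lemma (in abelian_monoid) finsum_add_pow:
  assumes "finite A" "u \<in> carrier G"
  shows "(\<Oplus>x\<in>A. [(m x :: nat)] \<cdot> u) = [(\<Sum>x\<in>A. m x)] \<cdot> u"
  using assms(1)
  by (induction A rule: finite_induct) (simp_all add: assms(2) add.nat_pow_mult)

lemma projective_of_weights:
  fixes P :: "('g \<Rightarrow> 'a, 'm, 'e) module_scheme" and m :: "'x \<Rightarrow> nat"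
  assumes F: "field F" and G: "group G" "finite (carrier G)"
    and act: "left_action G X act" and X: "finite X" and P: "left_module (group_algebra F G) P"
    and h: "h \<in> left_module_hom (group_algebra F G) P (permutation_module F G X act)"
      "bij_betw h (carrier P) (carrier (permutation_module F G X act))"
    and m: "\<And>x. x \<in> X \<Longrightarrow> (\<Sum>g\<in>carrier G. m (act (inv\<^bsub>G\<^esub> g) x)) = K"
    and K: "[K] \<cdot>\<^bsub>F\<^esub> \<one>\<^bsub>F\<^esub> \<noteq> \<zero>\<^bsub>F\<^esub>"
  shows "projective_module (group_algebra F G) P"
proof -
  interpret F: field F by fact
  interpret finite_group_algebra F G
    by (intro finite_group_algebra.intro finite_group_algebra_axioms.intro G F.is_cring)
  let ?U = "permutation_module F G X act"
  define u where "u = inv\<^bsub>F\<^esub> ([K] \<cdot>\<^bsub>F\<^esub> \<one>\<^bsub>F\<^esub>)"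
  have "[K] \<cdot>\<^bsub>F\<^esub> \<one>\<^bsub>F\<^esub> \<in> Units F" using K by (simp add: F.field_Units)
  then have u: "u \<in> carrier F" "[K] \<cdot>\<^bsub>F\<^esub> \<one>\<^bsub>F\<^esub> \<otimes>\<^bsub>F\<^esub> u = \<one>\<^bsub>F\<^esub>"
    by (simp_all add: u_def)
  define b where "b = inv_into (carrier P) h \<circ> basis_vector F X"
  have bU: "basis_vector F X x \<in> carrier ?U" for x
    using F.basis_vector_closed by (simp add: permutation_module_simps)
  have "inj_on (basis_vector F X) X"
  proof (rule inj_onI)
    fix x y assume "x \<in> X" "y \<in> X" "basis_vector F X x = basis_vector F X y"
    then have "basis_vector F X x x = basis_vector F X y x" by simp
    then show "x = y" using \<open>x \<in> X\<close> by (simp add: basis_vector_def split: if_splits)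
  qed
  moreover have "inj_on (inv_into (carrier P) h) (basis_vector F X ` X)"
    using bU bij_betw_imp_inj_on[OF bij_betw_inv_into[OF h(2)]] by (rule_tac inj_on_subset) auto
  ultimately have b: "inj_on b X" unfolding b_def by (rule comp_inj_on)
  show ?thesis
  proof (rule projective_permutation_moduleI[OF act X P h b])
    fix x assume x: "x \<in> X"
    show "[m x] \<cdot>\<^bsub>F\<^esub> u \<in> carrier F" using u by simp
    have "(\<Oplus>\<^bsub>F\<^esub>g\<in>carrier G. [m (act (inv\<^bsub>G\<^esub> g) x)] \<cdot>\<^bsub>F\<^esub> u) = [K] \<cdot>\<^bsub>F\<^esub> u"
      using F.finsum_add_pow[OF G(2) u(1)] m[OF x] by simp
    also have "\<dots> = \<one>\<^bsub>F\<^esub>"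
      using F.add_pow_ldistr[of "\<one>\<^bsub>F\<^esub>" u K] u by simp
    finally show "(\<Oplus>\<^bsub>F\<^esub>g\<in>carrier G. [m (act (inv\<^bsub>G\<^esub> g) x)] \<cdot>\<^bsub>F\<^esub> u) = \<one>\<^bsub>F\<^esub>" .
  qed
qed

lemma (in group) sum_count_transitive:
  assumes fin: "finite (carrier G)" and \<Omega>: "finite \<Omega>" and act: "left_action G \<Omega> act"
    and t0: "t\<^sub>0 \<in> \<Omega>" and trans: "\<And>t. t \<in> \<Omega> \<Longrightarrow> \<exists>g\<in>carrier G. act g t\<^sub>0 = t"
    and x: "x \<in> multisets_of_size \<Omega> a"
  shows "(\<Sum>g\<in>carrier G. count (image_mset (act (inv g)) x) t\<^sub>0) =
    a * card {g \<in> carrier G. act g t\<^sub>0 = t\<^sub>0}"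
proof -
  let ?St = "{g \<in> carrier G. act g t\<^sub>0 = t\<^sub>0}"
  have x\<Omega>: "set_mset x \<subseteq> \<Omega>" "size x = a" using x by (auto simp: multisets_of_size_def)
  have count: "count (image_mset (act (inv g)) x) t\<^sub>0 = count x (act g t\<^sub>0)" if g: "g \<in> carrier G" for g
  proof -
    have "t\<^sub>0 = act (inv g) s \<longleftrightarrow> s = act g t\<^sub>0" if "s \<in># x" for s
      using left_action_eq_iff[OF act g _ t0, of s] x\<Omega> that by auto
    then have "{s. s \<in># x \<and> t\<^sub>0 = act (inv g) s} = {s. s \<in># x \<and> s = act g t\<^sub>0}"
      by (intro Collect_cong conj_cong refl)
    also have "\<dots> = (if act g t\<^sub>0 \<in># x then {act g t\<^sub>0} else {})"
      by auto
    finally have "{s. s \<in># x \<and> t\<^sub>0 = act (inv g) s} = (if act g t\<^sub>0 \<in># x then {act g t\<^sub>0} else {})" .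
    then show ?thesis by (simp add: count_image_mset' not_in_iff)
  qed
  have card: "card {g \<in> carrier G. act g t\<^sub>0 = t} = card ?St" if t: "t \<in> \<Omega>" for t
  proof -
    obtain h where h: "h \<in> carrier G" "act h t\<^sub>0 = t" using trans[OF t] by blast
    then have "act (inv h) t = t\<^sub>0" using left_action_inv(1)[OF act h(1) t0] by simp
    then have "bij_betw (\<lambda>g. h \<otimes> g) ?St {g \<in> carrier G. act g t\<^sub>0 = t}"
      using h t0
      by (intro bij_betw_byWitness[where f' = "\<lambda>g. inv h \<otimes> g"])
        (auto simp: m_assoc[symmetric] left_actionD(3)[OF act])
    then show ?thesis by (simp add: bij_betw_same_card)
  qed
  have "(\<Sum>g\<in>carrier G. count (image_mset (act (inv g)) x) t\<^sub>0) = (\<Sum>g\<in>carrier G. count x (act g t\<^sub>0))"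
    by (intro sum.cong refl count)
  also have "\<dots> = (\<Sum>t\<in>\<Omega>. \<Sum>g\<in>{g \<in> carrier G. act g t\<^sub>0 = t}. count x (act g t\<^sub>0))"
    using fin \<Omega> left_actionD(1)[OF act _ t0] by (intro sum.group[symmetric]) auto
  also have "\<dots> = (\<Sum>t\<in>\<Omega>. count x t * card ?St)"
    using card by (intro sum.cong refl) (simp add: mult.commute)
  also have "\<dots> = (\<Sum>t\<in>\<Omega>. count x t) * card ?St"
    by (simp add: sum_distrib_right)
  also have "(\<Sum>t\<in>\<Omega>. count x t) = size x"
    unfolding size_multiset_overloaded_eq using x\<Omega> \<Omega>
    by (intro sum.mono_neutral_right) (auto simp: not_in_iff)
  finally show ?thesis using x\<Omega> by simp
qed

section \<open>Tabloids\<close>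

definition set_tabloids :: "'a set \<Rightarrow> nat list \<Rightarrow> 'a set list set"
  where "set_tabloids A lam = {t. length t = length lam \<and>
    (\<forall>i<length lam. card (t ! i) = lam ! i) \<and>
    (\<forall>i<length lam. \<forall>j<length lam. i \<noteq> j \<longrightarrow> t ! i \<inter> t ! j = {}) \<and>
    \<Union> (set t) = A}"

lemma tabloids_eq: "tabloids n lam = set_tabloids {1..n} lam"
  by (simp add: tabloids_def set_tabloids_def)

lemma set_tabloids_Nil: "t \<in> set_tabloids A [] \<longleftrightarrow> t = [] \<and> A = {}"
  by (auto simp: set_tabloids_def)

lemma set_tabloids_Cons:
  "B # t \<in> set_tabloids A (m # lam) \<longleftrightarrow> B \<subseteq> A \<and> card B = m \<and> t \<in> set_tabloids (A - B) lam"
proof -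
  have disj: "(\<forall>i<Suc l. \<forall>j<Suc l. i \<noteq> j \<longrightarrow> (B # t) ! i \<inter> (B # t) ! j = {}) \<longleftrightarrow>
      (\<forall>j<l. B \<inter> t ! j = {}) \<and> (\<forall>i<l. \<forall>j<l. i \<noteq> j \<longrightarrow> t ! i \<inter> t ! j = {})" (is "?L \<longleftrightarrow> ?R") for l
  proof
    assume L: ?L
    have "B \<inter> t ! j = {}" if "j < l" for j
      using L[rule_format, of 0 "Suc j"] that by simp
    moreover have "t ! i \<inter> t ! j = {}" if "i < l" "j < l" "i \<noteq> j" for i j
      using L[rule_format, of "Suc i" "Suc j"] that by simp
    ultimately show ?R by simp
  next
    assume R: ?R
    show ?L
    proof (intro allI impI)
      fix i j assume "i < Suc l" "j < Suc l" "i \<noteq> j"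
      then show "(B # t) ! i \<inter> (B # t) ! j = {}"
        using R by (cases i; cases j) (simp_all add: Int_commute[of _ B])
    qed
  qed
  have "(\<forall>j<length t. B \<inter> t ! j = {}) \<longleftrightarrow> (\<forall>D\<in>set t. B \<inter> D = {})"
    by (simp add: all_set_conv_all_nth)
  also have "\<dots> \<longleftrightarrow> B \<inter> \<Union> (set t) = {}"
    by blast
  finally have un: "(\<forall>j<length t. B \<inter> t ! j = {}) \<longleftrightarrow> B \<inter> \<Union> (set t) = {}" .
  have diff: "B \<inter> U = {} \<and> B \<union> U = A \<longleftrightarrow> B \<subseteq> A \<and> U = A - B" for U
    by blast
  show ?thesis
  proof (cases "length t = length lam")
    case True
    then show ?thesis
      using un diff[of "\<Union> (set t)"]
      unfolding set_tabloids_def mem_Collect_eq length_Cons disj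
      unfolding All_less_Suc2 nth_Cons_0 nth_Cons_Suc list.set Union_insert Suc_inject True
      by argo
  qed (simp add: set_tabloids_def)
qed

lemma set_tabloids_ConsE:
  assumes "t \<in> set_tabloids A (m # lam)"
  obtains B s where "t = B # s" "B \<subseteq> A" "card B = m" "s \<in> set_tabloids (A - B) lam"
proof -
  obtain B s where "t = B # s"
    using assms by (cases t) (auto simp: set_tabloids_def)
  with assms that show thesis by (simp add: set_tabloids_Cons)
qed

lemma finite_set_tabloids:
  assumes "finite A"
  shows "finite (set_tabloids A lam)"
proof (rule finite_subset)
  show "set_tabloids A lam \<subseteq> {t. set t \<subseteq> Pow A \<and> length t = length lam}"
    by (auto simp: set_tabloids_def)
qed (use assms in \<open>intro finite_lists_length_eq, simp\<close>)

lemma set_tabloids_nonempty: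
  "finite A \<Longrightarrow> card A = sum_list lam \<Longrightarrow> \<exists>t. t \<in> set_tabloids A lam"
proof (induction lam arbitrary: A)
  case (Cons m lam)
  obtain B where B: "B \<subseteq> A" "card B = m"
    using Cons.prems obtain_subset_with_card_n[of m A] by auto
  then have "card (A - B) = sum_list lam"
    using Cons.prems by (simp add: card_Diff_subset finite_subset)
  then obtain s where "s \<in> set_tabloids (A - B) lam" using Cons by blast
  then have "B # s \<in> set_tabloids A (m # lam)" using B by (simp add: set_tabloids_Cons)
  then show ?case by blast
qed (simp add: set_tabloids_Nil)

lemma set_tabloids_subset:
  assumes "t \<in> set_tabloids A lam" "B \<in> set t"
  shows "B \<subseteq> A"
  using assms by (auto simp: set_tabloids_def)

lemma set_tabloids_bij:
  assumes "finite A" "finite A'" "s \<in> set_tabloids A lam" "t \<in> set_tabloids A' lam"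
  shows "\<exists>\<sigma>. bij_betw \<sigma> A A' \<and> map (image \<sigma>) s = t"
  using assms
proof (induction lam arbitrary: A A' s t)
  case Nil
  then show ?case by (simp add: set_tabloids_Nil bij_betw_def)
next
  case (Cons m lam)
  obtain B s' where s: "s = B # s'" "B \<subseteq> A" "card B = m" "s' \<in> set_tabloids (A - B) lam"
    using Cons.prems(3) by (rule set_tabloids_ConsE)
  obtain C t' where t: "t = C # t'" "C \<subseteq> A'" "card C = m" "t' \<in> set_tabloids (A' - C) lam"
    using Cons.prems(4) by (rule set_tabloids_ConsE)
  obtain f where f: "bij_betw f B C"
    using finite_same_card_bij[of B C] s t Cons.prems(1,2) finite_subset[of B A] finite_subset[of C A']
    by auto
  obtain g where g: "bij_betw g (A - B) (A' - C)" "map (image g) s' = t'"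
    using Cons.IH[OF _ _ s(4) t(4)] Cons.prems by auto
  define h where "h x = (if x \<in> B then f x else g x)" for x
  have "bij_betw h (B \<union> (A - B)) (C \<union> (A' - C))"
    unfolding h_def by (intro bij_betw_disjoint_Un f g) auto
  moreover have "h ` B = C" using f by (auto simp: h_def bij_betw_def)
  moreover have "map (image h) s' = map (image g) s'"
  proof (intro list.map_cong refl)
    fix D assume "D \<in> set s'"
    then have "D \<subseteq> A - B" using set_tabloids_subset[OF s(4)] by blast
    then show "h ` D = g ` D" by (intro image_cong refl) (auto simp: h_def)
  qed
  moreover have "B \<union> (A - B) = A" "C \<union> (A' - C) = A'" using s t by auto
  ultimately show ?case using s t g by auto
qed

lemma set_tabloids_transitive:
  assumes "finite A" "s \<in> set_tabloids A lam" "t \<in> set_tabloids A lam"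
  shows "\<exists>\<sigma>. \<sigma> permutes A \<and> map (image \<sigma>) s = t"
proof -
  obtain \<sigma> where \<sigma>: "bij_betw \<sigma> A A" "map (image \<sigma>) s = t"
    using set_tabloids_bij[OF assms(1,1,2,3)] by blast
  define \<tau> where "\<tau> x = (if x \<in> A then \<sigma> x else x)" for x
  have "bij_betw \<tau> A A" using \<sigma>(1) by (subst bij_betw_cong[of A \<tau> \<sigma>]) (auto simp: \<tau>_def)
  then have "\<tau> permutes A" by (rule bij_imp_permutes) (simp add: \<tau>_def)
  moreover have "map (image \<tau>) s = map (image \<sigma>) s"
  proof (intro list.map_cong refl)
    fix D assume "D \<in> set s"
    then have "D \<subseteq> A" using set_tabloids_subset[OF assms(2)] by blast
    then show "\<tau> ` D = \<sigma> ` D" by (intro image_cong refl) (auto simp: \<tau>_def)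
  qed
  ultimately show ?thesis using \<sigma>(2) by auto
qed

lemma image_permutes_tabloid:
  assumes "\<sigma> permutes A" "t \<in> set_tabloids A lam"
  shows "map (image \<sigma>) t \<in> set_tabloids A lam"
proof -
  have inj: "inj \<sigma>" using assms(1) by (rule permutes_inj)
  have "\<Union> (set (map (image \<sigma>) t)) = \<sigma> ` \<Union> (set t)" by auto
  then show ?thesis
    using assms inj
    by (auto simp: set_tabloids_def permutes_image card_image inj_on_subset[OF inj]
        image_Int[OF inj, symmetric])
qed

lemma permutes_restrict:
  assumes "\<sigma> permutes A" "B \<subseteq> A" "\<sigma> ` B = B"
  shows "(\<lambda>x. if x \<in> B then \<sigma> x else x) permutes B"
proof (rule bij_imp_permutes)
  have "inj_on \<sigma> B" using permutes_inj[OF assms(1)] by (rule inj_on_subset) simp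
  then show "bij_betw (\<lambda>x. if x \<in> B then \<sigma> x else x) B B"
    using assms(3) by (subst bij_betw_cong[of B _ \<sigma>]) (auto simp: bij_betw_def)
qed simp

lemma map_image_cong:
  assumes "\<And>D x. D \<in> set s \<Longrightarrow> x \<in> D \<Longrightarrow> f x = g x"
  shows "map (image f) s = map (image g) s"
  using assms by (intro list.map_cong refl image_cong) auto

lemma card_tabloid_stabilizer:
  assumes "finite A" "t \<in> set_tabloids A lam"
  shows "card {\<sigma>. \<sigma> permutes A \<and> map (image \<sigma>) t = t} = prod_list (map fact lam)"
  using assms
proof (induction lam arbitrary: A t)
  case Nil
  then show ?case by (simp add: set_tabloids_Nil)
next
  case (Cons m lam)
  obtain B s where t: "t = B # s" "B \<subseteq> A" "card B = m" "s \<in> set_tabloids (A - B) lam"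
    using Cons.prems(2) by (rule set_tabloids_ConsE)
  let ?P = "{\<alpha>. \<alpha> permutes B}" and ?Q = "{\<beta>. \<beta> permutes (A - B) \<and> map (image \<beta>) s = s}"
  let ?S = "{\<sigma>. \<sigma> permutes A \<and> map (image \<sigma>) t = t}"
  let ?r = "\<lambda>\<sigma> C x. if x \<in> C then \<sigma> x else x"
  have sub: "D \<subseteq> A - B" if "D \<in> set s" for D
    using set_tabloids_subset[OF t(4) that] .
  have fin: "finite B" using t(2) Cons.prems(1) by (rule finite_subset)
  have val: "(\<alpha> \<circ> \<beta>) x = (if x \<in> B then \<alpha> x else \<beta> x)" if "\<alpha> permutes B" "\<beta> permutes (A - B)" for \<alpha> \<beta> x
  proof (cases "x \<in> A - B")
    case True
    then have "\<beta> x \<in> A - B" using permutes_in_image[OF that(2), of x] by blast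
    then show ?thesis using True permutes_not_in[OF that(1), of "\<beta> x"] by simp
  next
    case False
    then show ?thesis
      using permutes_not_in[OF that(2), of x] permutes_not_in[OF that(1), of x] by simp
  qed
  have "bij_betw (\<lambda>(\<alpha>, \<beta>). \<alpha> \<circ> \<beta>) (?P \<times> ?Q) ?S"
  proof (rule bij_betw_byWitness[where f' = "\<lambda>\<sigma>. (?r \<sigma> B, ?r \<sigma> (A - B))"])
    show "\<forall>p\<in>?P \<times> ?Q. (?r (case p of (\<alpha>, \<beta>) \<Rightarrow> \<alpha> \<circ> \<beta>) B, ?r (case p of (\<alpha>, \<beta>) \<Rightarrow> \<alpha> \<circ> \<beta>) (A - B)) = p"
      using val by (auto simp: fun_eq_iff permutes_not_in simp del: comp_apply)
    show "(\<lambda>(\<alpha>, \<beta>). \<alpha> \<circ> \<beta>) ` (?P \<times> ?Q) \<subseteq> ?S"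
    proof clarify
      fix \<alpha> \<beta> assume \<alpha>: "\<alpha> permutes B" and \<beta>: "\<beta> permutes (A - B)" "map (image \<beta>) s = s"
      have "\<alpha> \<circ> \<beta> permutes A"
        using permutes_subset[OF \<alpha> t(2)] permutes_subset[OF \<beta>(1)] by (intro permutes_compose) auto
      moreover have "(\<alpha> \<circ> \<beta>) ` B = \<alpha> ` B"
        using val[OF \<alpha> \<beta>(1)] by (intro image_cong refl) simp
      moreover have "map (image (\<alpha> \<circ> \<beta>)) s = map (image \<beta>) s"
        using val[OF \<alpha> \<beta>(1)] sub by (intro map_image_cong) fastforce
      ultimately show "\<alpha> \<circ> \<beta> permutes A \<and> map (image (\<alpha> \<circ> \<beta>)) t = t"
        using t(1) \<beta>(2) permutes_image[OF \<alpha>] by simp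
    qed
    show *: "(\<lambda>\<sigma>. (?r \<sigma> B, ?r \<sigma> (A - B))) ` ?S \<subseteq> ?P \<times> ?Q"
    proof (rule image_subsetI)
      fix \<sigma> assume "\<sigma> \<in> ?S"
      then have \<sigma>: "\<sigma> permutes A" "map (image \<sigma>) t = t" by auto
      then have B: "\<sigma> ` B = B" and s: "map (image \<sigma>) s = s" using t(1) by auto
      have AB: "\<sigma> ` (A - B) = A - B"
        using B permutes_image[OF \<sigma>(1)] image_set_diff[OF permutes_inj[OF \<sigma>(1)]] by metis
      have "?r \<sigma> B permutes B" "?r \<sigma> (A - B) permutes (A - B)"
        by (rule permutes_restrict[OF \<sigma>(1) t(2) B] permutes_restrict[OF \<sigma>(1) Diff_subset AB])+
      moreover have "map (image (?r \<sigma> (A - B))) s = map (image \<sigma>) s"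
        using sub by (intro map_image_cong) auto
      ultimately show "(?r \<sigma> B, ?r \<sigma> (A - B)) \<in> ?P \<times> ?Q" using s by simp
    qed
    show "\<forall>\<sigma>\<in>?S. (case (?r \<sigma> B, ?r \<sigma> (A - B)) of (\<alpha>, \<beta>) \<Rightarrow> \<alpha> \<circ> \<beta>) = \<sigma>"
    proof
      fix \<sigma> assume \<sigma>: "\<sigma> \<in> ?S"
      then have "?r \<sigma> B permutes B" "?r \<sigma> (A - B) permutes (A - B)" using * by auto
      from val[OF this] have "(?r \<sigma> B \<circ> ?r \<sigma> (A - B)) x = \<sigma> x" for x
        using \<sigma> permutes_not_in[of \<sigma> A x] t(2) by auto
      then show "(case (?r \<sigma> B, ?r \<sigma> (A - B)) of (\<alpha>, \<beta>) \<Rightarrow> \<alpha> \<circ> \<beta>) = \<sigma>"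
        by (simp add: fun_eq_iff)
    qed
  qed
  then have "card (?P \<times> ?Q) = card ?S" by (rule bij_betw_same_card)
  then have "card ?S = card ?P * card ?Q"
    unfolding card_cartesian_product by (rule sym)
  also have "\<dots> = fact m * prod_list (map fact lam)"
    using card_permutations[OF t(3) fin] Cons.IH[OF _ t(4)] Cons.prems(1) by simp
  finally show ?case by simp
qed

section \<open>The symmetric group\<close>

lemma finite_sym_group: "finite (carrier (sym_group n))"
  by (simp add: sym_group_def finite_permutations)

lemma sym_group_pow: "\<sigma> [^]\<^bsub>sym_group n\<^esub> (k::nat) = \<sigma> ^^ k"
proof (induction k)
  case 0
  interpret group "sym_group n" by (rule sym_group_is_group)
  show ?case by (simp add: sym_group_one)
next
  case (Suc k)
  interpret group "sym_group n" by (rule sym_group_is_group)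
  show ?case using Suc by (simp add: sym_group_mult funpow_Suc_right del: funpow.simps)
qed

lemma left_action_tabloids:
  "left_action (sym_group n) (tabloids n lam) (\<lambda>\<sigma>. map (image \<sigma>))"
  unfolding left_action_def tabloids_eq
  by (auto simp: image_permutes_tabloid sym_group_carrier sym_group_one sym_group_mult image_comp)

lemma exists_cycle:
  fixes B :: "nat set"
  assumes "finite B" "card B > 0"
  obtains \<sigma> where "\<sigma> permutes B" "\<sigma> ^^ card B = id" "\<And>i. 0 < i \<Longrightarrow> i < card B \<Longrightarrow> \<sigma> ^^ i \<noteq> id"
proof -
  obtain cs where cs: "set cs = B" "distinct cs" using finite_distinct_list[OF assms(1)] by blast
  then have len: "length cs = card B" by (metis distinct_card)
  have "cycle_of_list cs ^^ i \<noteq> id" if i: "0 < i" "i < card B" for i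
  proof
    assume "cycle_of_list cs ^^ i = id"
    then have "rotate i cs = cs"
      using cyclic_rotation[OF cs(2), of i] by simp
    moreover have "rotate i cs ! 0 = cs ! i"
      using i len by (simp add: nth_rotate)
    ultimately have "cs ! 0 = cs ! i" by simp
    then show False
      using nth_eq_iff_index_eq[OF cs(2), of 0 i] i len by simp
  qed
  then show thesis
    using that[of "cycle_of_list cs"] cycle_permutes[of cs] cycle_is_id_root[OF cs(2)] cs(1) len by simp
qed

lemma image_mset_repeat_mset: "image_mset f (repeat_mset q M) = repeat_mset q (image_mset f M)"
  by (induction q) simp_all

lemma image_mset_cyclic:
  assumes "p > 0" "f p = f (0::nat)"
  shows "image_mset (\<lambda>i. f (Suc i)) (mset_set {..<p}) = image_mset f (mset_set {..<p})"
proof -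
  have "image_mset Suc (mset_set {..<p}) = mset_set (Suc ` {..<p})"
    by (rule image_mset_mset_set) simp
  also have "Suc ` {..<p} = insert p {1..<p}"
    using assms(1) by (auto simp: image_Suc_lessThan)
  finally have Suc: "image_mset Suc (mset_set {..<p}) = mset_set (insert p {1..<p})" .
  have "image_mset (\<lambda>i. f (Suc i)) (mset_set {..<p}) = image_mset f (mset_set (insert p {1..<p}))"
    unfolding Suc[symmetric] multiset.map_comp comp_def ..
  also have "\<dots> = add_mset (f 0) (image_mset f (mset_set {1..<p}))"
    using assms(2) by simp
  also have "\<dots> = image_mset f (mset_set (insert 0 {1..<p}))"
    by simp
  also have "insert 0 {1..<p} = {..<p}" using assms(1) by auto
  finally show ?thesis .
qed

lemma projective_symmetric_power_fixed_point_free: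
  assumes F: "field F" and char: "has_positive_char F p"
    and proj: "projective_module (group_algebra F (sym_group n))
      (symmetric_power F (sym_group n) a (young_module F n lam))"
    and B: "B \<subseteq> {1..n}" "card B = p"
  shows "\<exists>\<sigma>. \<sigma> permutes B \<and> \<sigma> ^^ p = id \<and>
    (\<forall>x\<in>multisets_of_size (tabloids n lam) a. image_mset (map (image \<sigma>)) x \<noteq> x)"
proof -
  let ?G = "sym_group n" and ?act = "\<lambda>\<sigma>. map (image \<sigma>)"
  interpret F: field F by fact
  interpret finite_group_algebra F ?G
    by (intro finite_group_algebra.intro finite_group_algebra_axioms.intro sym_group_is_group
        F.is_cring finite_sym_group)
  have p: "p > 0" "[p] \<cdot>\<^bsub>F\<^esub> \<one>\<^bsub>F\<^esub> = \<zero>\<^bsub>F\<^esub>" using char by (auto simp: has_positive_char_def)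
  have "finite B" using B(1) finite_subset by blast
  then obtain \<sigma> where \<sigma>: "\<sigma> permutes B" "\<sigma> ^^ p = id" "\<And>i. 0 < i \<Longrightarrow> i < p \<Longrightarrow> \<sigma> ^^ i \<noteq> id"
    using exists_cycle[of B] B(2) p(1) by metis
  have \<sigma>G: "\<sigma> \<in> carrier ?G"
    using permutes_subset[OF \<sigma>(1) B(1)] by (simp add: sym_group_carrier)
  have fin: "finite (tabloids n lam)" by (simp add: tabloids_eq finite_set_tabloids)
  let ?X = "multisets_of_size (tabloids n lam) a"
  let ?S = "symmetric_power F ?G a (young_module F n lam)"
  let ?U = "permutation_module F ?G ?X (\<lambda>g. image_mset (?act g))"
  obtain h where h: "h \<in> left_module_hom FG ?S ?U" "bij_betw h (carrier ?S) (carrier ?U)"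
    using symmetric_power_permutation_module(2)[OF left_action_tabloids fin, of a]
    unfolding young_module_def by blast
  have "image_mset (?act \<sigma>) x \<noteq> x" if "x \<in> ?X" for x
    using projective_permutation_moduleD[OF left_action_multisets[OF left_action_tabloids] proj h
        F.one_not_zero p(2) \<sigma>G p(1) _ _ that] \<sigma>(2,3)
    by (simp add: sym_group_pow sym_group_one)
  with \<sigma>(1,2) show ?thesis by blast
qed

lemma tabloids_nonempty:
  assumes "partition_of lam n"
  obtains t where "t \<in> tabloids n lam"
  using set_tabloids_nonempty[of "{1..n}" lam] assms by (auto simp: tabloids_eq partition_of_def)

theorem proposition3p9:
  fixes F :: "('a, 'b) ring_scheme" and p n a :: nat and lam :: "nat list"
  assumes "field F" and "has_positive_char F p"
    and "n > 0" and "partition_of lam n"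
  shows "projective_module (group_algebra F (sym_group n))
           (symmetric_power F (sym_group n) a (young_module F n lam))
         \<longleftrightarrow> n < p \<or> (\<not> p dvd a \<and> (\<forall>i<length lam. lam ! i < p))"
proof
  let ?P = "symmetric_power F (sym_group n) a (young_module F n lam)"
  let ?\<Omega> = "tabloids n lam" and ?X = "multisets_of_size (tabloids n lam) a"
  interpret F: field F by fact
  have p: "p > 0" using assms(2) by (simp add: has_positive_char_def)
  have fin: "finite ?\<Omega>" by (simp add: tabloids_eq finite_set_tabloids)
  obtain t\<^sub>0 where t0: "t\<^sub>0 \<in> ?\<Omega>" using tabloids_nonempty[OF assms(4)] .
  {
    assume proj: "projective_module (group_algebra F (sym_group n)) ?P"
    show "n < p \<or> (\<not> p dvd a \<and> (\<forall>i<length lam. lam ! i < p))"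
    proof (rule ccontr)
      assume "\<not> ?thesis"
      then consider (dvd) "p \<le> n" "p dvd a" | (row) i where "i < length lam" "p \<le> lam ! i" "p \<le> n"
        by fastforce
      then show False
      proof cases
        case dvd
        then obtain q where q: "a = p * q" by auto
        obtain B :: "nat set" where B: "B \<subseteq> {1..n}" "card B = p"
          using obtain_subset_with_card_n[of p "{1..n}"] dvd by auto
        then obtain \<sigma> where \<sigma>: "\<sigma> permutes B" "\<sigma> ^^ p = id"
          and free: "\<And>x. x \<in> ?X \<Longrightarrow> image_mset (map (image \<sigma>)) x \<noteq> x"
          using projective_symmetric_power_fixed_point_free[OF assms(1,2) proj B] by blast
        have "\<sigma> permutes {1..n}" using \<sigma>(1) B(1) by (rule permutes_subset)
        define f where "f i = map (image (\<sigma> ^^ i)) t\<^sub>0" for i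
        have "f i \<in> ?\<Omega>" for i
          unfolding f_def using t0 permutes_funpow[OF \<open>\<sigma> permutes {1..n}\<close>]
          by (simp add: tabloids_eq image_permutes_tabloid)
        define x where "x = repeat_mset q (image_mset f (mset_set {..<p}))"
        have "y \<in> ?\<Omega>" if "y \<in># x" for y
        proof -
          have "y \<in># image_mset f (mset_set {..<p})"
            using that unfolding x_def count_greater_zero_iff[symmetric] by simp
          then show ?thesis using \<open>\<And>i. f i \<in> ?\<Omega>\<close> by auto
        qed
        then have "set_mset x \<subseteq> ?\<Omega>" by blast
        then have "x \<in> ?X"
          by (simp add: multisets_of_size_def x_def q)
        moreover have step: "map (image \<sigma>) (f i) = f (Suc i)" for i
          by (simp add: f_def image_comp)
        have "f p = f 0" by (simp add: f_def \<sigma>(2))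
        then have "image_mset (map (image \<sigma>)) (image_mset f (mset_set {..<p})) =
            image_mset f (mset_set {..<p})"
          unfolding multiset.map_comp comp_def step by (rule image_mset_cyclic[OF p])
        then have "image_mset (map (image \<sigma>)) x = x"
          unfolding x_def image_mset_repeat_mset by simp
        ultimately show False using free by blast
      next
        case row
        have t0': "length t\<^sub>0 = length lam" "card (t\<^sub>0 ! i) = lam ! i" "t\<^sub>0 ! i \<subseteq> {1..n}"
          "\<And>j. j < length lam \<Longrightarrow> j \<noteq> i \<Longrightarrow> t\<^sub>0 ! j \<inter> t\<^sub>0 ! i = {}"
          using t0 row(1) by (auto simp: tabloids_def)
        obtain B where B: "B \<subseteq> t\<^sub>0 ! i" "card B = p"
          using obtain_subset_with_card_n[of p "t\<^sub>0 ! i"] row(2) t0'(2) by auto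
        then obtain \<sigma> where \<sigma>: "\<sigma> permutes B"
          and free: "\<And>x. x \<in> ?X \<Longrightarrow> image_mset (map (image \<sigma>)) x \<noteq> x"
          using projective_symmetric_power_fixed_point_free[OF assms(1,2) proj subset_trans[OF B(1) t0'(3)] B(2)]
          by blast
        have "\<sigma> ` (t\<^sub>0 ! j) = t\<^sub>0 ! j" if "j < length t\<^sub>0" for j
        proof (cases "j = i")
          case True
          then show ?thesis using permutes_image[OF permutes_subset[OF \<sigma> B(1)]] by simp
        next
          case False
          then have "\<sigma> y = y" if "y \<in> t\<^sub>0 ! j" for y
            using that t0'(4)[of j] \<open>j < length t\<^sub>0\<close> t0'(1) B(1) permutes_not_in[OF \<sigma>, of y] by auto
          then show ?thesis by simp
        qed
        then have "map (image \<sigma>) t\<^sub>0 = t\<^sub>0"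
          by (intro nth_equalityI) simp_all
        moreover have "replicate_mset a t\<^sub>0 \<in> ?X"
          using t0 by (auto simp: multisets_of_size_def)
        ultimately show False using free[of "replicate_mset a t\<^sub>0"] by simp
      qed
    qed
  next
    assume cond: "n < p \<or> (\<not> p dvd a \<and> (\<forall>i<length lam. lam ! i < p))"
    let ?G = "sym_group n" and ?act = "\<lambda>\<sigma>. map (image \<sigma>)"
    interpret G: group ?G by (rule sym_group_is_group)
    interpret finite_group_algebra F ?G
      by (intro finite_group_algebra.intro finite_group_algebra_axioms.intro G.group_axioms
          F.is_cring finite_sym_group)
    let ?U = "permutation_module F ?G ?X (\<lambda>g. image_mset (?act g))"
    have P: "left_module FG ?P"
      using symmetric_power_permutation_module(1)[OF left_action_tabloids fin]
      unfolding young_module_def .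
    obtain h where h: "h \<in> left_module_hom FG ?P ?U" "bij_betw h (carrier ?P) (carrier ?U)"
      using symmetric_power_permutation_module(2)[OF left_action_tabloids fin, of a]
      unfolding young_module_def by blast
    note weights = projective_of_weights[OF assms(1) G.group_axioms finite_sym_group
        left_action_multisets[OF left_action_tabloids] finite_multisets_of_size[OF fin] P h]
    show "projective_module (group_algebra F (sym_group n)) ?P"
      using cond
    proof
      assume n: "n < p"
      show ?thesis
      proof (rule weights)
        show "(\<Sum>g\<in>carrier ?G. 1) = (fact n :: nat)"
          using card_permutations[of "{1..n}" n] by (simp add: sym_group_def)
        show "[(fact n :: nat)] \<cdot>\<^bsub>F\<^esub> \<one>\<^bsub>F\<^esub> \<noteq> \<zero>\<^bsub>F\<^esub>"
          using F.add_pow_fact_nonzero[OF assms(2) n] .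
      qed
    next
      assume *: "\<not> p dvd a \<and> (\<forall>i<length lam. lam ! i < p)"
      let ?St = "{g \<in> carrier ?G. ?act g t\<^sub>0 = t\<^sub>0}"
      have St: "card ?St = prod_list (map fact lam)"
        using card_tabloid_stabilizer[of "{1..n}" t\<^sub>0 lam] t0
        by (simp add: tabloids_eq sym_group_carrier)
      show ?thesis
      proof (rule weights)
        fix x assume x: "x \<in> ?X"
        have "\<exists>g\<in>carrier ?G. ?act g t\<^sub>0 = t" if "t \<in> ?\<Omega>" for t
          using set_tabloids_transitive[of "{1..n}" t\<^sub>0 lam t] t0 that
          by (auto simp: tabloids_eq sym_group_carrier)
        then show "(\<Sum>g\<in>carrier ?G. count (image_mset (?act (inv\<^bsub>?G\<^esub> g)) x) t\<^sub>0) = a * card ?St"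
          by (rule G.sum_count_transitive[OF finite_sym_group fin left_action_tabloids t0 _ x])
      next
        have "[a] \<cdot>\<^bsub>F\<^esub> \<one>\<^bsub>F\<^esub> \<noteq> \<zero>\<^bsub>F\<^esub>"
          using * F.add_pow_eq_zero_iff[OF assms(2)] by simp
        moreover have "[(card ?St)] \<cdot>\<^bsub>F\<^esub> \<one>\<^bsub>F\<^esub> \<noteq> \<zero>\<^bsub>F\<^esub>"
          unfolding St using * by (intro F.add_pow_prod_fact_nonzero[OF assms(2)]) (auto simp: in_set_conv_nth)
        ultimately show "[(a * card ?St)] \<cdot>\<^bsub>F\<^esub> \<one>\<^bsub>F\<^esub> \<noteq> \<zero>\<^bsub>F\<^esub>"
          unfolding F.add_pow_mult_one[symmetric] by (simp add: F.integral_iff)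
      qed
    qed
  }
qed

end
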